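(* Suppose that the two-sided set partitioning problem (SP) defined in the context is feasible. Then the algorithm BranchPriceAndCut described in the context returns an optimal solution of (SP) in finitely many iterations.
   Context: **Networks.** Time periods $\mathcal T=\{1,\dots,T\}$ with sink period $T+1$; $\mathcal G$ is a finite set of fires; $\mathcal J$ is a finite set of crews, $J=|\mathcal J|$. Crew networks. Each crew must rest every $\varphi$ periods for $\gamma$ periods, and it is assumed that $T<\varphi+\gamma$. Crew $j$ last completed a rest at time $r_j^0$, so its latest possible rest time is $R_j=\min(\varphi+r_j^0,T)$. It has a finite location set $\mathcal L_j$ including its home base $b_j$ and the fires $\mathcal G_j\subseteq\mathcal G$ in its jurisdiction, and an initial location $\ell^1_j$. Nodes: $\mathcal N_j=(\mathcal L_j\times\{2,\dots,T+1\}\times\{0,1\})\cup\{(\ell^1_j,1,0)\}$; a node is (location, time, rested indicator). Arcs $\mathcal A_j$: traveling arcs $(\ell_1,t_1,r)\to(\ell_2,t_2,r)$, $\ell_1\ne\ell_2$, where $t_2-t_1$ is the travel time from $\ell_1$ to $\ell_2$ rounded up to the time discretization; working arcs $(g,t,r)\to(g,t+1,r)$, $g\in\mathcal G_j$, $t\in\mathcal T$; resting arcs $(b_j,t,0)\to(b_j,t',1)$ with $t'-t\ge\gamma$, and base arcs $(b_j,t,r)\to(b_j,t+1,r)$. All arcs go strictly forward in time. Traveling and working arcs from nodes with time $>R_j$ and rested indicator $0$ are removed. Each arc has a cost $c_a$. $\mathcal P_j$ (crew routes) is the set of complete directed paths in this network starting in $(\ell^1_j,1,0)$ and ending at time $T+1$.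 $\mathcal A_j^{gt}$ is the set of arcs leaving $(g,t,0)$ or $(g,t,1)$; $A_{pgt}=1$ if route $p$ uses an arc of $\mathcal A_j^{gt}$, else $0$; $c_p$ is the sum of the arc costs of $p$. Fire networks. Fire $g$ has a finite discretized state set $\mathcal S_g$, initial state $s^1_g$, transition functions $f_{gt}$, and a ceiling map $\lceil s\rceil_{\mathcal S_g}=\min\{\sigma\in\mathcal S_g:\sigma\ge s\}$. Nodes: $(\mathcal S_g\times\{2,\dots,T+1\})\cup\{(s_g^1,1)\}$. An arc $a$ goes from $(s_1,t)$ to $(s_2,t+1)$ when $\lceil f_{gt}(s_1,x)\rceil_{\mathcal S_g}=s_2$ for some number of crews $x\in\{0,\dots,J\}$; $x_a$ is the minimum such number, and the arc has a cost $d_a$. $\mathcal B_g$ is the arc set, $\mathcal B_g^t$ the set of arcs leaving time $t$ with $x_a>0$. $\mathcal Q_g$ (suppression plans) is the set of complete directed paths starting in $(s_g^1,1)$ and ending at time $T+1$; $B_{qt}=\sum x_a$ over the arcs $a\in\mathcal B_g^t$ of $q$; $d_q$ is the sum of the arc costs of $q$. **Problem (SP).** Minimize $\sum_{j}\sum_{p\in\mathcal P_j}c_pz_p+\sum_g\sum_{q\in\mathcal Q_g}d_qy_q$ over binary $y,z$ subject to $\sum_{q\in\mathcal Q_g}y_q=1$ for all $g\in\mathcal G$; $\sum_{p\in\mathcal P_j}z_p=1$ for all $j\in\mathcal J$; and $\sum_{j}\sum_{p\in\mathcal P_j}A_{pgt}z_p-\sum_{q\in\mathcal Q_g}B_{qt}y_q\ge0$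 for all $g\in\mathcal G,t\in\mathcal T$. Let $\sigma_g,\pi_j,\rho_{gt}$ (with $\rho_{gt}\ge0$) be the dual variables of these three families in the linear relaxation. **TwoSidedColumnGeneration.** Given column subsets $\mathcal Q'_g\subseteq\mathcal Q_g$, $\mathcal P'_j\subseteq\mathcal P_j$, the restricted master problem (RMP) is the linear relaxation of (SP) (binarity replaced by nonnegativity) over these columns, together with the current cuts $\mathcal U$ and the branching constraints of the current node. The pricing problems are, for each fire $g$, $\min_{q\in\mathcal Q_g}(d_q+\sum_tB_{qt}\rho_{gt}-\sigma_g)$ and, for each crew $j$, $\min_{p\in\mathcal P_j}(c_p-\sum_{g,t}A_{pgt}\rho_{gt}-\pi_j)$, plus the dual terms of the current cuts, over columns respecting the branching decisions. Initialization: $c\leftarrow\infty$, column sets empty (unless initialized otherwise, see below), $\sigma\leftarrow M'\mathbf 1$, $\pi\leftarrow0$, $\rho\leftarrow M\mathbf 1$ for large $M,M'$. Iterate: Step 1. Solve all pricing problems, with optimal solutions $q_g^*$, $p_j^*$. Step 2. If all pricing problems return solutions with nonnegative reduced cost, stop: if $c<\infty$ return $(c,y,z)$, otherwise return INFEASIBLE. Otherwise add to $\mathcal Q'_g$, $\mathcal P'_j$ every $q_g^*$, $p_j^*$ with negative reduced cost. Step 3. Solve RMP. If it has a feasible solution, let $(y^*,z^* )$ be its solution, of cost $c^*$; update $(y,z)\leftarrow(y^*,z^* )$, $c\leftarrow c^*$, and set $(\sigma,\pi,\rho)$ to an optimal dual solution. Else, take a dual extreme ray $(\sigma^*,\pi^*,\rho^*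 )$ and set $\sigma\leftarrow M'\sigma^*/\|\sigma^*\|_1$, $\pi\leftarrow M'\pi^*/\|\pi^*\|_1$, $\rho\leftarrow M'\rho^*/\|\rho^*\|_1$. **Cuts.** For $t\in\mathcal T$, $\mathcal G_u\subseteq\mathcal G$, $\mathcal J_u\subseteq\mathcal J$, let $\mathcal H$ be the collection of $S\subseteq\mathcal G_u\times\{0,\dots,J\}$ with $\sum_{(g,d)\in S}d\le J-|\mathcal J_u|$ and at most one pair $(g,d)\in S$ for each $g\in\mathcal G_u$. For $\delta_{ugd}\in[0,1]$ and $K_u\in\mathbb R$ with $\sum_{(g,d)\in S}\delta_{ugd}\le K_u$ for all $S\in\mathcal H$, the augmented GUB (A-GUB) cut is $$\sum_{g\in\mathcal G_u}\sum_{q\in\mathcal Q_g}\sum_{d=0}^J\mathbb 1[B_{qt}=d]\,\delta_{ugd}\,y_q+\sum_{j\in\mathcal J_u}\sum_{p\in\mathcal P_j}\mathbb 1\Big[\sum_{g\in\mathcal G_u}A_{pgt}=0\Big]z_p\le|\mathcal J_u|+K_u .$$ (This family includes the GUB cover cuts, obtained with $\delta_{ugd}=\mathbb 1[d\ge D_{ug}]$ and $K_u=|\mathcal G_u|-1$, where $D_{ug}\in\{0,\dots,J\}$ and $\sum_{g\in\mathcal G_u}D_{ug}+|\mathcal J_u|>J$.) Given a fractional solution $(y^*,z^* )$ and $t$, violated A-GUB cuts are sought with $\mathcal G_u=\mathcal G$, $\mathcal J_u=\{j:\sum_{p\in\mathcal P_j}\sum_{g\in\mathcal G}A_{pgt}z^*_p=0\}$,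 by the cut-generating linear program: maximize $\sum_g\sum_{q\in\mathcal Q_g}\sum_{d=0}^J\mathbb 1[B_{qt}=d]y_q^*\delta_{gd}-K$ over $\delta,K$ subject to $\sum_{(g,d)\in S}\delta_{gd}\le K$ for all $S\in\mathcal H$ and $0\le\delta_{gd}\le1$. **Branching.** Let $v(g,t)=\sum_{q\in\mathcal Q_g}B_{qt}^2y_q^*-(\sum_{q\in\mathcal Q_g}B_{qt}y_q^* )^2$ and $w(j,g,t)=\sum_{p\in\mathcal P_j}A_{pgt}^2z_p^*-(\sum_{p\in\mathcal P_j}A_{pgt}z_p^* )^2$. Select an entry with the largest value among all $v(g,t)$ and $w(j,g,t)$ (maximum-variance rule), or, in the dual-aware variant, among the same quantities with $B_{qt}$, $A_{pgt}$ replaced by $B_{qt}\rho^*_{gt}$, $A_{pgt}\rho^*_{gt}$, where $\rho^*$ is the vector of dual prices, perturbed by a small positive vector so that $\rho^*>0$. If $v(g,t)$ is selected, with $d=\lfloor\sum_qB_{qt}y_q^*\rfloor$, the two children impose $\sum_{q\in\mathcal Q_g}\mathbb 1[B_{qt}>d]y_q=0$ and $\sum_{q\in\mathcal Q_g}\mathbb 1[B_{qt}>d]y_q=1$ respectively; if $w(j,g,t)$ is selected, the children impose $\sum_{p\in\mathcal P_j}\mathbb 1[A_{pgt}=1]z_p=0$ and $\sum_{p\in\mathcal P_j}\mathbb 1[A_{pgt}=1]z_p=1$ respectively. These are incorporated in the master problem by replacing the set partitioning constraints by constraints of the form $\sum_{q\in\mathcal Q_g}\mathbb 1[d_1<B_{qt}\le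 d_2]y_q=1$ and $\sum_{p\in\mathcal P_j}\mathbb 1[A_{pgt}=k]z_p=1$, and in the pricing problems by removing the arcs violating them. If all variances are zero, fire demands and crew assignments are identical across all columns of positive weight of a given fire or crew, and the fractional solution is converted into an integer solution of the same cost. **BranchPriceAndCut.** Initialize the node set $\mathcal N=\{1\}$, counter $n=0$, node $i=1$, $UB=\infty$, $LB=0$. Repeat: (1) $n\leftarrow n+1$; iterate between (1.a) TwoSidedColumnGeneration, initialized with no columns and no cuts if $i=1$, and otherwise with the columns of the parent node and with $\mathcal U$ the cuts with positive dual price in the parent solution, storing the objective $c$ and the solution $(y,z,\sigma,\pi,\rho)$; and (1.b) for each $t\in\mathcal T$, adding violated cuts to $\mathcal U$, if any. (2) Bounding: set $LB$ to the lower bound among all unexplored leaves. (3) Pruning: (i) if $(y,z)$ is integer and $c<UB$, set $UB\leftarrow c$, store $(y,z)$ as best solution and go to (6); (ii) if $c\ge UB$, prune the node and go to (5). (4) Branching: define two children nodes and append them to $\mathcal N$. (5) Optionally, run an upper-bounding heuristic; if its cost is less than $UB$, update $UB$ and the best solution. (The heuristic starts from demands $\overline D_{gt}=\lceil\sum_qB_{qt}y^*_q\rceil$ and, until a termination criterion is met, e.g. improvements get too small, solves the relaxation by column generation and cuts subject to $\sum_{q\in\mathcal Q_g}\mathbb 1[B_{qt}\le\overline D_{gt}]y_q=1$ for all $g,t$, solves the master problem over the columns generated with integrality constraints, and increments all $\overline D_{gt}$ by $1$.) (6) If $|\mathcal N|=n$, stop and return the best stored solution $(y,z)$; otherwise set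 $i$ to an unexplored node and go to (1).
   Formalization: The dual ray is scaled by one common norm rather than separately for σ, π, ρ (which can wrongly yield INFEASIBLE); there is at least one fire, all arc costs are nonnegative, and the cut-generating LP is solved to an optimal vertex. *)

theory Defs
  imports "Graph_Theory.Arc_Walk" "HOL-Library.Extended_Real"
begin

section \<open>Crew and fire networks\<close>

text \<open>
  Type variables: \<open>'j\<close> crews, \<open>'l\<close> locations, \<open>'s\<close> (linearly ordered) fire states.
  Fires are identified with their locations.
\<close>

datatype arc_kind = Travel | Work | Rest | Base

type_synonym 'l crew_node = "'l \<times> nat \<times> bool"
type_synonym 'l crew_arc = "arc_kind \<times> 'l crew_node \<times> 'l crew_node"
type_synonym 's fire_node = "'s \<times> nat"
type_synonym 's fire_arc = "'s fire_node \<times> 's fire_node"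
type_synonym 'l route = "'l crew_arc list"
type_synonym 's plan = "'s fire_arc list"

text \<open>
  Travel times are real numbers in units of one period.  The time of the last completed rest is an
  integer because it may precede the planning horizon.
\<close>

record ('j, 'l, 's) network =
  horizon :: nat
  fires :: "'l set"
  crews :: "'j set"
  max_work :: nat
  min_rest :: nat
  last_rest :: "'j \<Rightarrow> int"
  locations :: "'j \<Rightarrow> 'l set"
  home :: "'j \<Rightarrow> 'l"
  crew_fires :: "'j \<Rightarrow> 'l set"
  start_loc :: "'j \<Rightarrow> 'l"
  travel_time :: "'l \<Rightarrow> 'l \<Rightarrow> real"
  crew_cost :: "'j \<Rightarrow> 'l crew_arc \<Rightarrow> real"
  states :: "'l \<Rightarrow> 's set"
  start_state :: "'l \<Rightarrow> 's"
  fire_trans :: "'l \<Rightarrow> nat \<Rightarrow> 's \<Rightarrow> nat \<Rightarrow> 's"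
  fire_cost :: "'l \<Rightarrow> 's fire_arc \<Rightarrow> real"

abbreviation periods :: "('j, 'l, 's) network \<Rightarrow> nat set" where
  "periods I \<equiv> {1..horizon I}"

abbreviation ncrews :: "('j, 'l, 's) network \<Rightarrow> nat" where
  "ncrews I \<equiv> card (crews I)"

definition wf_network :: "('j, 'l, 's::linorder) network \<Rightarrow> bool" where
  "wf_network I \<longleftrightarrow>
     finite (fires I) \<and> finite (crews I) \<and>
     0 < min_rest I \<and> horizon I < max_work I + min_rest I \<and>
     (\<forall>j\<in>crews I. finite (locations I j) \<and> home I j \<in> locations I j \<and>
        crew_fires I j \<subseteq> fires I \<and> crew_fires I j \<subseteq> locations I j) \<and>
     (\<forall>j\<in>crews I. \<forall>l \<in> insert (start_loc I j) (locations I j). \<forall>l' \<in> locations I j.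
        l \<noteq> l' \<longrightarrow> 0 < travel_time I l l') \<and>
     (\<forall>g\<in>fires I. finite (states I g))"

definition latest_rest :: "('j, 'l, 's) network \<Rightarrow> 'j \<Rightarrow> int" where
  "latest_rest I j = min (int (max_work I) + last_rest I j) (int (horizon I))"

definition crew_nodes :: "('j, 'l, 's) network \<Rightarrow> 'j \<Rightarrow> 'l crew_node set" where
  "crew_nodes I j = locations I j \<times> {2..horizon I + 1} \<times> UNIV \<union> {(start_loc I j, 1, False)}"

definition must_rest :: "('j, 'l, 's) network \<Rightarrow> 'j \<Rightarrow> 'l crew_node \<Rightarrow> bool" where
  "must_rest I j = (\<lambda>(l, t, r). int t > latest_rest I j \<and> \<not> r)"

definition crew_arcs :: "('j, 'l, 's) network \<Rightarrow> 'j \<Rightarrow> 'l crew_arc set" where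
  "crew_arcs I j =
     {(k, u, v). u \<in> crew_nodes I j \<and> v \<in> crew_nodes I j} \<inter>
     ({(Travel, (l1, t1, r), (l2, t2, r)) | l1 t1 l2 t2 r.
         l1 \<noteq> l2 \<and> int t2 - int t1 = \<lceil>travel_time I l1 l2\<rceil> \<and> \<not> must_rest I j (l1, t1, r)} \<union>
      {(Work, (g, t, r), (g, t + 1, r)) | g t r.
         g \<in> crew_fires I j \<and> t \<in> periods I \<and> \<not> must_rest I j (g, t, r)} \<union>
      {(Rest, (home I j, t, False), (home I j, t', True)) | t t'. t + min_rest I \<le> t'} \<union>
      {(Base, (home I j, t, r), (home I j, t + 1, r)) | t r. True})"

definition crew_digraph :: "('j, 'l, 's) network \<Rightarrow> 'j \<Rightarrow> ('l crew_node, 'l crew_arc) pre_digraph" where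
  "crew_digraph I j = \<lparr>verts = crew_nodes I j, arcs = crew_arcs I j,
     tail = (\<lambda>(k, u, v). u), head = (\<lambda>(k, u, v). v)\<rparr>"

definition routes :: "('j, 'l, 's) network \<Rightarrow> 'j \<Rightarrow> 'l route set" where
  "routes I j = {p. \<exists>l r. pre_digraph.apath (crew_digraph I j)
                             (start_loc I j, 1, False) p (l, horizon I + 1, r)}"

definition leaving_arcs :: "('j, 'l, 's) network \<Rightarrow> 'j \<Rightarrow> 'l \<Rightarrow> nat \<Rightarrow> 'l crew_arc set" where
  "leaving_arcs I j g t = {a \<in> crew_arcs I j. tail (crew_digraph I j) a \<in> {(g, t, False), (g, t, True)}}"

definition assigned :: "('j, 'l, 's) network \<Rightarrow> 'j \<Rightarrow> 'l route \<Rightarrow> 'l \<Rightarrow> nat \<Rightarrow> real" where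
  "assigned I j p g t = of_bool (set p \<inter> leaving_arcs I j g t \<noteq> {})"

definition route_cost :: "('j, 'l, 's) network \<Rightarrow> 'j \<Rightarrow> 'l route \<Rightarrow> real" where
  "route_cost I j p = sum_list (map (crew_cost I j) p)"

text \<open>
  The ceiling of \<open>s\<close> in a state set \<open>S\<close> is defined only if \<open>S\<close> has an element above \<open>s\<close>; a
  transition whose ceiling is undefined yields no arc.
\<close>

definition is_ceiling :: "'s::linorder set \<Rightarrow> 's \<Rightarrow> 's \<Rightarrow> bool" where
  "is_ceiling S s c \<longleftrightarrow> {c \<in> S. s \<le> c} \<noteq> {} \<and> c = Min {c \<in> S. s \<le> c}"

definition fire_nodes :: "('j, 'l, 's) network \<Rightarrow> 'l \<Rightarrow> 's fire_node set" where
  "fire_nodes I g = states I g \<times> {2..horizon I + 1} \<union> {(start_state I g, 1)}"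

definition fire_moves :: "('j, 'l, 's::linorder) network \<Rightarrow> 'l \<Rightarrow> 's fire_arc \<Rightarrow> nat \<Rightarrow> bool" where
  "fire_moves I g = (\<lambda>((s1, t), (s2, t')) x.
     x \<le> ncrews I \<and> is_ceiling (states I g) (fire_trans I g t s1 x) s2)"

definition fire_arcs :: "('j, 'l, 's::linorder) network \<Rightarrow> 'l \<Rightarrow> 's fire_arc set" where
  "fire_arcs I g = {(u, v). u \<in> fire_nodes I g \<and> v \<in> fire_nodes I g \<and> snd v = snd u + 1 \<and>
                            (\<exists>x. fire_moves I g (u, v) x)}"

definition arc_demand :: "('j, 'l, 's::linorder) network \<Rightarrow> 'l \<Rightarrow> 's fire_arc \<Rightarrow> nat" where
  "arc_demand I g a = (LEAST x. fire_moves I g a x)"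

definition fire_digraph :: "('j, 'l, 's::linorder) network \<Rightarrow> 'l \<Rightarrow> ('s fire_node, 's fire_arc) pre_digraph" where
  "fire_digraph I g = \<lparr>verts = fire_nodes I g, arcs = fire_arcs I g, tail = fst, head = snd\<rparr>"

definition plans :: "('j, 'l, 's::linorder) network \<Rightarrow> 'l \<Rightarrow> 's plan set" where
  "plans I g = {q. \<exists>s. pre_digraph.apath (fire_digraph I g) (start_state I g, 1) q (s, horizon I + 1)}"

definition demand_arcs :: "('j, 'l, 's::linorder) network \<Rightarrow> 'l \<Rightarrow> nat \<Rightarrow> 's fire_arc set" where
  "demand_arcs I g t = {a \<in> fire_arcs I g. snd (fst a) = t \<and> 0 < arc_demand I g a}"

definition demand :: "('j, 'l, 's::linorder) network \<Rightarrow> 'l \<Rightarrow> 's plan \<Rightarrow> nat \<Rightarrow> nat" where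
  "demand I g q t = (\<Sum>a \<in> set q \<inter> demand_arcs I g t. arc_demand I g a)"

definition plan_cost :: "('j, 'l, 's) network \<Rightarrow> 'l \<Rightarrow> 's plan \<Rightarrow> real" where
  "plan_cost I g q = sum_list (map (fire_cost I g) q)"


section \<open>The two-sided set partitioning problem\<close>

type_synonym ('l, 's) yvars = "'l \<Rightarrow> 's plan \<Rightarrow> real"
type_synonym ('j, 'l) zvars = "'j \<Rightarrow> 'l route \<Rightarrow> real"

definition cost :: "('j, 'l, 's::linorder) network \<Rightarrow> ('l, 's) yvars \<Rightarrow> ('j, 'l) zvars \<Rightarrow> real" where
  "cost I y z = (\<Sum>j\<in>crews I. \<Sum>p\<in>routes I j. route_cost I j p * z j p) +
                (\<Sum>g\<in>fires I. \<Sum>q\<in>plans I g. plan_cost I g q * y g q)"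

definition sp_constraints :: "('j, 'l, 's::linorder) network \<Rightarrow> ('l, 's) yvars \<Rightarrow> ('j, 'l) zvars \<Rightarrow> bool" where
  "sp_constraints I y z \<longleftrightarrow>
     (\<forall>g\<in>fires I. (\<Sum>q\<in>plans I g. y g q) = 1) \<and>
     (\<forall>j\<in>crews I. (\<Sum>p\<in>routes I j. z j p) = 1) \<and>
     (\<forall>g\<in>fires I. \<forall>t\<in>periods I.
        (\<Sum>j\<in>crews I. \<Sum>p\<in>routes I j. assigned I j p g t * z j p) -
        (\<Sum>q\<in>plans I g. real (demand I g q t) * y g q) \<ge> 0)"

definition binary :: "('j, 'l, 's::linorder) network \<Rightarrow> ('l, 's) yvars \<Rightarrow> ('j, 'l) zvars \<Rightarrow> bool" where
  "binary I y z \<longleftrightarrow> (\<forall>g\<in>fires I. \<forall>q\<in>plans I g. y g q \<in> {0, 1}) \<and>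
                   (\<forall>j\<in>crews I. \<forall>p\<in>routes I j. z j p \<in> {0, 1})"

definition sp_feasible :: "('j, 'l, 's::linorder) network \<Rightarrow> ('l, 's) yvars \<Rightarrow> ('j, 'l) zvars \<Rightarrow> bool" where
  "sp_feasible I y z \<longleftrightarrow> binary I y z \<and> sp_constraints I y z"

definition sp_optimal :: "('j, 'l, 's::linorder) network \<Rightarrow> ('l, 's) yvars \<Rightarrow> ('j, 'l) zvars \<Rightarrow> bool" where
  "sp_optimal I y z \<longleftrightarrow> sp_feasible I y z \<and> (\<forall>y' z'. sp_feasible I y' z' \<longrightarrow> cost I y z \<le> cost I y' z')"


section \<open>Cuts\<close>

record ('j, 'l) cut =
  cut_time :: nat
  cut_fires :: "'l set"
  cut_crews :: "'j set"
  cut_coeff :: "'l \<Rightarrow> nat \<Rightarrow> real"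
  cut_bound :: real

definition demand_packings :: "('j, 'l, 's) network \<Rightarrow> 'l set \<Rightarrow> 'j set \<Rightarrow> ('l \<times> nat) set set" where
  "demand_packings I G J = {S. S \<subseteq> G \<times> {0..ncrews I} \<and>
     (\<Sum>(g, d)\<in>S. int d) \<le> int (ncrews I) - int (card J) \<and>
     (\<forall>g d d'. (g, d) \<in> S \<and> (g, d') \<in> S \<longrightarrow> d = d')}"

text \<open>The coefficients are set to 0 outside their index range, so that equal cuts are equal records.\<close>

definition agub :: "('j, 'l, 's) network \<Rightarrow> 'l set \<Rightarrow> 'j set \<Rightarrow> ('l \<Rightarrow> nat \<Rightarrow> real) \<Rightarrow> real \<Rightarrow> bool" where
  "agub I G J \<delta> K \<longleftrightarrow>
     (\<forall>g d. if g \<in> G \<and> d \<le> ncrews I then 0 \<le> \<delta> g d \<and> \<delta> g d \<le> 1 else \<delta> g d = 0) \<and>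
     (\<forall>S\<in>demand_packings I G J. (\<Sum>(g, d)\<in>S. \<delta> g d) \<le> K)"

definition plan_coeff :: "('j, 'l, 's::linorder) network \<Rightarrow> ('j, 'l) cut \<Rightarrow> 'l \<Rightarrow> 's plan \<Rightarrow> real" where
  "plan_coeff I u g q = (if g \<in> cut_fires u
     then \<Sum>d = 0..ncrews I. of_bool (demand I g q (cut_time u) = d) * cut_coeff u g d else 0)"

definition route_coeff :: "('j, 'l, 's) network \<Rightarrow> ('j, 'l) cut \<Rightarrow> 'j \<Rightarrow> 'l route \<Rightarrow> real" where
  "route_coeff I u j p = (if j \<in> cut_crews u
     then of_bool ((\<Sum>g\<in>cut_fires u. assigned I j p g (cut_time u)) = 0) else 0)"

definition cut_rhs :: "('j, 'l) cut \<Rightarrow> real" where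
  "cut_rhs u = real (card (cut_crews u)) + cut_bound u"

definition satisfies_cut :: "('j, 'l, 's::linorder) network \<Rightarrow> ('l, 's) yvars \<Rightarrow> ('j, 'l) zvars \<Rightarrow> ('j, 'l) cut \<Rightarrow> bool" where
  "satisfies_cut I y z u \<longleftrightarrow>
     (\<Sum>g\<in>fires I. \<Sum>q\<in>plans I g. plan_coeff I u g q * y g q) +
     (\<Sum>j\<in>crews I. \<Sum>p\<in>routes I j. route_coeff I u j p * z j p) \<le> cut_rhs u"

definition idle_crews :: "('j, 'l, 's) network \<Rightarrow> nat \<Rightarrow> ('j, 'l) zvars \<Rightarrow> 'j set" where
  "idle_crews I t z = {j \<in> crews I. (\<Sum>p\<in>routes I j. \<Sum>g\<in>fires I. assigned I j p g t * z j p) = 0}"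

definition cglp_value :: "('j, 'l, 's::linorder) network \<Rightarrow> nat \<Rightarrow> ('l, 's) yvars \<Rightarrow> ('l \<Rightarrow> nat \<Rightarrow> real) \<Rightarrow> real \<Rightarrow> real" where
  "cglp_value I t y \<delta> K =
     (\<Sum>g\<in>fires I. \<Sum>q\<in>plans I g. \<Sum>d = 0..ncrews I. of_bool (demand I g q t = d) * y g q * \<delta> g d) - K"

text \<open>
  The cut-generating linear program is solved to an optimal vertex of its feasible region.  The
  vertex condition makes the family of cuts that can ever be generated finite.
\<close>

definition cglp_solution :: "('j, 'l, 's::linorder) network \<Rightarrow> nat \<Rightarrow> ('l, 's) yvars \<Rightarrow> ('j, 'l) zvars
    \<Rightarrow> ('l \<Rightarrow> nat \<Rightarrow> real) \<Rightarrow> real \<Rightarrow> bool" where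
  "cglp_solution I t y z \<delta> K \<longleftrightarrow> (let feas = agub I (fires I) (idle_crews I t z) in
     feas \<delta> K \<and>
     (\<forall>\<delta>' K'. feas \<delta>' K' \<longrightarrow> cglp_value I t y \<delta>' K' \<le> cglp_value I t y \<delta> K) \<and>
     (\<forall>\<delta>1 K1 \<delta>2 K2. feas \<delta>1 K1 \<and> feas \<delta>2 K2 \<and> K = (K1 + K2) / 2 \<and>
        (\<forall>g d. \<delta> g d = (\<delta>1 g d + \<delta>2 g d) / 2) \<longrightarrow> \<delta>1 = \<delta>2 \<and> K1 = K2))"

definition cglp_cut :: "('j, 'l, 's) network \<Rightarrow> nat \<Rightarrow> ('j, 'l) zvars \<Rightarrow> ('l \<Rightarrow> nat \<Rightarrow> real) \<Rightarrow> real \<Rightarrow> ('j, 'l) cut" where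
  "cglp_cut I t z \<delta> K = \<lparr>cut_time = t, cut_fires = fires I, cut_crews = idle_crews I t z,
     cut_coeff = \<delta>, cut_bound = K\<rparr>"


section \<open>Branching decisions\<close>

datatype ('j, 'l) decision =
    DemandLe 'l nat nat
  | DemandGt 'l nat nat
  | Unassigned 'j 'l nat
  | Assigned 'j 'l nat

definition allowed_plans :: "('j, 'l, 's::linorder) network \<Rightarrow> ('j, 'l) decision set \<Rightarrow> 'l \<Rightarrow> 's plan set" where
  "allowed_plans I D g = {q \<in> plans I g. \<forall>t d.
     (DemandLe g t d \<in> D \<longrightarrow> demand I g q t \<le> d) \<and> (DemandGt g t d \<in> D \<longrightarrow> demand I g q t > d)}"

definition allowed_routes :: "('j, 'l, 's) network \<Rightarrow> ('j, 'l) decision set \<Rightarrow> 'j \<Rightarrow> 'l route set" where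
  "allowed_routes I D j = {p \<in> routes I j. \<forall>g t.
     (Unassigned j g t \<in> D \<longrightarrow> assigned I j p g t = 0) \<and> (Assigned j g t \<in> D \<longrightarrow> assigned I j p g t = 1)}"


section \<open>Restricted master problem and its dual\<close>

type_synonym ('l, 's) plan_sets = "'l \<Rightarrow> 's plan set"
type_synonym ('j, 'l) route_sets = "'j \<Rightarrow> 'l route set"

text \<open>
  The restricted master problem over given columns, cuts and decisions is the linear relaxation in
  which all variables of missing or disallowed columns are fixed to 0.
\<close>

definition rmp_feasible :: "('j, 'l, 's::linorder) network \<Rightarrow> ('j, 'l) decision set \<Rightarrow> ('j, 'l) cut set \<Rightarrow>
    ('l, 's) plan_sets \<Rightarrow> ('j, 'l) route_sets \<Rightarrow> ('l, 's) yvars \<Rightarrow> ('j, 'l) zvars \<Rightarrow> bool" where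
  "rmp_feasible I D U Q P y z \<longleftrightarrow>
     (\<forall>g\<in>fires I. \<forall>q\<in>plans I g. 0 \<le> y g q \<and> (q \<notin> Q g \<inter> allowed_plans I D g \<longrightarrow> y g q = 0)) \<and>
     (\<forall>j\<in>crews I. \<forall>p\<in>routes I j. 0 \<le> z j p \<and> (p \<notin> P j \<inter> allowed_routes I D j \<longrightarrow> z j p = 0)) \<and>
     sp_constraints I y z \<and> (\<forall>u\<in>U. satisfies_cut I y z u)"

definition rmp_optimal :: "('j, 'l, 's::linorder) network \<Rightarrow> ('j, 'l) decision set \<Rightarrow> ('j, 'l) cut set \<Rightarrow>
    ('l, 's) plan_sets \<Rightarrow> ('j, 'l) route_sets \<Rightarrow> ('l, 's) yvars \<Rightarrow> ('j, 'l) zvars \<Rightarrow> bool" where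
  "rmp_optimal I D U Q P y z \<longleftrightarrow> rmp_feasible I D U Q P y z \<and>
     (\<forall>y' z'. rmp_feasible I D U Q P y' z' \<longrightarrow> cost I y z \<le> cost I y' z')"

text \<open>
  A dual vector has the components \<open>\<sigma>\<^sub>g\<close>, \<open>\<pi>\<^sub>j\<close>, \<open>\<rho>\<^sub>g\<^sub>t\<close> and one price per cut,
  which is nonnegative and enters the reduced cost with a positive sign.
\<close>

datatype ('j, 'l) row = Sigma_row 'l | Pi_row 'j | Rho_row 'l nat | Cut_row "('j, 'l) cut"

type_synonym ('j, 'l) dual = "('j, 'l) row \<Rightarrow> real"

definition rows :: "('j, 'l, 's) network \<Rightarrow> ('j, 'l) cut set \<Rightarrow> ('j, 'l) row set" where
  "rows I U = Sigma_row ` fires I \<union> Pi_row ` crews I \<union>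
     (\<lambda>(g, t). Rho_row g t) ` (fires I \<times> periods I) \<union> Cut_row ` U"

definition plan_price :: "('j, 'l, 's::linorder) network \<Rightarrow> ('j, 'l) cut set \<Rightarrow> ('j, 'l) dual \<Rightarrow> 'l \<Rightarrow> 's plan \<Rightarrow> real" where
  "plan_price I U w g q = w (Sigma_row g) - (\<Sum>t\<in>periods I. real (demand I g q t) * w (Rho_row g t)) -
     (\<Sum>u\<in>U. plan_coeff I u g q * w (Cut_row u))"

definition route_price :: "('j, 'l, 's) network \<Rightarrow> ('j, 'l) cut set \<Rightarrow> ('j, 'l) dual \<Rightarrow> 'j \<Rightarrow> 'l route \<Rightarrow> real" where
  "route_price I U w j p =
     w (Pi_row j) + (\<Sum>g\<in>fires I. \<Sum>t\<in>periods I. assigned I j p g t * w (Rho_row g t)) -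
     (\<Sum>u\<in>U. route_coeff I u j p * w (Cut_row u))"

definition plan_reduced_cost :: "('j, 'l, 's::linorder) network \<Rightarrow> ('j, 'l) cut set \<Rightarrow> ('j, 'l) dual \<Rightarrow> 'l \<Rightarrow> 's plan \<Rightarrow> real" where
  "plan_reduced_cost I U w g q = plan_cost I g q - plan_price I U w g q"

definition route_reduced_cost :: "('j, 'l, 's) network \<Rightarrow> ('j, 'l) cut set \<Rightarrow> ('j, 'l) dual \<Rightarrow> 'j \<Rightarrow> 'l route \<Rightarrow> real" where
  "route_reduced_cost I U w j p = route_cost I j p - route_price I U w j p"

definition dual_objective :: "('j, 'l, 's) network \<Rightarrow> ('j, 'l) cut set \<Rightarrow> ('j, 'l) dual \<Rightarrow> real" where
  "dual_objective I U w = (\<Sum>g\<in>fires I. w (Sigma_row g)) + (\<Sum>j\<in>crews I. w (Pi_row j)) -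
     (\<Sum>u\<in>U. cut_rhs u * w (Cut_row u))"

text \<open>With \<open>k = 1\<close> these are the dual constraints, with \<open>k = 0\<close> their recession cone.\<close>

definition dual_constraints :: "('j, 'l, 's::linorder) network \<Rightarrow> ('j, 'l) decision set \<Rightarrow> ('j, 'l) cut set \<Rightarrow>
    ('l, 's) plan_sets \<Rightarrow> ('j, 'l) route_sets \<Rightarrow> real \<Rightarrow> ('j, 'l) dual \<Rightarrow> bool" where
  "dual_constraints I D U Q P k w \<longleftrightarrow>
     (\<forall>g\<in>fires I. \<forall>t\<in>periods I. 0 \<le> w (Rho_row g t)) \<and> (\<forall>u\<in>U. 0 \<le> w (Cut_row u)) \<and>
     (\<forall>g\<in>fires I. \<forall>q \<in> Q g \<inter> allowed_plans I D g. plan_price I U w g q \<le> k * plan_cost I g q) \<and>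
     (\<forall>j\<in>crews I. \<forall>p \<in> P j \<inter> allowed_routes I D j. route_price I U w j p \<le> k * route_cost I j p)"

definition dual_optimal :: "('j, 'l, 's::linorder) network \<Rightarrow> ('j, 'l) decision set \<Rightarrow> ('j, 'l) cut set \<Rightarrow>
    ('l, 's) plan_sets \<Rightarrow> ('j, 'l) route_sets \<Rightarrow> ('j, 'l) dual \<Rightarrow> bool" where
  "dual_optimal I D U Q P w \<longleftrightarrow> dual_constraints I D U Q P 1 w \<and>
     (\<forall>w'. dual_constraints I D U Q P 1 w' \<longrightarrow> dual_objective I U w' \<le> dual_objective I U w)"

text \<open>
  An extreme ray along which the dual objective increases.  As long as some fire or crew has no
  column, the recession cone contains lines and has no extreme ray in the narrow sense.
  Extremality therefore refers to the standard form of the dual, in which a free variable is the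
  difference of two nonnegative ones: only sign-compatible decompositions have to be trivial.  Every
  extreme ray in the narrow sense is extreme in this sense.
\<close>

definition dual_extreme_ray :: "('j, 'l, 's::linorder) network \<Rightarrow> ('j, 'l) decision set \<Rightarrow> ('j, 'l) cut set \<Rightarrow>
    ('l, 's) plan_sets \<Rightarrow> ('j, 'l) route_sets \<Rightarrow> ('j, 'l) dual \<Rightarrow> bool" where
  "dual_extreme_ray I D U Q P w \<longleftrightarrow> dual_constraints I D U Q P 0 w \<and> 0 < dual_objective I U w \<and>
     (\<forall>w1 w2. dual_constraints I D U Q P 0 w1 \<and> dual_constraints I D U Q P 0 w2 \<and>
        (\<forall>r\<in>rows I U. w r = w1 r + w2 r \<and> 0 \<le> w1 r * w2 r) \<longrightarrow>
        (\<exists>k. \<forall>r\<in>rows I U. w1 r = k * w r))"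

text \<open>
  The whole ray is scaled by one common factor.  Scaling its components \<open>\<sigma>\<close>, \<open>\<pi>\<close> and \<open>\<rho>\<close>
  separately would in general not yield a ray, and columns needed for feasibility could be missed.
\<close>

definition scaled_ray :: "('j, 'l, 's) network \<Rightarrow> ('j, 'l) cut set \<Rightarrow> real \<Rightarrow> ('j, 'l) dual \<Rightarrow> ('j, 'l) dual" where
  "scaled_ray I U M' w = (\<lambda>r. M' * w r / (\<Sum>r\<in>rows I U. \<bar>w r\<bar>))"


section \<open>Column generation and cuts\<close>

text \<open>\<open>None\<close> is the answer to a pricing problem without any column.\<close>

definition priced :: "'c set \<Rightarrow> ('c \<Rightarrow> real) \<Rightarrow> 'c option \<Rightarrow> bool" where
  "priced C f x = (case x of None \<Rightarrow> C = {} | Some c \<Rightarrow> is_arg_min f (\<lambda>c. c \<in> C) c)"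

definition pricing :: "('j, 'l, 's::linorder) network \<Rightarrow> ('j, 'l) decision set \<Rightarrow> ('j, 'l) cut set \<Rightarrow> ('j, 'l) dual \<Rightarrow>
    ('l \<Rightarrow> 's plan option) \<Rightarrow> ('j \<Rightarrow> 'l route option) \<Rightarrow> bool" where
  "pricing I D U w qs ps \<longleftrightarrow>
     (\<forall>g\<in>fires I. priced (allowed_plans I D g) (plan_reduced_cost I U w g) (qs g)) \<and>
     (\<forall>j\<in>crews I. priced (allowed_routes I D j) (route_reduced_cost I U w j) (ps j))"

definition new_plans :: "('j, 'l, 's::linorder) network \<Rightarrow> ('j, 'l) cut set \<Rightarrow> ('j, 'l) dual \<Rightarrow>
    ('l \<Rightarrow> 's plan option) \<Rightarrow> ('l, 's) plan_sets" where
  "new_plans I U w qs g = {q. g \<in> fires I \<and> qs g = Some q \<and> plan_reduced_cost I U w g q < 0}"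

definition new_routes :: "('j, 'l, 's) network \<Rightarrow> ('j, 'l) cut set \<Rightarrow> ('j, 'l) dual \<Rightarrow>
    ('j \<Rightarrow> 'l route option) \<Rightarrow> ('j, 'l) route_sets" where
  "new_routes I U w ps j = {p. j \<in> crews I \<and> ps j = Some p \<and> route_reduced_cost I U w j p < 0}"

datatype relax_stage = Generate | Separate | Solved

text \<open>The objective \<open>\<infinity>\<close> of a solved relaxation encodes the answer INFEASIBLE.\<close>

record ('j, 'l, 's) relaxation =
  stage :: relax_stage
  cols_q :: "('l, 's) plan_sets"
  cols_p :: "('j, 'l) route_sets"
  cuts :: "('j, 'l) cut set"
  obj :: ereal
  yval :: "('l, 's) yvars"
  zval :: "('j, 'l) zvars"
  dual :: "('j, 'l) dual"

fun initial_dual :: "real \<Rightarrow> real \<Rightarrow> ('j, 'l) dual" where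
  "initial_dual M M' (Sigma_row g) = M'"
| "initial_dual M M' (Pi_row j) = 0"
| "initial_dual M M' (Rho_row g t) = M"
| "initial_dual M M' (Cut_row u) = 0"

definition start_relaxation :: "real \<Rightarrow> real \<Rightarrow> ('l, 's) plan_sets \<Rightarrow> ('j, 'l) route_sets \<Rightarrow> ('j, 'l) cut set
    \<Rightarrow> ('j, 'l, 's) relaxation" where
  "start_relaxation M M' Q P U = \<lparr>stage = Generate, cols_q = Q, cols_p = P, cuts = U, obj = \<infinity>,
     yval = (\<lambda>_ _. 0), zval = (\<lambda>_ _. 0), dual = initial_dual M M'\<rparr>"

text \<open>
  One iteration of column generation (\<open>feasible\<close>, \<open>infeasible\<close>), its termination
  (\<open>converged\<close>), one round of cuts, after which column generation restarts from the columns at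
  hand (\<open>add_cuts\<close>), and the end of the relaxation (\<open>no_cuts\<close>).
\<close>

inductive relax_step :: "('j, 'l, 's::linorder) network \<Rightarrow> real \<Rightarrow> real \<Rightarrow> ('j, 'l) decision set \<Rightarrow>
    ('j, 'l, 's) relaxation \<Rightarrow> ('j, 'l, 's) relaxation \<Rightarrow> bool"
  for I :: "('j, 'l, 's::linorder) network" and M M' :: real and D :: "('j, 'l) decision set" where
  feasible:
    "relax_step I M M' D s (s\<lparr>cols_q := Q, cols_p := P, obj := ereal (cost I y z),
                             yval := y, zval := z, dual := w\<rparr>)"
    if "stage s = Generate"
       "pricing I D (cuts s) (dual s) qs ps"
       "(\<exists>g. new_plans I (cuts s) (dual s) qs g \<noteq> {}) \<or> (\<exists>j. new_routes I (cuts s) (dual s) ps j \<noteq> {})"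
       "Q = (\<lambda>g. cols_q s g \<union> new_plans I (cuts s) (dual s) qs g)"
       "P = (\<lambda>j. cols_p s j \<union> new_routes I (cuts s) (dual s) ps j)"
       "rmp_optimal I D (cuts s) Q P y z"
       "dual_optimal I D (cuts s) Q P w"
| infeasible:
    "relax_step I M M' D s (s\<lparr>cols_q := Q, cols_p := P, dual := scaled_ray I (cuts s) M' w\<rparr>)"
    if "stage s = Generate"
       "pricing I D (cuts s) (dual s) qs ps"
       "(\<exists>g. new_plans I (cuts s) (dual s) qs g \<noteq> {}) \<or> (\<exists>j. new_routes I (cuts s) (dual s) ps j \<noteq> {})"
       "Q = (\<lambda>g. cols_q s g \<union> new_plans I (cuts s) (dual s) qs g)"
       "P = (\<lambda>j. cols_p s j \<union> new_routes I (cuts s) (dual s) ps j)"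
       "\<nexists>y z. rmp_feasible I D (cuts s) Q P y z"
       "dual_extreme_ray I D (cuts s) Q P w"
| converged:
    "relax_step I M M' D s (s\<lparr>stage := Separate\<rparr>)"
    if "stage s = Generate"
       "pricing I D (cuts s) (dual s) qs ps"
       "\<And>g. new_plans I (cuts s) (dual s) qs g = {}"
       "\<And>j. new_routes I (cuts s) (dual s) ps j = {}"
| add_cuts:
    "relax_step I M M' D s (start_relaxation M M' (cols_q s) (cols_p s) (cuts s \<union> C))"
    if "stage s = Separate"
       "obj s < \<infinity>"
       "\<And>t. t \<in> periods I \<Longrightarrow> cglp_solution I t (yval s) (zval s) (\<delta> t) (K t)"
       "C = {cglp_cut I t (zval s) (\<delta> t) (K t) | t.
               t \<in> periods I \<and> cglp_value I t (yval s) (\<delta> t) (K t) > 0}"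
       "C \<noteq> {}"
| no_cuts:
    "relax_step I M M' D s (s\<lparr>stage := Solved\<rparr>)"
    if "stage s = Separate"
       "obj s < \<infinity> \<longrightarrow> (\<forall>t\<in>periods I. \<forall>\<delta> K. agub I (fires I) (idle_crews I t (zval s)) \<delta> K \<longrightarrow>
          cglp_value I t (yval s) \<delta> K \<le> 0)"


section \<open>Branching rules\<close>

datatype ('j, 'l) entry = Demand_entry 'l nat | Assign_entry 'j 'l nat

definition entries :: "('j, 'l, 's) network \<Rightarrow> ('j, 'l) entry set" where
  "entries I = {Demand_entry g t | g t. g \<in> fires I \<and> t \<in> periods I} \<union>
               {Assign_entry j g t | j g t. j \<in> crews I \<and> g \<in> fires I \<and> t \<in> periods I}"

text \<open>
  The weights \<open>\<omega>\<close> are constantly 1 for the maximum-variance rule, and positively perturbed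
  dual prices of the linking constraints for the dual-aware rule.
\<close>

fun variance :: "('j, 'l, 's::linorder) network \<Rightarrow> ('l \<Rightarrow> nat \<Rightarrow> real) \<Rightarrow> ('l, 's) yvars \<Rightarrow> ('j, 'l) zvars \<Rightarrow>
    ('j, 'l) entry \<Rightarrow> real" where
  "variance I \<omega> y z (Demand_entry g t) =
     (\<Sum>q\<in>plans I g. (real (demand I g q t) * \<omega> g t)\<^sup>2 * y g q) -
     (\<Sum>q\<in>plans I g. real (demand I g q t) * \<omega> g t * y g q)\<^sup>2"
| "variance I \<omega> y z (Assign_entry j g t) =
     (\<Sum>p\<in>routes I j. (assigned I j p g t * \<omega> g t)\<^sup>2 * z j p) -
     (\<Sum>p\<in>routes I j. assigned I j p g t * \<omega> g t * z j p)\<^sup>2"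

definition branching_weights :: "bool \<Rightarrow> ('j, 'l) dual \<Rightarrow> ('l \<Rightarrow> nat \<Rightarrow> real) \<Rightarrow> bool" where
  "branching_weights dual_aware w \<omega> \<longleftrightarrow>
     (if dual_aware then \<exists>\<epsilon>. (\<forall>g t. 0 < \<epsilon> g t) \<and> \<omega> = (\<lambda>g t. w (Rho_row g t) + \<epsilon> g t)
      else \<omega> = (\<lambda>g t. 1))"

definition mean_demand :: "('j, 'l, 's::linorder) network \<Rightarrow> ('l, 's) yvars \<Rightarrow> 'l \<Rightarrow> nat \<Rightarrow> real" where
  "mean_demand I y g t = (\<Sum>q\<in>plans I g. real (demand I g q t) * y g q)"

fun lower_child :: "('j, 'l, 's::linorder) network \<Rightarrow> ('l, 's) yvars \<Rightarrow> ('j, 'l) entry \<Rightarrow> ('j, 'l) decision" where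
  "lower_child I y (Demand_entry g t) = DemandLe g t (nat \<lfloor>mean_demand I y g t\<rfloor>)"
| "lower_child I y (Assign_entry j g t) = Unassigned j g t"

fun upper_child :: "('j, 'l, 's::linorder) network \<Rightarrow> ('l, 's) yvars \<Rightarrow> ('j, 'l) entry \<Rightarrow> ('j, 'l) decision" where
  "upper_child I y (Demand_entry g t) = DemandGt g t (nat \<lfloor>mean_demand I y g t\<rfloor>)"
| "upper_child I y (Assign_entry j g t) = Assigned j g t"

text \<open>
  When all variances vanish, a fractional solution is converted by keeping, for every fire and
  every crew, one of its columns of positive weight.
\<close>

definition converted :: "('j, 'l, 's::linorder) network \<Rightarrow> ('l, 's) yvars \<Rightarrow> ('j, 'l) zvars \<Rightarrow>
    ('l, 's) yvars \<Rightarrow> ('j, 'l) zvars \<Rightarrow> bool" where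
  "converted I y z y' z' \<longleftrightarrow> (\<exists>qs ps.
     (\<forall>g\<in>fires I. qs g \<in> plans I g \<and> 0 < y g (qs g)) \<and>
     (\<forall>j\<in>crews I. ps j \<in> routes I j \<and> 0 < z j (ps j)) \<and>
     y' = (\<lambda>g q. of_bool (q = qs g)) \<and> z' = (\<lambda>j p. of_bool (p = ps j)))"


section \<open>Branch-price-and-cut\<close>

record ('j, 'l, 's) node =
  decisions :: "('j, 'l) decision set"
  node_q :: "('l, 's) plan_sets"
  node_p :: "('j, 'l) route_sets"
  node_cuts :: "('j, 'l) cut set"
  node_bound :: ereal

definition child :: "('j, 'l, 's) node \<Rightarrow> ('j, 'l, 's) relaxation \<Rightarrow> ('j, 'l) decision \<Rightarrow> ('j, 'l, 's) node" where
  "child nd r b = \<lparr>decisions = insert b (decisions nd), node_q = cols_q r, node_p = cols_p r,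
     node_cuts = {u \<in> cuts r. 0 < dual r (Cut_row u)}, node_bound = obj r\<rparr>"

text \<open>
  In the heuristic phases, the number is that of the rounds still to be run, and the function
  holds the current demand limits.
\<close>

datatype ('j, 'l, 's) phase =
    Enter
  | Solving "('j, 'l, 's) relaxation"
  | Heuristic_option "('j, 'l, 's) relaxation"
  | Heuristic nat "'l \<Rightarrow> nat \<Rightarrow> nat" "('j, 'l, 's) relaxation"
  | Heuristic_next nat "'l \<Rightarrow> nat \<Rightarrow> nat" "('j, 'l, 's) relaxation"
  | Select
  | Done

record ('j, 'l, 's) bpc_state =
  nodes :: "('j, 'l, 's) node list"
  explored :: "nat set"
  counter :: nat
  current :: nat
  ub :: ereal
  lb :: ereal
  best :: "(('l, 's) yvars \<times> ('j, 'l) zvars) option"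
  phase :: "('j, 'l, 's) phase"

definition bpc_init :: "('j, 'l, 's) bpc_state" where
  "bpc_init = \<lparr>nodes = [\<lparr>decisions = {}, node_q = (\<lambda>_. {}), node_p = (\<lambda>_. {}), node_cuts = {}, node_bound = 0\<rparr>],
     explored = {}, counter = 0, current = 0, ub = \<infinity>, lb = 0, best = None, phase = Enter\<rparr>"

definition open_nodes :: "('j, 'l, 's) bpc_state \<Rightarrow> nat set" where
  "open_nodes s = {..<length (nodes s)} - explored s"

definition leaf_bound :: "('j, 'l, 's) bpc_state \<Rightarrow> ereal" where
  "leaf_bound s = (INF i\<in>open_nodes s. node_bound (nodes s ! i))"

definition demand_limits :: "('j, 'l, 's) network \<Rightarrow> ('l \<Rightarrow> nat \<Rightarrow> nat) \<Rightarrow> ('j, 'l) decision set" where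
  "demand_limits I c = {DemandLe g t (c g t) | g t. g \<in> fires I \<and> t \<in> periods I}"

definition rmp_integer_optimal :: "('j, 'l, 's::linorder) network \<Rightarrow> ('j, 'l) decision set \<Rightarrow> ('j, 'l, 's) relaxation \<Rightarrow>
    ('l, 's) yvars \<Rightarrow> ('j, 'l) zvars \<Rightarrow> bool" where
  "rmp_integer_optimal I D r y z \<longleftrightarrow> (let feas = (\<lambda>y z. binary I y z \<and> rmp_feasible I D (cuts r) (cols_q r) (cols_p r) y z)
     in feas y z \<and> (\<forall>y' z'. feas y' z' \<longrightarrow> cost I y z \<le> cost I y' z'))"

text \<open>
  The heuristic may warm-start each of its relaxations with any of the columns and cuts at hand
  (in particular with none), and its termination criterion is an arbitrary number of rounds fixed
  at its start.
\<close>

inductive bpc_step :: "('j, 'l, 's::linorder) network \<Rightarrow> real \<Rightarrow> real \<Rightarrow> bool \<Rightarrow>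
    ('j, 'l, 's) bpc_state \<Rightarrow> ('j, 'l, 's) bpc_state \<Rightarrow> bool"
  for I :: "('j, 'l, 's::linorder) network" and M M' :: real and dual_aware :: bool where
  enter:
    "bpc_step I M M' dual_aware s (s\<lparr>counter := counter s + 1, explored := insert (current s) (explored s),
       phase := Solving (start_relaxation M M' (node_q nd) (node_p nd) (node_cuts nd))\<rparr>)"
    if "phase s = Enter" "nd = nodes s ! current s"
| solve:
    "bpc_step I M M' dual_aware s (s\<lparr>phase := Solving r'\<rparr>)"
    if "phase s = Solving r" "relax_step I M M' (decisions (nodes s ! current s)) r r'"
| integral:
    "bpc_step I M M' dual_aware s (s\<lparr>lb := leaf_bound s, ub := obj r, best := Some (yval r, zval r), phase := Select\<rparr>)"
    if "phase s = Solving r" "stage r = Solved"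
       "obj r < ub s" "binary I (yval r) (zval r)"
| prune:
    "bpc_step I M M' dual_aware s (s\<lparr>lb := leaf_bound s, phase := Heuristic_option r\<rparr>)"
    if "phase s = Solving r" "stage r = Solved"
       "obj r \<ge> ub s"
| convert:
    "bpc_step I M M' dual_aware s (s\<lparr>lb := leaf_bound s, ub := obj r, best := Some (y', z'), phase := Select\<rparr>)"
    if "phase s = Solving r" "stage r = Solved"
       "obj r < ub s" "\<not> binary I (yval r) (zval r)"
       "branching_weights dual_aware (dual r) \<omega>"
       "\<And>e. e \<in> entries I \<Longrightarrow> variance I \<omega> (yval r) (zval r) e = 0"
       "converted I (yval r) (zval r) y' z'"
| branch:
    "bpc_step I M M' dual_aware s (s\<lparr>lb := leaf_bound s,
       nodes := nodes s @ [child nd r (lower_child I (yval r) e), child nd r (upper_child I (yval r) e)],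
       phase := Heuristic_option r\<rparr>)"
    if "phase s = Solving r" "stage r = Solved"
       "obj r < ub s" "\<not> binary I (yval r) (zval r)"
       "branching_weights dual_aware (dual r) \<omega>"
       "e \<in> entries I" "variance I \<omega> (yval r) (zval r) e \<noteq> 0"
       "\<And>e'. e' \<in> entries I \<Longrightarrow> variance I \<omega> (yval r) (zval r) e' \<le> variance I \<omega> (yval r) (zval r) e"
       "nd = nodes s ! current s"
| heuristic_skip:
    "bpc_step I M M' dual_aware s (s\<lparr>phase := Select\<rparr>)"
    if "phase s = Heuristic_option r"
| heuristic_start:
    "bpc_step I M M' dual_aware s (s\<lparr>phase := Heuristic k (\<lambda>g t. nat \<lceil>mean_demand I (yval r) g t\<rceil>)
       (start_relaxation M M' Q P U)\<rparr>)"
    if "phase s = Heuristic_option r" "obj r < \<infinity>"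
       "\<And>g. Q g \<subseteq> cols_q r g" "\<And>j. P j \<subseteq> cols_p r j" "U \<subseteq> cuts r"
| heuristic_solve:
    "bpc_step I M M' dual_aware s (s\<lparr>phase := Heuristic k c r'\<rparr>)"
    if "phase s = Heuristic k c r" "relax_step I M M' (demand_limits I c) r r'"
| heuristic_improve:
    "bpc_step I M M' dual_aware s (s\<lparr>ub := ereal (cost I y z), best := Some (y, z), phase := Heuristic_next k c r\<rparr>)"
    if "phase s = Heuristic k c r" "stage r = Solved"
       "rmp_integer_optimal I (demand_limits I c) r y z" "ereal (cost I y z) < ub s"
| heuristic_no_improve:
    "bpc_step I M M' dual_aware s (s\<lparr>phase := Heuristic_next k c r\<rparr>)"
    if "phase s = Heuristic k c r" "stage r = Solved"
       "\<And>y z. rmp_integer_optimal I (demand_limits I c) r y z \<Longrightarrow> \<not> ereal (cost I y z) < ub s"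
| heuristic_again:
    "bpc_step I M M' dual_aware s (s\<lparr>phase := Heuristic k (\<lambda>g t. c g t + 1) (start_relaxation M M' Q P U)\<rparr>)"
    if "phase s = Heuristic_next (Suc k) c r"
       "\<And>g. Q g \<subseteq> cols_q r g" "\<And>j. P j \<subseteq> cols_p r j" "U \<subseteq> cuts r"
| heuristic_stop:
    "bpc_step I M M' dual_aware s (s\<lparr>phase := Select\<rparr>)"
    if "phase s = Heuristic_next 0 c r"
| finish:
    "bpc_step I M M' dual_aware s (s\<lparr>phase := Done\<rparr>)"
    if "phase s = Select" "length (nodes s) = counter s"
| select:
    "bpc_step I M M' dual_aware s (s\<lparr>current := i, phase := Enter\<rparr>)"
    if "phase s = Select" "length (nodes s) \<noteq> counter s" "i \<in> open_nodes s"

end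

theory Submission
  imports Defs
begin

text \<open>
  The algorithm is a transition system. It returns an optimal solution in finitely many iterations if
  it never gets stuck early, never runs forever, and ends with an optimal incumbent.

  \<^emph>\<open>Column generation.\<close> The restricted master problem is a linear program with nonnegative costs and
  bounded feasible region. Such a program has an optimal vertex and, by Farkas' lemma, a dual optimum,
  or else an extreme dual ray, so every iteration can be carried out (\<open>relax_progress\<close>). After it the
  columns at hand have nonnegative reduced cost, so the next priced columns are new; as there are
  finitely many columns, the process ends (\<open>relax_decreases\<close>). At the end there are three cases for the
  prices. If they are dual optimal, they are dual feasible for all allowed columns, and weak duality
  shows that the restricted optimum is optimal (\<open>optimal_full\<close>). If they are a scaled ray, \<open>M'\<close> has to be large:
  up to scaling there are only finitely many extreme rays over all sets of columns and cuts, so a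
  positive price of a normalised ray is bounded away from zero (\<open>price_gap_exists\<close>), and a column of
  positive price would have negative reduced cost. Thus the ray proves infeasibility for all allowed
  columns (\<open>ray_infeasible\<close>). If they are still the initial prices, no allowed route serves
  a fire while every allowed plan demands crews, and again there is no solution (\<open>initial_dual_infeasible\<close>).

  \<^emph>\<open>Cuts.\<close> The cuts hold for integer solutions (\<open>agub_cut_valid\<close>). They come from vertices of finitely many
  polyhedra, so there are finitely many (\<open>finite_cut_universe\<close>), and a violated cut is a new one.

  \<^emph>\<open>Branching.\<close> If some variance is nonzero, the columns of positive weight disagree about the selected
  entry, and each child forbids one of them (\<open>children_smaller\<close>). Hence the tree is finite. If all
  variances vanish, every choice of one column of positive weight per fire and crew is an integer
  solution; none is cheaper than the relaxation, whose cost is an average of theirs, so all have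
  exactly that cost (\<open>converted_optimal\<close>).

  \<^emph>\<open>Optimality.\<close> Every integer solution either costs at least \<open>ub\<close> or respects the decisions of a node that
  is open or being solved (\<open>covered\<close>). When no such node is left, the incumbent is optimal.
\<close>

section \<open>Linear programs over finite index sets\<close>

text \<open>
  Vectors are functions of which only the values on a finite index set matter. Restricted master problems
  have varying columns and cuts, and therefore no common dimension.
\<close>

definition dot :: "'v set \<Rightarrow> ('v \<Rightarrow> real) \<Rightarrow> ('v \<Rightarrow> real) \<Rightarrow> real" where
  "dot N f x = (\<Sum>v\<in>N. f v * x v)"

lemma dot_step: "dot N f (\<lambda>v. x v + s * h v) = dot N f x + s * dot N f h"
  by (simp add: dot_def sum.distrib sum_distrib_left algebra_simps)

lemma dot_step_left: "dot N (\<lambda>v. f v + s * h v) x = dot N f x + s * dot N h x"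
  by (simp add: dot_def sum.distrib sum_distrib_left algebra_simps)

lemma dot_commute: "dot N f x = dot N x f"
  by (simp add: dot_def mult.commute)

lemma dot_cong: "(\<And>v. v \<in> N \<Longrightarrow> f v = f' v) \<Longrightarrow> (\<And>v. v \<in> N \<Longrightarrow> x v = x' v) \<Longrightarrow> dot N f x = dot N f' x'"
  by (simp add: dot_def)

lemma dot_uminus_left: "dot N (\<lambda>v. - f v) x = - dot N f x"
  by (simp add: dot_def sum_negf)

lemma dot_unit: "finite N \<Longrightarrow> c \<in> N \<Longrightarrow> dot N (\<lambda>v. of_bool (v = c)) x = x c"
  by (simp add: dot_def of_bool_def if_distribR if_distrib sum_negf cong: if_cong)

text \<open>
  Induction on the number of inequalities. If dropping inequality \<open>m\<close> destroys the implication, some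
  \<open>x0\<close> satisfies the others but has \<open>c x0 > 0\<close>, hence \<open>a m x0 > 0\<close>. The projection along \<open>x0\<close> onto the
  hyperplane \<open>a m x = 0\<close> eliminates \<open>m\<close>, and multipliers of the projected system extend to \<open>m\<close>.
\<close>

lemma farkas:
  fixes a :: "'i \<Rightarrow> 'v \<Rightarrow> real"
  assumes "finite M" "finite N"
    and "\<And>x. \<forall>i\<in>M. dot N (a i) x \<le> 0 \<Longrightarrow> dot N c x \<le> 0"
  shows "\<exists>l. (\<forall>i\<in>M. 0 \<le> l i) \<and> (\<forall>v\<in>N. c v = (\<Sum>i\<in>M. l i * a i v))"
  using assms(1,3)
proof (induction M arbitrary: a c rule: finite_induct)
  case empty
  \<comment> \<open>A functional that is nowhere positive vanishes, as seen at its own coefficient vector.\<close>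
  have "dot N c c \<le> 0" using empty by simp
  then have "(\<Sum>v\<in>N. c v * c v) = 0"
    by (simp add: dot_def sum_nonneg order_antisym)
  then show ?case
    using assms(2) by (simp add: sum_nonneg_eq_0_iff)
next
  case (insert m M)
  show ?case
  proof (cases "\<forall>x. (\<forall>i\<in>M. dot N (a i) x \<le> 0) \<longrightarrow> dot N c x \<le> 0")
    case True
    then obtain l where l: "\<forall>i\<in>M. 0 \<le> l i" "\<forall>v\<in>N. c v = (\<Sum>i\<in>M. l i * a i v)"
      using insert.IH[of a c] by blast
    have "(\<Sum>i\<in>insert m M. (l(m := 0)) i * a i v) = (\<Sum>i\<in>M. l i * a i v)" for v
      using insert.hyps by (auto intro!: sum.cong)
    then show ?thesis
      using l by (intro exI[of _ "l(m := 0)"]) auto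
  next
    case False
    then obtain x0 where x0: "\<forall>i\<in>M. dot N (a i) x0 \<le> 0" "dot N c x0 > 0"
      by (auto simp: not_le)
    define k where "k = dot N (a m) x0"
    have "k > 0"
      using insert.prems[of x0] x0 unfolding k_def by force
    define a' where "a' i v = a i v + (- (dot N (a i) x0 / k)) * a m v" for i v
    define c' where "c' v = c v + (- (dot N c x0 / k)) * a m v" for v
    have "dot N c' x \<le> 0" if x: "\<forall>i\<in>M. dot N (a' i) x \<le> 0" for x
    proof -
      define y where "y v = x v + (- (dot N (a m) x / k)) * x0 v" for v
      have "dot N (a m) y = 0"
        using \<open>k > 0\<close> unfolding y_def dot_step k_def by simp
      moreover have "dot N (a i) y = dot N (a' i) x" for i
        unfolding y_def dot_step a'_def dot_step_left by simp
      moreover have "dot N c y = dot N c' x"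
        unfolding y_def dot_step c'_def dot_step_left by simp
      ultimately show ?thesis
        using insert.prems[of y] x by simp
    qed
    then obtain l where l: "\<forall>i\<in>M. 0 \<le> l i" "\<forall>v\<in>N. c' v = (\<Sum>i\<in>M. l i * a' i v)"
      using insert.IH[of a' c'] by blast
    \<comment> \<open>The multiplier of \<open>m\<close> makes both sides agree at \<open>x0\<close>.\<close>
    define lm where "lm = (dot N c x0 - (\<Sum>i\<in>M. l i * dot N (a i) x0)) / k"
    have "(\<Sum>i\<in>M. l i * dot N (a i) x0) \<le> 0"
      using l(1) x0(1) by (intro sum_nonpos) (simp add: mult_nonneg_nonpos)
    then have "lm \<ge> 0"
      using x0(2) \<open>k > 0\<close> by (simp add: lm_def)
    have "c v = (\<Sum>i\<in>insert m M. (l(m := lm)) i * a i v)" if "v \<in> N" for v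
    proof -
      have "(\<Sum>i\<in>insert m M. (l(m := lm)) i * a i v) = lm * a m v + (\<Sum>i\<in>M. l i * a i v)"
        using insert.hyps by (auto intro!: sum.cong)
      moreover have "c v = (\<Sum>i\<in>M. l i * a' i v) + dot N c x0 / k * a m v"
        using l(2)[rule_format, OF that] by (simp only: c'_def)
      moreover have "(\<Sum>i\<in>M. l i * a' i v)
          = (\<Sum>i\<in>M. l i * a i v) - (\<Sum>i\<in>M. l i * dot N (a i) x0) / k * a m v"
        by (simp add: a'_def algebra_simps sum_subtractf sum_distrib_left sum_divide_distrib)
      ultimately show ?thesis
        by (simp add: lm_def diff_divide_distrib algebra_simps)
    qed
    then show ?thesis
      using l(1) \<open>lm \<ge> 0\<close> by (intro exI[of _ "l(m := lm)"]) auto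
  qed
qed

definition feas :: "'i set \<Rightarrow> 'v set \<Rightarrow> ('i \<Rightarrow> 'v \<Rightarrow> real) \<Rightarrow> ('i \<Rightarrow> real) \<Rightarrow> ('v \<Rightarrow> real) \<Rightarrow> bool" where
  "feas M N a b x \<longleftrightarrow> (\<forall>i\<in>M. dot N (a i) x \<le> b i)"

definition tight :: "'i set \<Rightarrow> 'v set \<Rightarrow> ('i \<Rightarrow> 'v \<Rightarrow> real) \<Rightarrow> ('i \<Rightarrow> real) \<Rightarrow> ('v \<Rightarrow> real) \<Rightarrow> 'i set" where
  "tight M N a b x = {i \<in> M. dot N (a i) x = b i}"

text \<open>
  A vertex is a point at which no nonzero direction keeps all tight inequalities tight. With this
  description a vertex is determined by its tight inequalities, without any rank argument.
\<close>

definition vertex :: "'i set \<Rightarrow> 'v set \<Rightarrow> ('i \<Rightarrow> 'v \<Rightarrow> real) \<Rightarrow> ('i \<Rightarrow> real) \<Rightarrow> ('v \<Rightarrow> real) \<Rightarrow> bool" where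
  "vertex M N a b x \<longleftrightarrow> feas M N a b x \<and>
     (\<forall>h. (\<forall>i\<in>tight M N a b x. dot N (a i) h = 0) \<longrightarrow> (\<forall>v\<in>N. h v = 0))"

text \<open>
  The ratio test of the simplex method: among the inequalities that get tighter along \<open>h\<close>, the one with the
  smallest ratio of slack to speed determines the step. None of them is tight at the start.
\<close>

lemma step_to_boundary:
  assumes "finite M" and x: "feas M N a b x"
    and h: "\<And>i. i \<in> tight M N a b x \<Longrightarrow> dot N (a i) h \<le> 0"
    and blocked: "\<exists>i\<in>M. 0 < dot N (a i) h"
  shows "\<exists>s>0. feas M N a b (\<lambda>v. x v + s * h v) \<and>
           (\<exists>i\<in>M. 0 < dot N (a i) h \<and> i \<in> tight M N a b (\<lambda>v. x v + s * h v))"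
proof -
  define B where "B = {i \<in> M. 0 < dot N (a i) h}"
  define f where "f i = (b i - dot N (a i) x) / dot N (a i) h" for i
  have B: "finite B" "B \<noteq> {}"
    using assms(1) blocked by (auto simp: B_def)
  define s where "s = Min (f ` B)"
  have pos: "0 < f i" if "i \<in> B" for i
    using that x h[of i] by (fastforce simp: f_def B_def feas_def tight_def)
  then have "s > 0"
    using B by (simp add: s_def)
  have "s \<in> f ` B"
    unfolding s_def by (rule Min_in) (use B in auto)
  then obtain i where i: "i \<in> B" "s = f i"
    by blast
  have "dot N (a j) x + s * dot N (a j) h \<le> b j" if "j \<in> M" for j
  proof (cases "j \<in> B")
    case True
    then have "s \<le> f j" using B by (simp add: s_def)
    then show ?thesis
      using True by (simp add: f_def B_def pos_le_divide_eq)
  next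
    case False
    then have "s * dot N (a j) h \<le> 0"
      using that \<open>s > 0\<close> by (simp add: B_def mult_le_0_iff)
    then show ?thesis
      using x that by (fastforce simp: feas_def)
  qed
  moreover have "dot N (a i) x + s * dot N (a i) h = b i"
    using i by (simp add: f_def B_def)
  ultimately show ?thesis
    using \<open>s > 0\<close> i(1) by (intro exI[of _ s]) (auto simp: feas_def tight_def dot_step B_def)
qed

lemma uniform_scale:
  fixes f g :: "'x \<Rightarrow> real"
  assumes "finite X" "\<And>x. x \<in> X \<Longrightarrow> 0 \<le> f x \<and> (f x = 0 \<longrightarrow> g x = 0)"
  shows "\<exists>e>0. \<forall>x\<in>X. e * \<bar>g x\<bar> \<le> f x"
  using assms
proof (induction X rule: finite_induct)
  case empty
  then show ?case by (intro exI[of _ 1]) auto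
next
  case (insert y X)
  then obtain e where e: "e > 0" "\<forall>x\<in>X. e * \<bar>g x\<bar> \<le> f x" by auto
  obtain d where d: "d > 0" "d * \<bar>g y\<bar> \<le> f y"
  proof (cases "g y = 0")
    case True
    then show ?thesis using insert.prems[of y] that[of 1] by auto
  next
    case False
    then have "0 < f y" using insert.prems[of y] by (auto simp: less_le)
    then show ?thesis using False that[of "f y / \<bar>g y\<bar>"] by simp
  qed
  have "min e d * \<bar>g x\<bar> \<le> e * \<bar>g x\<bar>" "min e d * \<bar>g x\<bar> \<le> d * \<bar>g x\<bar>" for x
    by (auto intro: mult_right_mono)
  then show ?case
    using e d by (intro exI[of _ "min e d"]) (auto intro: order_trans)
qed

text \<open>
  A direction that keeps the tight inequalities tight can be followed both ways for a while, so an
  extreme point has no such direction.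
\<close>

lemma two_sided_step:
  assumes "finite M" and x: "feas M N a b x"
    and h: "\<And>i. i \<in> tight M N a b x \<Longrightarrow> dot N (a i) h = 0"
  shows "\<exists>s>0. feas M N a b (\<lambda>v. x v + s * h v) \<and> feas M N a b (\<lambda>v. x v + - s * h v)"
proof -
  have "\<exists>s>0. \<forall>i\<in>M. s * \<bar>dot N (a i) h\<bar> \<le> b i - dot N (a i) x"
    using x h by (intro uniform_scale[OF assms(1)]) (auto simp: feas_def tight_def)
  then obtain s where "s > 0" and s: "\<forall>i\<in>M. s * \<bar>dot N (a i) h\<bar> \<le> b i - dot N (a i) x" by blast
  have "s * d \<le> s * \<bar>d\<bar>" "- s * d \<le> s * \<bar>d\<bar>" for d
    using \<open>s > 0\<close> by (auto simp: abs_if mult_le_0_iff)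
  then show ?thesis
    using \<open>s > 0\<close> s unfolding feas_def dot_step by (intro exI[of _ s]) (smt (verit, best))
qed

text \<open>
  At a point that is no vertex some direction keeps the tight inequalities tight, and it can be chosen
  not to decrease the objective. Following it to the boundary makes a further inequality tight. There is
  a boundary because recession directions decrease the objective.
\<close>

lemma vertex_above:
  assumes "finite M" "feas M N a b x"
    and rec: "\<And>h. \<forall>i\<in>M. dot N (a i) h \<le> 0 \<Longrightarrow> \<exists>v\<in>N. h v \<noteq> 0 \<Longrightarrow> dot N c h < 0"
  shows "\<exists>v. vertex M N a b v \<and> dot N c x \<le> dot N c v"
  using assms(2)
proof (induction "card (M - tight M N a b x)" arbitrary: x rule: less_induct)
  case less
  show ?case
  proof (cases "vertex M N a b x")
    case True
    then show ?thesis by blast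
  next
    case False
    then obtain h where h: "\<And>i. i \<in> tight M N a b x \<Longrightarrow> dot N (a i) h = 0" "\<exists>v\<in>N. h v \<noteq> 0"
      using less.prems by (auto simp: vertex_def)
    define k where "k = (if 0 \<le> dot N c h then 1 else -1 :: real)"
    define h' where "h' v = 0 + k * h v" for v
    have dh': "dot N f h' = k * dot N f h" for f
      unfolding h'_def dot_step by (simp add: dot_def)
    have h': "\<And>i. i \<in> tight M N a b x \<Longrightarrow> dot N (a i) h' = 0" "\<exists>v\<in>N. h' v \<noteq> 0" "0 \<le> dot N c h'"
      using h by (auto simp: dh' k_def h'_def)
    have "\<exists>i\<in>M. 0 < dot N (a i) h'"
      using rec[of h'] h'(2,3) by (meson not_le)
    then obtain s i where s: "s > 0" "feas M N a b (\<lambda>v. x v + s * h' v)"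
      and i: "i \<in> M" "0 < dot N (a i) h'" "i \<in> tight M N a b (\<lambda>v. x v + s * h' v)"
      using step_to_boundary[OF assms(1) less.prems, of h'] h'(1) by force
    let ?y = "\<lambda>v. x v + s * h' v"
    have "tight M N a b x \<subseteq> tight M N a b ?y"
      using h'(1) by (auto simp: tight_def dot_step)
    moreover have "i \<notin> tight M N a b x"
      using h'(1)[of i] i(2) by auto
    ultimately have "M - tight M N a b ?y \<subset> M - tight M N a b x"
      using i by blast
    then have "card (M - tight M N a b ?y) < card (M - tight M N a b x)"
      using assms(1) by (simp add: psubset_card_mono)
    then obtain v where "vertex M N a b v" "dot N c ?y \<le> dot N c v"
      using less.hyps s(2) by blast
    moreover have "dot N c x \<le> dot N c ?y"
      using h'(3) s(1) by (simp add: dot_step)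
    ultimately show ?thesis by fastforce
  qed
qed

lemma vertex_unique:
  assumes "vertex M N a b x" "vertex M N a b y" "tight M N a b x = tight M N a b y" "v \<in> N"
  shows "x v = y v"
proof -
  have "dot N (a i) (\<lambda>v. x v + (-1) * y v) = 0" if "i \<in> tight M N a b x" for i
  proof -
    have "i \<in> tight M N a b y" using that assms(3) by simp
    then show ?thesis using that unfolding dot_step by (simp add: tight_def)
  qed
  then have "\<forall>v\<in>N. x v + (-1) * y v = 0"
    using assms(1) unfolding vertex_def by meson
  then show ?thesis using assms(4) by simp
qed

lemma finite_image_factor:
  assumes "finite (f ` S)" "\<And>x y. x \<in> S \<Longrightarrow> y \<in> S \<Longrightarrow> f x = f y \<Longrightarrow> g x = g y"
  shows "finite (g ` S)"
proof -
  have "g x = g (inv_into S f (f x))" if "x \<in> S" for x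
    by (rule assms(2)) (simp_all add: that inv_into_into f_inv_into_f)
  then have "g ` S \<subseteq> (\<lambda>z. g (inv_into S f z)) ` f ` S" by auto
  then show ?thesis using assms(1) finite_surj by blast
qed

text \<open>A vertex is determined by the set of its tight inequalities, which has finitely many values.\<close>

lemma finite_vertex_image:
  assumes "finite M"
    and "\<And>x y. x \<in> S \<Longrightarrow> y \<in> S \<Longrightarrow> (\<And>v. v \<in> N \<Longrightarrow> x v = y v) \<Longrightarrow> g x = g y"
    and "S \<subseteq> Collect (vertex M N a b)"
  shows "finite (g ` S)"
proof (rule finite_image_factor)
  show "finite (tight M N a b ` S)"
    by (rule finite_subset[of _ "Pow M"]) (use assms(1) in \<open>auto simp: tight_def\<close>)
  show "g x = g y" if "x \<in> S" "y \<in> S" "tight M N a b x = tight M N a b y" for x y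
    using that assms(2,3) vertex_unique[of M N a b x y] by (metis mem_Collect_eq subsetD)
qed

lemma optimal_vertex:
  assumes "finite M" "feas M N a b x0"
    and "\<And>h. \<forall>i\<in>M. dot N (a i) h \<le> 0 \<Longrightarrow> \<exists>v\<in>N. h v \<noteq> 0 \<Longrightarrow> dot N c h < 0"
  shows "\<exists>v. vertex M N a b v \<and> (\<forall>x. feas M N a b x \<longrightarrow> dot N c x \<le> dot N c v)"
proof -
  let ?V = "dot N c ` Collect (vertex M N a b)"
  have "finite ?V"
    by (rule finite_vertex_image[OF assms(1), where N = N and a = a and b = b])
      (simp_all add: dot_def)
  moreover have "?V \<noteq> {}"
    using vertex_above[OF assms] by auto
  ultimately have "Max ?V \<in> ?V"
    by (rule Max_in)
  then obtain v where v: "vertex M N a b v" "dot N c v = Max ?V"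
    by (metis imageE mem_Collect_eq)
  have "dot N c x \<le> dot N c v" if "feas M N a b x" for x
    using vertex_above[OF assms(1) that assms(3)] \<open>finite ?V\<close> v(2)
    by (metis Max_ge imageI mem_Collect_eq order_trans)
  then show ?thesis using v(1) by blast
qed

text \<open>
  Rows in \<open>F\<close> are equations and the other rows of \<open>R\<close> inequalities, so dual prices are free on \<open>F\<close> and
  nonnegative elsewhere.
\<close>

definition lp_feasible ::
    "'c set \<Rightarrow> 'r set \<Rightarrow> 'r set \<Rightarrow> ('r \<Rightarrow> 'c \<Rightarrow> real) \<Rightarrow> ('r \<Rightarrow> real) \<Rightarrow> ('c \<Rightarrow> real) \<Rightarrow> bool" where
  "lp_feasible N R F A b x \<longleftrightarrow> (\<forall>c\<in>N. 0 \<le> x c) \<and> (\<forall>r\<in>R. b r \<le> dot N (A r) x) \<and>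
     (\<forall>r\<in>F. dot N (A r) x = b r)"

abbreviation price :: "'r set \<Rightarrow> ('r \<Rightarrow> 'c \<Rightarrow> real) \<Rightarrow> ('r \<Rightarrow> real) \<Rightarrow> 'c \<Rightarrow> real" where
  "price R A w c \<equiv> dot R w (\<lambda>r. A r c)"

definition lp_dual ::
    "'c set \<Rightarrow> 'r set \<Rightarrow> 'r set \<Rightarrow> ('r \<Rightarrow> 'c \<Rightarrow> real) \<Rightarrow> ('c \<Rightarrow> real) \<Rightarrow> ('r \<Rightarrow> real) \<Rightarrow> bool" where
  "lp_dual N R F A k w \<longleftrightarrow> (\<forall>r\<in>R - F. 0 \<le> w r) \<and> (\<forall>c\<in>N. price R A w c \<le> k c)"

lemma weak_duality:
  assumes "finite N" "finite R" and x: "lp_feasible N R F A b x" and w: "lp_dual N R F A k w"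
  shows "dot R w b \<le> dot N k x"
proof -
  have "dot R w b \<le> (\<Sum>r\<in>R. w r * dot N (A r) x)"
    unfolding dot_def[of R]
  proof (rule sum_mono)
    fix r assume r: "r \<in> R"
    show "w r * b r \<le> w r * dot N (A r) x"
    proof (cases "r \<in> F")
      case True
      then show ?thesis using x by (simp add: lp_feasible_def)
    next
      case False
      then show ?thesis using x w r by (auto simp: lp_feasible_def lp_dual_def intro!: mult_left_mono)
    qed
  qed
  also have "\<dots> = (\<Sum>c\<in>N. price R A w c * x c)"
    unfolding dot_def sum_distrib_left sum_distrib_right
    by (subst sum.swap) (simp add: mult.assoc)
  also have "\<dots> \<le> dot N k x"
    unfolding dot_def[of N k]
    using x w by (intro sum_mono mult_right_mono) (auto simp: lp_feasible_def lp_dual_def)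
  finally show ?thesis .
qed

text \<open>
  The program as a system of inequalities: all rows, the reversed equations, and the sign constraints.
\<close>

fun lp_row :: "('r \<Rightarrow> 'c \<Rightarrow> real) \<Rightarrow> 'r + 'r + 'c \<Rightarrow> 'c \<Rightarrow> real" where
  "lp_row A (Inl r) = (\<lambda>c. - A r c)"
| "lp_row A (Inr (Inl r)) = A r"
| "lp_row A (Inr (Inr c)) = (\<lambda>c'. - of_bool (c' = c))"

fun lp_bound :: "('r \<Rightarrow> real) \<Rightarrow> 'r + 'r + 'c \<Rightarrow> real" where
  "lp_bound b (Inl r) = - b r"
| "lp_bound b (Inr (Inl r)) = b r"
| "lp_bound b (Inr (Inr c)) = 0"

lemma lp_bound_zero: "lp_bound (\<lambda>_. 0) i = 0"
proof (cases i)
  case (Inr j)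
  then show ?thesis by (cases j) auto
qed simp

lemma ball_Plus: "(\<forall>i\<in>S <+> T. P i) \<longleftrightarrow> (\<forall>i\<in>S. P (Inl i)) \<and> (\<forall>i\<in>T. P (Inr i))"
  by blast

lemma lp_feasible_iff_feas:
  assumes "finite N" "F \<subseteq> R"
  shows "lp_feasible N R F A b x \<longleftrightarrow> feas (R <+> F <+> N) N (lp_row A) (lp_bound b) x"
proof -
  have "(\<forall>r\<in>F. dot N (A r) x = b r) \<longleftrightarrow> (\<forall>r\<in>F. dot N (A r) x \<le> b r)"
    if "\<forall>r\<in>R. b r \<le> dot N (A r) x"
    using that assms(2) by (metis order_antisym order_refl subsetD)
  moreover have "(\<forall>c\<in>N. 0 \<le> x c) \<longleftrightarrow> (\<forall>c\<in>N. 0 \<le> dot N (\<lambda>v. of_bool (v = c)) x)"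
    using assms(1) by (auto simp: dot_unit)
  ultimately show ?thesis
    unfolding lp_feasible_def feas_def ball_Plus by (simp add: dot_uminus_left) blast
qed

lemma cone_farkas:
  assumes fin: "finite N" "finite R" and "F \<subseteq> R"
    and imp: "\<And>x. lp_feasible N R F A (\<lambda>_. 0) x \<Longrightarrow> 0 \<le> dot N k x"
  shows "\<exists>w. lp_dual N R F A k w"
proof -
  have F: "finite F" using fin \<open>F \<subseteq> R\<close> finite_subset by blast
  let ?M = "R <+> F <+> N"
  have "dot N (\<lambda>c. - k c) x \<le> 0" if "\<forall>i\<in>?M. dot N (lp_row A i) x \<le> 0" for x
    using imp[of x] that by (simp add: lp_feasible_iff_feas[OF fin(1) \<open>F \<subseteq> R\<close>] feas_def dot_uminus_left lp_bound_zero)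
  then obtain l where l: "\<forall>i\<in>?M. 0 \<le> l i" "\<forall>c\<in>N. - k c = (\<Sum>i\<in>?M. l i * lp_row A i c)"
    using farkas[of ?M N "lp_row A" "\<lambda>c. - k c"] fin F by auto
  \<comment> \<open>An equation carries two multipliers, whose difference is its free price.\<close>
  define w where "w r = l (Inl r) - (if r \<in> F then l (Inr (Inl r)) else 0)" for r
  have "price R A w c \<le> k c" if c: "c \<in> N" for c
  proof -
    have "- k c = - (\<Sum>r\<in>R. l (Inl r) * A r c) + (\<Sum>r\<in>F. l (Inr (Inl r)) * A r c)
        + (\<Sum>c'\<in>N. l (Inr (Inr c')) * - of_bool (c = c'))"
      using l(2) c fin F by (simp add: sum.Plus sum_negf)
    also have "(\<Sum>c'\<in>N. l (Inr (Inr c')) * - of_bool (c = c')) = - l (Inr (Inr c))"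
      using c fin by (simp add: of_bool_def if_distrib sum_negf cong: if_cong)
    also have "(\<Sum>r\<in>F. l (Inr (Inl r)) * A r c) = (\<Sum>r\<in>R. (if r \<in> F then l (Inr (Inl r)) else 0) * A r c)"
      using fin \<open>F \<subseteq> R\<close> by (intro sum.mono_neutral_cong_left) auto
    finally have "price R A w c = k c - l (Inr (Inr c))"
      unfolding dot_def w_def left_diff_distrib sum_subtractf by linarith
    then show ?thesis using l(1) c by auto
  qed
  moreover have "\<forall>r\<in>R - F. 0 \<le> w r"
    using l(1) by (auto simp: w_def)
  ultimately show ?thesis unfolding lp_dual_def by blast
qed

text \<open>
  The variable \<open>t\<close> homogenises the right-hand side; in the proof it is the additional column \<open>None\<close>.
\<close>

lemma lp_farkas:
  assumes fin: "finite N" "finite R" and "F \<subseteq> R"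
    and imp: "\<And>x t. 0 \<le> t \<Longrightarrow> lp_feasible N R F A (\<lambda>r. t * b r) x \<Longrightarrow> t * g \<le> dot N k x"
  shows "\<exists>w. lp_dual N R F A k w \<and> g \<le> dot R w b"
proof -
  let ?A = "\<lambda>r c. case c of None \<Rightarrow> - b r | Some c \<Rightarrow> A r c"
  let ?k = "\<lambda>c. case c of None \<Rightarrow> - g | Some c \<Rightarrow> k c"
  let ?N = "insert None (Some ` N)"
  have dotN: "dot ?N f x = f None * x None + dot N (f \<circ> Some) (x \<circ> Some)" for f x
    using fin by (simp add: dot_def sum.reindex)
  have "0 \<le> dot ?N ?k x" if "lp_feasible ?N R F ?A (\<lambda>_. 0) x" for x
  proof -
    have "lp_feasible N R F A (\<lambda>r. x None * b r) (x \<circ> Some)"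
      using that by (auto simp: lp_feasible_def dotN comp_def mult.commute)
    moreover have "0 \<le> x None"
      using that by (simp add: lp_feasible_def)
    ultimately show ?thesis
      using imp[of "x None" "x \<circ> Some"] by (simp add: dotN comp_def mult.commute)
  qed
  then obtain w where w: "lp_dual ?N R F ?A ?k w"
    using cone_farkas[of ?N R F ?A ?k] assms by auto
  then have "lp_dual N R F A k w"
    by (simp add: lp_dual_def)
  moreover have "dot R w (\<lambda>r. - b r) = - dot R w b"
    by (metis dot_commute dot_uminus_left)
  then have "g \<le> dot R w b"
    using w by (simp add: lp_dual_def)
  ultimately show ?thesis by blast
qed

lemma lp_feasible_scale:
  assumes "lp_feasible N R F A (\<lambda>r. t * b r) x" "0 < t"
  shows "lp_feasible N R F A b (\<lambda>c. 0 + 1 / t * x c)"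
proof -
  have "dot N f (\<lambda>c. 0) = 0" for f :: "'a \<Rightarrow> real" by (simp add: dot_def)
  then show ?thesis
    using assms unfolding lp_feasible_def dot_step by (auto simp: field_simps)
qed

lemma infeasible_ray:
  assumes fin: "finite N" "finite R" and "F \<subseteq> R" and inf: "\<nexists>x. lp_feasible N R F A b x"
  shows "\<exists>w. lp_dual N R F A (\<lambda>_. 0) w \<and> 0 < dot R w b"
proof -
  have "t * 1 \<le> dot N (\<lambda>_. 0) x" if "0 \<le> t" "lp_feasible N R F A (\<lambda>r. t * b r) x" for t x
    using lp_feasible_scale[OF that(2)] inf that(1) by (cases "t = 0") (auto simp: dot_def)
  from lp_farkas[OF fin \<open>F \<subseteq> R\<close>, of A b 1 "\<lambda>_. 0", OF this] show ?thesis
    by (meson less_le_trans zero_less_one)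
qed

text \<open>
  A point of the homogenised program with \<open>t > 0\<close> can be scaled to a feasible one; for \<open>t = 0\<close> its cost is
  at least 0 because costs are nonnegative. So the bound \<open>g\<close> survives homogenisation.
\<close>

lemma strong_duality:
  assumes fin: "finite N" "finite R" and "F \<subseteq> R" and k: "\<And>c. c \<in> N \<Longrightarrow> 0 \<le> k c"
    and opt: "\<And>x. lp_feasible N R F A b x \<Longrightarrow> g \<le> dot N k x"
  shows "\<exists>w. lp_dual N R F A k w \<and> g \<le> dot R w b"
proof (rule lp_farkas[OF fin \<open>F \<subseteq> R\<close>])
  fix x t assume t: "0 \<le> (t::real)" and x: "lp_feasible N R F A (\<lambda>r. t * b r) x"
  show "t * g \<le> dot N k x"
  proof (cases "t = 0")
    case True
    then show ?thesis
      using x k by (auto simp: lp_feasible_def dot_def intro!: sum_nonneg)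
  next
    case False
    then have "g \<le> 1 / t * dot N k x"
      using opt[OF lp_feasible_scale[OF x]] t unfolding dot_step by (simp add: dot_def)
    then show ?thesis
      using False t by (simp add: field_simps)
  qed
qed

lemma lp_optimum:
  assumes fin: "finite N" "finite R" and "F \<subseteq> R" and x: "lp_feasible N R F A b x"
    and bounded: "\<And>h c. lp_feasible N R F A (\<lambda>_. 0) h \<Longrightarrow> c \<in> N \<Longrightarrow> h c = 0"
  shows "\<exists>x. lp_feasible N R F A b x \<and> (\<forall>x'. lp_feasible N R F A b x' \<longrightarrow> dot N k x \<le> dot N k x')"
proof -
  have F: "finite F" using fin \<open>F \<subseteq> R\<close> finite_subset by blast
  note iff = lp_feasible_iff_feas[OF fin(1) \<open>F \<subseteq> R\<close>]
  have "\<exists>v. vertex (R <+> F <+> N) N (lp_row A) (lp_bound b) v \<and>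
      (\<forall>x. feas (R <+> F <+> N) N (lp_row A) (lp_bound b) x \<longrightarrow> dot N (\<lambda>c. - k c) x \<le> dot N (\<lambda>c. - k c) v)"
    using bounded x fin F by (intro optimal_vertex) (auto simp: iff feas_def lp_bound_zero)
  then show ?thesis
    by (auto simp: vertex_def iff dot_uminus_left)
qed

text \<open>
  Extreme rays of the standard form of the dual, in which a free price is the difference of two
  nonnegative ones: only sign-compatible decompositions have to be trivial.
\<close>

definition lp_ray ::
    "'c set \<Rightarrow> 'r set \<Rightarrow> 'r set \<Rightarrow> ('r \<Rightarrow> 'c \<Rightarrow> real) \<Rightarrow> ('r \<Rightarrow> real) \<Rightarrow> ('r \<Rightarrow> real) \<Rightarrow> bool" where
  "lp_ray N R F A b w \<longleftrightarrow> lp_dual N R F A (\<lambda>_. 0) w \<and> 0 < dot R w b \<and>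
     (\<forall>w1 w2. lp_dual N R F A (\<lambda>_. 0) w1 \<and> lp_dual N R F A (\<lambda>_. 0) w2 \<and>
        (\<forall>r\<in>R. w r = w1 r + w2 r \<and> 0 \<le> w1 r * w2 r) \<longrightarrow> (\<exists>k. \<forall>r\<in>R. w1 r = k * w r))"

text \<open>
  Prescribing the signs of a given ray makes the cone pointed, and in its slice where the objective is at
  least 1 there is a vertex \<open>v\<close>. A sign-compatible summand \<open>w1\<close> of \<open>v\<close> vanishes wherever \<open>v\<close> does. With \<open>k\<close> the
  quotient of the objectives, \<open>w1 - k v\<close> therefore changes no tight inequality, so it is zero.
\<close>

lemma extreme_ray_exists:
  fixes A :: "'r \<Rightarrow> 'c \<Rightarrow> real"
  assumes fin: "finite N" "finite R" and w0: "lp_dual N R F A (\<lambda>_. 0) w0" "0 < dot R w0 b"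
  shows "\<exists>w. lp_ray N R F A b w"
proof -
  \<comment> \<open>A zero entry is treated as positive, so that inequality rows keep nonnegative prices.\<close>
  define s where "s r = (if w0 r < 0 then -1 else 1 :: real)" for r
  define a :: "'r + 'c + unit \<Rightarrow> 'r \<Rightarrow> real" where
    "a i = (case i of Inl r \<Rightarrow> (\<lambda>v. - of_bool (v = r) * s v) | Inr (Inl c) \<Rightarrow> (\<lambda>v. A v c) | Inr (Inr _) \<Rightarrow> (\<lambda>v. - b v))" for i
  define e :: "'r + 'c + unit \<Rightarrow> real" where
    "e i = (case i of Inr (Inr _) \<Rightarrow> - 1 | _ \<Rightarrow> 0)" for i
  let ?M = "R <+> N <+> {()}"
  have row: "dot R (a (Inl r)) x = - s r * x r" if "r \<in> R" for r x
    using that fin by (simp add: a_def dot_def of_bool_def if_distrib if_distribR sum_negf cong: if_cong)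
  have col: "dot R (a (Inr (Inl c))) x = price R A x c" for c x
    by (simp add: a_def dot_commute)
  have obj: "dot R (a (Inr (Inr u))) x = - dot R x b" for x u
    by (simp add: a_def dot_uminus_left dot_commute)
  have feas: "feas ?M R a e x \<longleftrightarrow> (\<forall>r\<in>R. 0 \<le> s r * x r) \<and> (\<forall>c\<in>N. price R A x c \<le> 0) \<and> 1 \<le> dot R x b" for x
    unfolding feas_def ball_Plus by (simp add: row col obj e_def)
  define x0 where "x0 r = 0 + 1 / dot R w0 b * w0 r" for r
  have "dot R x0 f = 1 / dot R w0 b * dot R w0 f" for f
    unfolding x0_def dot_step_left by (simp add: dot_def)
  then have "feas ?M R a e x0"
    using w0 by (auto simp: feas lp_dual_def s_def x0_def divide_nonpos_pos)
  moreover have "dot R (\<lambda>r. - s r) h < 0" if h: "\<forall>i\<in>?M. dot R (a i) h \<le> 0" "\<exists>r\<in>R. h r \<noteq> 0" for h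
  proof -
    have "\<forall>r\<in>R. 0 \<le> s r * h r"
      using h(1) unfolding ball_Plus by (simp add: row)
    moreover obtain r where "r \<in> R" "s r * h r \<noteq> 0"
      using h(2) by (auto simp: s_def)
    ultimately have "0 < (\<Sum>r\<in>R. s r * h r)"
      using fin by (intro sum_pos2[of R r]) (auto simp: less_le)
    then show ?thesis by (simp add: dot_def sum_negf)
  qed
  ultimately obtain v where v: "vertex ?M R a e v"
    using vertex_above[of ?M R a e x0 "\<lambda>r. - s r"] fin by auto
  have fv: "feas ?M R a e v" using v by (simp add: vertex_def)
  have "0 \<le> v r" if "r \<in> R - F" for r
  proof -
    have "0 \<le> w0 r" using w0(1) that by (simp add: lp_dual_def)
    then show ?thesis using fv that by (auto simp: feas s_def)
  qed
  then have dual: "lp_dual N R F A (\<lambda>_. 0) v" and pos: "0 < dot R v b"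
    using fv by (auto simp: feas lp_dual_def)
  have "\<exists>k. \<forall>r\<in>R. w1 r = k * v r"
    if w: "lp_dual N R F A (\<lambda>_. 0) w1" "lp_dual N R F A (\<lambda>_. 0) w2"
      "\<forall>r\<in>R. v r = w1 r + w2 r \<and> 0 \<le> w1 r * w2 r" for w1 w2
  proof -
    define k where "k = dot R w1 b / dot R v b"
    define h where "h r = w1 r + (- k) * v r" for r
    have dh: "dot R h f = dot R w1 f + (- k) * dot R v f" for f
      unfolding h_def by (rule dot_step_left)
    have dv: "dot R v f = dot R w1 f + 1 * dot R w2 f" for f
      unfolding dot_step_left[symmetric] using w(3) by (intro dot_cong) auto
    have "dot R (a i) h = 0" if i: "i \<in> tight ?M R a e v" for i
    proof -
      consider r where "i = Inl r" "r \<in> R" | c where "i = Inr (Inl c)" "c \<in> N" | "i = Inr (Inr ())"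
        using i unfolding tight_def by blast
      then show ?thesis
      proof cases
        case 1
        then have "v r = 0" using i by (auto simp: tight_def row e_def s_def split: if_splits)
        moreover have "w1 r = 0"
        proof -
          have "w2 r = - w1 r" "0 \<le> w1 r * w2 r" using w(3) 1(2) \<open>v r = 0\<close> by auto
          then have "w1 r * w1 r \<le> 0" by simp
          then show ?thesis by (metis mult_eq_0_iff order_antisym zero_le_square)
        qed
        ultimately show ?thesis using 1 by (simp add: row h_def)
      next
        case 2
        then have "price R A v c = 0" using i by (simp add: tight_def col e_def)
        moreover have "price R A w1 c \<le> 0" "price R A w2 c \<le> 0"
          using w(1,2) 2 by (auto simp: lp_dual_def)
        ultimately show ?thesis
          using dv[of "\<lambda>r. A r c"] 2 by (simp add: col dh)
      next
        case 3
        then show ?thesis using pos by (simp add: obj dh k_def)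
      qed
    qed
    then have "\<forall>r\<in>R. h r = 0"
      using v unfolding vertex_def by blast
    then show ?thesis by (intro exI[of _ k]) (simp add: h_def)
  qed
  then show ?thesis
    using dual pos unfolding lp_ray_def by blast
qed

text \<open>
  If signs and zero prices agree, a small multiple of \<open>v\<close> can be split off from \<open>w\<close> inside the cone without
  changing signs, and extremality of \<open>w\<close> makes \<open>v\<close> a multiple of \<open>w\<close>.
\<close>

lemma extreme_ray_unique:
  assumes fin: "finite N" "finite R"
    and w: "lp_ray N R F A b w" and v: "lp_ray N R F A b v"
    and sgn: "\<And>r. r \<in> R \<Longrightarrow> sgn (w r) = sgn (v r)"
    and zero: "\<And>c. c \<in> N \<Longrightarrow> price R A w c = 0 \<longleftrightarrow> price R A v c = 0"
  shows "\<exists>k>0. \<forall>r\<in>R. v r = k * w r"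
proof -
  have "v r = 0" if "r \<in> R" "w r = 0" for r
    using sgn[OF that(1)] that(2) by (simp add: sgn_0_0)
  then have "\<exists>e>0. \<forall>i\<in>R <+> N. e * \<bar>case_sum v (price R A v) i\<bar> \<le>
      case_sum (\<lambda>r. \<bar>w r\<bar>) (\<lambda>c. - price R A w c) i"
    using fin zero w by (intro uniform_scale) (auto simp: lp_ray_def lp_dual_def)
  then obtain e where e: "e > 0" and er: "\<And>r. r \<in> R \<Longrightarrow> e * \<bar>v r\<bar> \<le> \<bar>w r\<bar>"
    and ec: "\<And>c. c \<in> N \<Longrightarrow> e * \<bar>price R A v c\<bar> \<le> - price R A w c"
    unfolding ball_Plus by auto
  define w1 where "w1 r = w r + (- e) * v r" for r
  define w2 where "w2 r = 0 + e * v r" for r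
  have d1: "dot R w1 f = dot R w f + (- e) * dot R v f" for f
    unfolding w1_def by (rule dot_step_left)
  have d2: "dot R w2 f = e * dot R v f" for f
    unfolding w2_def dot_step_left by (simp add: dot_def)
  have sign: "0 \<le> w1 r * w2 r \<and> (0 \<le> w r \<longrightarrow> 0 \<le> w1 r)" if "r \<in> R" for r
  proof -
    note same = sgn[OF that]
    consider "w r = 0" "v r = 0" | "w r > 0" "v r > 0" | "w r < 0" "v r < 0"
      using same by (auto simp: sgn_if split: if_splits)
    then show ?thesis
      using er[OF that] e
      by cases (auto simp: w1_def w2_def mult_nonneg_nonneg mult_nonpos_nonpos mult_le_0_iff)
  qed
  have "lp_dual N R F A (\<lambda>_. 0) w1"
    unfolding lp_dual_def
  proof (intro conjI ballI)
    show "0 \<le> w1 r" if "r \<in> R - F" for r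
      using that sign w by (auto simp: lp_ray_def lp_dual_def)
    show "price R A w1 c \<le> 0" if "c \<in> N" for c
    proof -
      have "- (e * price R A v c) \<le> e * \<bar>price R A v c\<bar>"
        using e by (metis abs_ge_minus_self mult_le_cancel_left_pos mult_minus_right)
      then show ?thesis
        using ec[OF that] by (simp add: d1)
    qed
  qed
  moreover have "lp_dual N R F A (\<lambda>_. 0) w2"
    using v e by (auto simp: lp_ray_def lp_dual_def d2 mult_nonneg_nonpos w2_def)
  moreover have "\<forall>r\<in>R. w r = w1 r + w2 r \<and> 0 \<le> w1 r * w2 r"
    using sign by (auto simp: w1_def w2_def)
  ultimately obtain k where k: "\<forall>r\<in>R. w1 r = k * w r"
    using w unfolding lp_ray_def by blast
  have kv: "v r = (1 - k) / e * w r" if "r \<in> R" for r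
    using k that e by (auto simp: w1_def field_simps)
  have "dot R v b = (1 - k) / e * dot R w b"
  proof -
    have "dot R v b = dot R (\<lambda>r. 0 + (1 - k) / e * w r) b"
      using kv by (intro dot_cong) auto
    then show ?thesis
      unfolding dot_step_left by (simp add: dot_def)
  qed
  then have "(1 - k) / e > 0"
    using w v unfolding lp_ray_def by (metis less_asym zero_less_mult_iff)
  then show ?thesis using kv by blast
qed

text \<open>
  A normalised extreme ray is determined by its signs and its zero prices. So only finitely many prices
  occur, and the positive ones have a positive minimum.
\<close>

lemma ray_price_gap:
  assumes fin: "finite N" "finite R" "finite C"
  shows "\<exists>m>0. \<forall>w. lp_ray N R F A b w \<longrightarrow> (\<forall>c\<in>C. 0 < price R A w c \<longrightarrow>
           m * (\<Sum>r\<in>R. \<bar>w r\<bar>) \<le> price R A w c)"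
proof -
  let ?S = "Collect (lp_ray N R F A b)"
  define g where "g c w = price R A w c / (\<Sum>r\<in>R. \<bar>w r\<bar>)" for c w
  define f where "f w = ({r \<in> R. 0 < w r}, {r \<in> R. w r < 0}, {c \<in> N. price R A w c = 0})" for w
  have "finite (f ` ?S)"
    by (rule finite_subset[of _ "Pow R \<times> Pow R \<times> Pow N"]) (use fin in \<open>auto simp: f_def\<close>)
  have "finite (g c ` ?S)" for c
  proof (rule finite_image_factor[OF \<open>finite (f ` ?S)\<close>])
    fix w v assume "w \<in> ?S" "v \<in> ?S" "f w = f v"
    then have w: "lp_ray N R F A b w" and v: "lp_ray N R F A b v" by auto
    have "sgn (w r) = sgn (v r)" if "r \<in> R" for r
    proof -
      have "0 < w r \<longleftrightarrow> 0 < v r" "w r < 0 \<longleftrightarrow> v r < 0"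
        using \<open>f w = f v\<close> that by (auto simp: f_def set_eq_iff)
      then show ?thesis by (auto simp: sgn_if)
    qed
    moreover have "price R A w c = 0 \<longleftrightarrow> price R A v c = 0" if "c \<in> N" for c
      using \<open>f w = f v\<close> that by (auto simp: f_def set_eq_iff)
    ultimately obtain k where k: "k > 0" "\<forall>r\<in>R. v r = k * w r"
      using extreme_ray_unique[OF fin(1,2) w v] by blast
    have "price R A v c = k * price R A w c"
      using k by (simp add: dot_def sum_distrib_left mult.assoc)
    moreover have "(\<Sum>r\<in>R. \<bar>v r\<bar>) = k * (\<Sum>r\<in>R. \<bar>w r\<bar>)"
      using k by (simp add: sum_distrib_left abs_mult)
    ultimately show "g c w = g c v"
      using k(1) by (simp add: g_def)
  qed
  then have finV: "finite (\<Union>c\<in>C. g c ` ?S)" using fin by blast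
  define m where "m = Min (insert 1 {x \<in> (\<Union>c\<in>C. g c ` ?S). 0 < x})"
  have "finite (insert 1 {x \<in> (\<Union>c\<in>C. g c ` ?S). 0 < x})"
    by (rule finite.insertI, rule finite_subset[OF _ finV]) blast
  then have "m > 0" unfolding m_def by (subst Min_gr_iff) auto
  moreover have "m * (\<Sum>r\<in>R. \<bar>w r\<bar>) \<le> price R A w c"
    if w: "lp_ray N R F A b w" and c: "c \<in> C" "0 < price R A w c" for w c
  proof -
    have "(\<Sum>r\<in>R. \<bar>w r\<bar>) \<noteq> 0"
    proof
      assume "(\<Sum>r\<in>R. \<bar>w r\<bar>) = 0"
      then have "\<forall>r\<in>R. w r = 0" using fin by (simp add: sum_nonneg_eq_0_iff)
      then show False using c by (simp add: dot_def)
    qed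
    then have pos: "(\<Sum>r\<in>R. \<bar>w r\<bar>) > 0" by (simp add: less_le sum_nonneg)
    then have "0 < g c w" using c by (simp add: g_def)
    then have "m \<le> g c w"
      unfolding m_def using \<open>finite (insert 1 _)\<close> w c by (intro Min_le) auto
    then show ?thesis using pos by (simp add: g_def pos_le_divide_eq)
  qed
  ultimately show ?thesis by blast
qed

section \<open>Networks\<close>

lemma set_path_subset:
  assumes "pre_digraph.apath G u p v"
  shows "set p \<subseteq> arcs G"
  using assms by (auto simp: pre_digraph.apath_def pre_digraph.awalk_def)

lemma finite_paths:
  assumes "fin_digraph G"
  shows "finite {p. \<exists>v. P v \<and> pre_digraph.apath G u p v}"
proof -
  have "{p. \<exists>v. P v \<and> pre_digraph.apath G u p v} \<subseteq> (fst \<circ> snd) ` {(u, p, v). pre_digraph.apath G u p v}"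
    by force
  then show ?thesis
    using fin_digraph.apaths_finite_triple[OF assms] finite_surj by blast
qed

lemma finite_plans:
  assumes "wf_network I" "g \<in> fires I"
  shows "finite (plans I g)"
proof -
  have fn: "finite (fire_nodes I g)"
    using assms by (auto simp: wf_network_def fire_nodes_def)
  have "fin_digraph (fire_digraph I g)"
    by unfold_locales
      (auto simp: fire_digraph_def fire_arcs_def fn intro: finite_subset[OF _ finite_cartesian_product[OF fn fn]])
  from finite_paths[OF this, of "\<lambda>v. \<exists>s. v = (s, horizon I + 1)"] show ?thesis
    by (rule finite_subset[rotated]) (auto simp: plans_def)
qed

lemma finite_routes:
  assumes "wf_network I" "j \<in> crews I"
  shows "finite (routes I j)"
proof -
  have fn: "finite (crew_nodes I j)"
    using assms by (auto simp: wf_network_def crew_nodes_def)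
  have "finite (UNIV :: arc_kind set)"
    by (rule finite_subset[of _ "{Travel, Work, Rest, Base}"]) (auto, metis arc_kind.exhaust)
  then have fa: "finite (UNIV \<times> crew_nodes I j \<times> crew_nodes I j :: 'b crew_arc set)"
    using fn by blast
  have "fin_digraph (crew_digraph I j)"
  proof unfold_locales
    show "finite (arcs (crew_digraph I j))"
      by (rule finite_subset[OF _ fa]) (auto simp: crew_digraph_def crew_arcs_def)
  qed (auto simp: crew_digraph_def crew_arcs_def fn)
  from finite_paths[OF this, of "\<lambda>v. \<exists>l r. v = (l, horizon I + 1, r)"] show ?thesis
    by (rule finite_subset[rotated]) (auto simp: routes_def)
qed

lemma plan_cost_nonneg:
  assumes "\<And>a. a \<in> fire_arcs I g \<Longrightarrow> 0 \<le> fire_cost I g a" "q \<in> plans I g"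
  shows "0 \<le> plan_cost I g q"
proof -
  have "set q \<subseteq> fire_arcs I g"
    using assms(2) set_path_subset by (fastforce simp: plans_def fire_digraph_def)
  then show ?thesis
    using assms(1) unfolding plan_cost_def by (intro sum_list_nonneg) auto
qed

lemma route_cost_nonneg:
  assumes "\<And>a. a \<in> crew_arcs I j \<Longrightarrow> 0 \<le> crew_cost I j a" "p \<in> routes I j"
  shows "0 \<le> route_cost I j p"
proof -
  have "set p \<subseteq> crew_arcs I j"
    using assms(2) set_path_subset by (fastforce simp: routes_def crew_digraph_def)
  then show ?thesis
    using assms(1) unfolding route_cost_def by (intro sum_list_nonneg) auto
qed

lemma awalk_verts_eq:
  assumes "pre_digraph.awalk G u p v"
  shows "pre_digraph.awalk_verts G u p = u # map (head G) p"
proof -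
  have "pre_digraph.cas G u p v" using assms by (simp add: pre_digraph.awalk_def)
  then show ?thesis
    by (induction p arbitrary: u) (auto simp: pre_digraph.cas.simps pre_digraph.awalk_verts.simps)
qed

lemma tails_inj:
  fixes time :: "'n \<Rightarrow> nat"
  assumes "pre_digraph.cas G u p v" "\<And>a. a \<in> set p \<Longrightarrow> time (tail G a) < time (head G a)"
  shows "(\<forall>a\<in>set p. time u \<le> time (tail G a)) \<and> inj_on (\<lambda>a. time (tail G a)) (set p)"
  using assms
proof (induction p arbitrary: u)
  case (Cons a p)
  have u: "u = tail G a" and p: "pre_digraph.cas G (head G a) p v"
    using Cons.prems(1) by (auto simp: pre_digraph.cas.simps)
  have IH: "\<forall>b\<in>set p. time (head G a) \<le> time (tail G b)" "inj_on (\<lambda>a. time (tail G a)) (set p)"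
    using Cons.IH[OF p] Cons.prems(2) by auto
  have "time u < time (tail G b)" if "b \<in> set p" for b
    using IH(1) Cons.prems(2)[of a] that u by fastforce
  then show ?case
    using IH(2) u by (fastforce simp: inj_on_def)
qed auto

text \<open>
  An arc into the start node may have an arbitrary travel time when the start location is not one of the
  crew's locations; a path never returns to that node.
\<close>

lemma crew_arc_forward:
  assumes "wf_network I" "j \<in> crews I" "a \<in> crew_arcs I j"
    and "head (crew_digraph I j) a \<noteq> (start_loc I j, 1, False)"
  shows "fst (snd (tail (crew_digraph I j) a)) < fst (snd (head (crew_digraph I j) a))"
proof -
  have "0 < min_rest I" using assms(1) by (simp add: wf_network_def)
  moreover have "t1 < t2"
    if "a = (Travel, (l1, t1, r), (l2, t2, r))" "l1 \<noteq> l2" "int t2 - int t1 = \<lceil>travel_time I l1 l2\<rceil>" for l1 t1 r l2 t2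
  proof -
    have "l2 \<in> locations I j" "l1 \<in> insert (start_loc I j) (locations I j)"
      using that assms(3,4) by (auto simp: crew_arcs_def crew_nodes_def crew_digraph_def)
    then have "0 < travel_time I l1 l2"
      using assms(1,2) that(2) unfolding wf_network_def by blast
    then show ?thesis
      using that(3) by (metis ceiling_le_zero diff_gt_0_iff_gt not_le of_nat_less_iff)
  qed
  ultimately show ?thesis
    using assms(3) by (auto simp: crew_arcs_def crew_digraph_def)
qed

text \<open>
  The arcs of a path leave at different times, and an assignment at time \<open>t\<close> is an arc that leaves at \<open>t\<close>.
\<close>

lemma assigned_once:
  assumes "wf_network I" "j \<in> crews I" "p \<in> routes I j"
  shows "(\<Sum>g\<in>fires I. assigned I j p g t) \<le> 1"
proof -
  let ?G = "crew_digraph I j"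
  obtain v where p: "pre_digraph.apath ?G (start_loc I j, 1, False) p v"
    using assms(3) by (auto simp: routes_def)
  then have walk: "pre_digraph.awalk ?G (start_loc I j, 1, False) p v"
    and "distinct (pre_digraph.awalk_verts ?G (start_loc I j, 1, False) p)"
    unfolding pre_digraph.apath_def by blast+
  then have "(start_loc I j, 1, False) \<notin> head ?G ` set p"
    unfolding awalk_verts_eq[OF walk] by simp
  then have "head ?G a \<noteq> (start_loc I j, 1, False)" if "a \<in> set p" for a
    using that by force
  moreover have "set p \<subseteq> crew_arcs I j"
    using set_path_subset[OF p] by (simp add: crew_digraph_def)
  ultimately have "fst (snd (tail ?G a)) < fst (snd (head ?G a))" if "a \<in> set p" for a
    using crew_arc_forward[OF assms(1,2)] that by blast
  moreover have "pre_digraph.cas ?G (start_loc I j, 1, False) p v"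
    using walk by (simp add: pre_digraph.awalk_def)
  ultimately have "inj_on (\<lambda>a. fst (snd (tail ?G a))) (set p)"
    using tails_inj[of ?G _ p v "\<lambda>x. fst (snd x)"] by blast
  then have "g = g'" if "set p \<inter> leaving_arcs I j g t \<noteq> {}" "set p \<inter> leaving_arcs I j g' t \<noteq> {}" for g g'
    using that by (fastforce simp: leaving_arcs_def inj_on_def)
  then have "card {g \<in> fires I. set p \<inter> leaving_arcs I j g t \<noteq> {}} \<le> Suc 0"
    using assms(1) by (subst card_le_Suc0_iff_eq) (auto simp: wf_network_def)
  moreover have "(\<Sum>g\<in>fires I. assigned I j p g t) = card {g \<in> fires I. set p \<inter> leaving_arcs I j g t \<noteq> {}}"
    using assms(1) by (simp add: assigned_def wf_network_def Int_def)
  ultimately show ?thesis by simp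
qed

lemma assigned_bool: "assigned I j p g t \<in> {0, 1}"
  by (simp add: assigned_def)

lemma assigned_nonneg: "0 \<le> assigned I j p g t"
  by (simp add: assigned_def)

section \<open>Integer solutions\<close>

lemma binary_unit_sum:
  fixes f :: "'x \<Rightarrow> real"
  assumes "finite S" "\<And>x. x \<in> S \<Longrightarrow> f x \<in> {0, 1}" "(\<Sum>x\<in>S. f x) = 1"
  shows "\<exists>q\<in>S. \<forall>x\<in>S. f x = of_bool (x = q)"
proof -
  have "(\<Sum>x\<in>S. f x) = (\<Sum>x\<in>{x \<in> S. f x = 1}. f x)"
    using assms by (intro sum.mono_neutral_right) auto
  then have "card {x \<in> S. f x = 1} = 1"
    using assms(3) by simp
  then obtain q where "{x \<in> S. f x = 1} = {q}"
    by (auto simp: card_1_singleton_iff)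
  then have q: "q \<in> S" "f q = 1" and uniq: "\<And>x. x \<in> S \<Longrightarrow> f x = 1 \<Longrightarrow> x = q"
    by blast+
  have "f x = of_bool (x = q)" if "x \<in> S" for x
  proof (cases "x = q")
    case True
    then show ?thesis using q(2) by simp
  next
    case False
    then have "f x \<noteq> 1" using uniq[OF that] by blast
    then show ?thesis using assms(2)[OF that] False by simp
  qed
  then show ?thesis using q(1) by blast
qed

lemma sum_selected:
  fixes f :: "'x \<Rightarrow> real"
  assumes "finite S" "q \<in> S" "\<And>x. x \<in> S \<Longrightarrow> y x = of_bool (x = q)"
  shows "(\<Sum>x\<in>S. f x * y x) = f q"
proof -
  have "(\<Sum>x\<in>S. f x * y x) = (\<Sum>x\<in>S. if x = q then f x else 0)"
    using assms(3) by (intro sum.cong) auto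
  then show ?thesis using assms by simp
qed

definition selects :: "('j, 'l, 's::linorder) network \<Rightarrow> ('l, 's) yvars \<Rightarrow> ('j, 'l) zvars \<Rightarrow>
    ('l \<Rightarrow> 's plan) \<Rightarrow> ('j \<Rightarrow> 'l route) \<Rightarrow> bool" where
  "selects I y z qs ps \<longleftrightarrow>
     (\<forall>g\<in>fires I. qs g \<in> plans I g \<and> (\<forall>q\<in>plans I g. y g q = of_bool (q = qs g))) \<and>
     (\<forall>j\<in>crews I. ps j \<in> routes I j \<and> (\<forall>p\<in>routes I j. z j p = of_bool (p = ps j)))"

lemma sp_feasible_selects:
  assumes "wf_network I" "sp_feasible I y z"
  shows "\<exists>qs ps. selects I y z qs ps"
proof -
  have "\<exists>q\<in>plans I g. \<forall>x\<in>plans I g. y g x = of_bool (x = q)" if "g \<in> fires I" for g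
    by (rule binary_unit_sum)
      (use assms that finite_plans in \<open>auto simp: sp_feasible_def binary_def sp_constraints_def\<close>)
  then obtain qs where "\<forall>g\<in>fires I. qs g \<in> plans I g \<and> (\<forall>q\<in>plans I g. y g q = of_bool (q = qs g))"
    by metis
  moreover have "\<exists>p\<in>routes I j. \<forall>x\<in>routes I j. z j x = of_bool (x = p)" if "j \<in> crews I" for j
    by (rule binary_unit_sum)
      (use assms that finite_routes in \<open>auto simp: sp_feasible_def binary_def sp_constraints_def\<close>)
  then obtain ps where "\<forall>j\<in>crews I. ps j \<in> routes I j \<and> (\<forall>p\<in>routes I j. z j p = of_bool (p = ps j))"
    by metis
  ultimately show ?thesis
    unfolding selects_def by blast
qed

lemma selects_sums:
  assumes "wf_network I" "selects I y z qs ps"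
  shows "g \<in> fires I \<Longrightarrow> (\<Sum>q\<in>plans I g. f q * y g q) = f (qs g)"
    and "j \<in> crews I \<Longrightarrow> (\<Sum>p\<in>routes I j. h p * z j p) = h (ps j)"
  using assms by (auto simp: selects_def intro!: sum_selected finite_plans finite_routes)

section \<open>Cuts\<close>

abbreviation full_cut :: "('j, 'l, 's) network \<Rightarrow> nat \<Rightarrow> 'j set \<Rightarrow> ('l \<Rightarrow> nat \<Rightarrow> real) \<Rightarrow> real \<Rightarrow> ('j, 'l) cut" where
  "full_cut I t J \<delta> K \<equiv> \<lparr>cut_time = t, cut_fires = fires I, cut_crews = J, cut_coeff = \<delta>, cut_bound = K\<rparr>"

lemma agub_bounds:
  assumes "agub I G J \<delta> K"
  shows "0 \<le> \<delta> g d" "\<delta> g d \<le> 1"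
  using assms unfolding agub_def by (metis order_refl zero_le_one)+

text \<open>
  Without extra capacity \<open>m\<close> the demands form a packing. Each unit of extra capacity is paid for by dropping
  a fire of positive demand, which costs at most 1 because the coefficients are at most 1.
\<close>

lemma agub_packing_bound:
  fixes B :: "'l \<Rightarrow> nat"
  assumes ag: "agub I G J \<delta> K" and "finite G" and J: "card J \<le> ncrews I"
    and "H \<subseteq> G" "(\<Sum>g\<in>H. B g) + card J \<le> ncrews I + m"
  shows "(\<Sum>g\<in>H. \<delta> g (B g)) \<le> K + m"
  using assms(4,5)
proof (induction m arbitrary: H)
  case 0
  have H: "finite H" using 0 \<open>finite G\<close> finite_subset by blast
  let ?S = "(\<lambda>g. (g, B g)) ` H"
  have inj: "inj_on (\<lambda>g. (g, B g)) H" by (auto simp: inj_on_def)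
  have "B g \<le> ncrews I" if "g \<in> H" for g
    using member_le_sum[of g H B] that H 0(2) by simp
  moreover have "int (\<Sum>g\<in>H. B g) \<le> int (ncrews I) - int (card J)"
    using 0(2) by linarith
  ultimately have "?S \<in> demand_packings I G J"
    using 0(1) by (auto simp: demand_packings_def sum.reindex[OF inj])
  then have "(\<Sum>(g, d)\<in>?S. \<delta> g d) \<le> K"
    using ag by (simp add: agub_def)
  then show ?case by (simp add: sum.reindex[OF inj])
next
  case (Suc m)
  have H: "finite H" using Suc.prems \<open>finite G\<close> finite_subset by blast
  show ?case
  proof (cases "\<forall>g\<in>H. B g = 0")
    case True
    then show ?thesis
      using Suc.IH[OF Suc.prems(1)] J by simp
  next
    case False
    then obtain g where g: "g \<in> H" "0 < B g" by auto
    have "(\<Sum>g\<in>H. B g) = B g + (\<Sum>g\<in>H - {g}. B g)"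
      using H g(1) by (rule sum.remove)
    then have "(\<Sum>g\<in>H - {g}. B g) + card J \<le> ncrews I + m"
      using Suc.prems(2) g(2) by linarith
    then have "(\<Sum>g\<in>H - {g}. \<delta> g (B g)) \<le> K + m"
      using Suc.IH[of "H - {g}"] Suc.prems(1) by blast
    moreover have "(\<Sum>g\<in>H. \<delta> g (B g)) = \<delta> g (B g) + (\<Sum>g\<in>H - {g}. \<delta> g (B g))"
      using H g(1) by (rule sum.remove)
    ultimately show ?thesis
      using agub_bounds(2)[OF ag, of g "B g"] by simp
  qed
qed

text \<open>
  Let \<open>m\<close> crews of \<open>J\<close> fight a fire at time \<open>t\<close>. Each of them lowers the crew part of the left-hand side by
  one, and together they allow the demands to exceed the capacity of the crews outside \<open>J\<close> by at most \<open>m\<close>,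
  because a crew is at one fire at a time. The two effects cancel.
\<close>

lemma agub_cut_valid:
  assumes wf: "wf_network I" and sp: "sp_feasible I y z" and ag: "agub I (fires I) J \<delta> K"
    and J: "J \<subseteq> crews I" and t: "t \<in> periods I"
  shows "satisfies_cut I y z (full_cut I t J \<delta> K)"
proof -
  obtain qs ps where sel: "selects I y z qs ps"
    using sp_feasible_selects[OF wf sp] by blast
  have fin: "finite (fires I)" "finite (crews I)"
    using wf by (auto simp: wf_network_def)
  then have finJ: "finite J" and cJ: "card J \<le> ncrews I"
    using J finite_subset card_mono by blast+
  let ?u = "full_cut I t J \<delta> K"
  let ?B = "\<lambda>g. demand I g (qs g) t"
  define a where "a j = (\<Sum>g\<in>fires I. assigned I j (ps j) g t)" for j
  have ps: "ps j \<in> routes I j" if "j \<in> crews I" for j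
    using sel that by (simp add: selects_def)
  have a: "0 \<le> a j" "j \<in> crews I \<Longrightarrow> a j \<le> 1" "a j \<noteq> 0 \<Longrightarrow> 1 \<le> a j" for j
  proof -
    show "0 \<le> a j" unfolding a_def by (intro sum_nonneg assigned_nonneg)
    show "j \<in> crews I \<Longrightarrow> a j \<le> 1"
      unfolding a_def by (rule assigned_once[OF wf]) (use ps in auto)
    assume "a j \<noteq> 0"
    then obtain g where g: "g \<in> fires I" "assigned I j (ps j) g t \<noteq> 0"
      unfolding a_def by (meson sum.not_neutral_contains_not_neutral)
    then have "assigned I j (ps j) g t = 1" using assigned_bool[of I j "ps j" g t] by auto
    then show "1 \<le> a j"
      unfolding a_def using member_le_sum[of g "fires I" "\<lambda>g. assigned I j (ps j) g t"] g fin
      by (simp add: assigned_nonneg)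
  qed
  \<comment> \<open>For \<open>j\<close> in \<open>J\<close>, the cut counts \<open>j\<close> iff \<open>a j = 0\<close>.\<close>
  define m where "m = card {j \<in> J. a j \<noteq> 0}"
  have "real (?B g) \<le> (\<Sum>j\<in>crews I. assigned I j (ps j) g t)" if "g \<in> fires I" for g
  proof -
    have "0 \<le> (\<Sum>j\<in>crews I. \<Sum>p\<in>routes I j. assigned I j p g t * z j p) -
        (\<Sum>q\<in>plans I g. real (demand I g q t) * y g q)"
      using sp that t by (simp add: sp_feasible_def sp_constraints_def)
    then show ?thesis
      using selects_sums[OF wf sel] that by simp
  qed
  then have "(\<Sum>g\<in>fires I. real (?B g)) \<le> (\<Sum>g\<in>fires I. \<Sum>j\<in>crews I. assigned I j (ps j) g t)"
    by (intro sum_mono)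
  also have "\<dots> = (\<Sum>j\<in>crews I. a j)"
    unfolding a_def by (rule sum.swap)
  also have "\<dots> \<le> (\<Sum>j\<in>crews I. of_bool (j \<notin> J \<or> a j \<noteq> 0))"
    using a by (intro sum_mono) (auto simp: of_bool_def)
  also have "\<dots> = card {j \<in> crews I. j \<notin> J \<or> a j \<noteq> 0}"
    using fin by (simp add: Int_def)
  also have "{j \<in> crews I. j \<notin> J \<or> a j \<noteq> 0} = (crews I - J) \<union> {j \<in> J. a j \<noteq> 0}"
    using J by auto
  also have "card \<dots> = ncrews I - card J + m"
    unfolding m_def using fin finJ J by (subst card_Un_disjoint) (auto simp: card_Diff_subset)
  finally have "(\<Sum>g\<in>fires I. ?B g) + card J \<le> ncrews I + m"
    using cJ by (simp flip: of_nat_sum of_nat_add)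
  then have pack: "(\<Sum>g\<in>fires I. \<delta> g (?B g)) \<le> K + m"
    by (intro agub_packing_bound[OF ag fin(1) cJ]) auto
  have "(\<Sum>q\<in>plans I g. plan_coeff I ?u g q * y g q) \<le> \<delta> g (?B g)" if "g \<in> fires I" for g
  proof -
    have "(\<Sum>q\<in>plans I g. plan_coeff I ?u g q * y g q) = (\<Sum>d = 0..ncrews I. of_bool (?B g = d) * \<delta> g d)"
      using that by (simp add: selects_sums[OF wf sel] plan_coeff_def)
    also have "\<dots> = (\<Sum>d = 0..ncrews I. if d = ?B g then \<delta> g d else 0)"
      by (intro sum.cong) auto
    also have "\<dots> \<le> \<delta> g (?B g)"
      using agub_bounds[OF ag] by (simp add: sum.delta)
    finally show ?thesis .
  qed
  then have "(\<Sum>g\<in>fires I. \<Sum>q\<in>plans I g. plan_coeff I ?u g q * y g q) \<le> K + m"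
    using pack by (meson order_trans sum_mono)
  moreover have "(\<Sum>j\<in>crews I. \<Sum>p\<in>routes I j. route_coeff I ?u j p * z j p) = real (card J) - m"
  proof -
    have "(\<Sum>j\<in>crews I. \<Sum>p\<in>routes I j. route_coeff I ?u j p * z j p)
        = (\<Sum>j\<in>crews I. of_bool (j \<in> J \<and> a j = 0))"
      using selects_sums(2)[OF wf sel] by (intro sum.cong) (auto simp: route_coeff_def a_def)
    also have "\<dots> = card {j \<in> crews I. j \<in> J \<and> a j = 0}"
      using fin by (simp add: Int_def)
    also have "{j \<in> crews I. j \<in> J \<and> a j = 0} = J - {j \<in> J. a j \<noteq> 0}"
      using J by auto
    also have "card \<dots> = card J - m"
      unfolding m_def using finJ by (simp add: card_Diff_subset)
    also have "real \<dots> = real (card J) - m"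
      unfolding m_def using finJ by (simp add: of_nat_diff card_mono)
    finally show ?thesis .
  qed
  ultimately show ?thesis
    by (simp add: satisfies_cut_def cut_rhs_def)
qed

definition agub_vertex :: "('j, 'l, 's) network \<Rightarrow> 'l set \<Rightarrow> 'j set \<Rightarrow> ('l \<Rightarrow> nat \<Rightarrow> real) \<Rightarrow> real \<Rightarrow> bool" where
  "agub_vertex I G J \<delta> K \<longleftrightarrow> agub I G J \<delta> K \<and>
     (\<forall>\<delta>1 K1 \<delta>2 K2. agub I G J \<delta>1 K1 \<and> agub I G J \<delta>2 K2 \<and> K = (K1 + K2) / 2 \<and>
        (\<forall>g d. \<delta> g d = (\<delta>1 g d + \<delta>2 g d) / 2) \<longrightarrow> \<delta>1 = \<delta>2 \<and> K1 = K2)"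

text \<open>
  The cuts that the cut-generating program can produce for any fractional solution: the idle crews range
  over all sets of crews, the coefficients over the extreme points.
\<close>

definition cut_universe :: "('j, 'l, 's) network \<Rightarrow> ('j, 'l) cut set" where
  "cut_universe I = {full_cut I t J \<delta> K | t J \<delta> K.
     t \<in> periods I \<and> J \<subseteq> crews I \<and> agub_vertex I (fires I) J \<delta> K}"

lemma cut_universe_valid:
  assumes "wf_network I" "sp_feasible I y z" "u \<in> cut_universe I"
  shows "satisfies_cut I y z u"
proof -
  obtain t J \<delta> K where "u = full_cut I t J \<delta> K"
    and "t \<in> periods I" "J \<subseteq> crews I" "agub_vertex I (fires I) J \<delta> K"
    using assms(3) unfolding cut_universe_def by blast
  then show ?thesis
    using agub_cut_valid[OF assms(1,2)] unfolding agub_vertex_def by blast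
qed

text \<open>
  Coordinates for the polyhedron of coefficients and bound: \<open>Some (g, d)\<close> stands for \<open>\<delta> g d\<close> and \<open>None\<close> for
  the bound \<open>K\<close>.
\<close>

definition agub_vars :: "('j, 'l, 's) network \<Rightarrow> 'l set \<Rightarrow> ('l \<times> nat) option set" where
  "agub_vars I G = insert None (Some ` (G \<times> {0..ncrews I}))"

definition agub_cons :: "('j, 'l, 's) network \<Rightarrow> 'l set \<Rightarrow> 'j set \<Rightarrow>
    ('l \<times> nat + 'l \<times> nat + ('l \<times> nat) set) set" where
  "agub_cons I G J = G \<times> {0..ncrews I} <+> G \<times> {0..ncrews I} <+> demand_packings I G J"

fun agub_row :: "'l \<times> nat + 'l \<times> nat + ('l \<times> nat) set \<Rightarrow> ('l \<times> nat) option \<Rightarrow> real" where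
  "agub_row (Inl e) v = - of_bool (v = Some e)"
| "agub_row (Inr (Inl e)) v = of_bool (v = Some e)"
| "agub_row (Inr (Inr S)) v = (case v of None \<Rightarrow> - 1 | Some e \<Rightarrow> of_bool (e \<in> S))"

fun agub_bound :: "'l \<times> nat + 'l \<times> nat + ('l \<times> nat) set \<Rightarrow> real" where
  "agub_bound (Inl e) = 0"
| "agub_bound (Inr (Inl e)) = 1"
| "agub_bound (Inr (Inr S)) = 0"

abbreviation agub_feas :: "('j, 'l, 's) network \<Rightarrow> 'l set \<Rightarrow> 'j set \<Rightarrow> (('l \<times> nat) option \<Rightarrow> real) \<Rightarrow> bool" where
  "agub_feas I G J \<equiv> feas (agub_cons I G J) (agub_vars I G) agub_row agub_bound"

abbreviation agub_vert :: "('j, 'l, 's) network \<Rightarrow> 'l set \<Rightarrow> 'j set \<Rightarrow> (('l \<times> nat) option \<Rightarrow> real) \<Rightarrow> bool" where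
  "agub_vert I G J \<equiv> vertex (agub_cons I G J) (agub_vars I G) agub_row agub_bound"

definition coeff_vector :: "('l \<Rightarrow> nat \<Rightarrow> real) \<Rightarrow> real \<Rightarrow> ('l \<times> nat) option \<Rightarrow> real" where
  "coeff_vector \<delta> K v = (case v of None \<Rightarrow> K | Some (g, d) \<Rightarrow> \<delta> g d)"

definition vector_coeff :: "('j, 'l, 's) network \<Rightarrow> 'l set \<Rightarrow> (('l \<times> nat) option \<Rightarrow> real) \<Rightarrow> 'l \<Rightarrow> nat \<Rightarrow> real" where
  "vector_coeff I G x g d = (if g \<in> G \<and> d \<le> ncrews I then x (Some (g, d)) else 0)"

lemma dot_agub_vars:
  assumes "finite G"
  shows "dot (agub_vars I G) f x = f None * x None + (\<Sum>e\<in>G \<times> {0..ncrews I}. f (Some e) * x (Some e))"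
  using assms by (simp add: agub_vars_def dot_def sum.reindex)

lemma packing_subset: "S \<in> demand_packings I G J \<Longrightarrow> S \<subseteq> G \<times> {0..ncrews I}"
  by (auto simp: demand_packings_def)

lemma finite_agub_cons: "finite G \<Longrightarrow> finite (agub_cons I G J)"
proof -
  assume G: "finite G"
  have "finite (demand_packings I G J)"
  proof (rule finite_subset)
    show "demand_packings I G J \<subseteq> Pow (G \<times> {0..ncrews I})"
      using packing_subset by blast
    show "finite (Pow (G \<times> {0..ncrews I}))"
      using G by simp
  qed
  then show ?thesis using G by (simp add: agub_cons_def)
qed

lemma dot_agub_row:
  assumes "finite G"
  shows "e \<in> G \<times> {0..ncrews I} \<Longrightarrow> dot (agub_vars I G) (agub_row (Inl e)) x = - x (Some e)"
    and "e \<in> G \<times> {0..ncrews I} \<Longrightarrow> dot (agub_vars I G) (agub_row (Inr (Inl e))) x = x (Some e)"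
    and "S \<in> demand_packings I G J \<Longrightarrow>
           dot (agub_vars I G) (agub_row (Inr (Inr S))) x = (\<Sum>e\<in>S. x (Some e)) - x None"
proof -
  have fin: "finite (G \<times> {0..ncrews I})" using assms by simp
  have unit: "(\<Sum>e'\<in>G \<times> {0..ncrews I}. of_bool (e' = e) * x (Some e')) = x (Some e)" if "e \<in> G \<times> {0..ncrews I}"
    using sum.delta'[OF fin, of e "\<lambda>e. x (Some e)"] that
    by (simp add: of_bool_def if_distrib if_distribR eq_commute cong: if_cong)
  show "e \<in> G \<times> {0..ncrews I} \<Longrightarrow> dot (agub_vars I G) (agub_row (Inl e)) x = - x (Some e)"
    "e \<in> G \<times> {0..ncrews I} \<Longrightarrow> dot (agub_vars I G) (agub_row (Inr (Inl e))) x = x (Some e)"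
    using unit by (simp_all add: dot_agub_vars[OF assms] sum_negf)
  assume S: "S \<in> demand_packings I G J"
  have "(\<Sum>e'\<in>G \<times> {0..ncrews I}. of_bool (e' \<in> S) * x (Some e')) = (\<Sum>e\<in>S. of_bool (e \<in> S) * x (Some e))"
    using packing_subset[OF S] fin by (intro sum.mono_neutral_right) auto
  then show "dot (agub_vars I G) (agub_row (Inr (Inr S))) x = (\<Sum>e\<in>S. x (Some e)) - x None"
    by (simp add: dot_agub_vars[OF assms])
qed

lemma feas_agub_iff:
  assumes "finite G"
  shows "agub_feas I G J x \<longleftrightarrow>
    (\<forall>e\<in>G \<times> {0..ncrews I}. 0 \<le> x (Some e) \<and> x (Some e) \<le> 1) \<and>
    (\<forall>S\<in>demand_packings I G J. (\<Sum>e\<in>S. x (Some e)) \<le> x None)"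
  unfolding feas_def agub_cons_def ball_Plus
  by (simp add: dot_agub_row[OF assms] cong: ball_cong) blast

lemma agub_imp_feas:
  assumes "finite G" "agub I G J \<delta> K"
  shows "agub_feas I G J (coeff_vector \<delta> K)"
proof -
  have "(\<Sum>e\<in>S. coeff_vector \<delta> K (Some e)) = (\<Sum>(g, d)\<in>S. \<delta> g d)" for S
    by (intro sum.cong) (auto simp: coeff_vector_def)
  then show ?thesis
    using assms agub_bounds[OF assms(2)] by (auto simp: feas_agub_iff agub_def coeff_vector_def)
qed

lemma feas_imp_agub:
  assumes "finite G" "agub_feas I G J x"
  shows "agub I G J (vector_coeff I G x) (x None)"
proof -
  have "(\<Sum>(g, d)\<in>S. vector_coeff I G x g d) = (\<Sum>e\<in>S. x (Some e))" if "S \<in> demand_packings I G J" for S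
    using packing_subset[OF that] by (intro sum.cong) (auto simp: vector_coeff_def)
  then show ?thesis
    using assms by (auto simp: feas_agub_iff agub_def vector_coeff_def)
qed

lemma agub_zero_outside: "agub I G J \<delta> K \<Longrightarrow> \<not> (g \<in> G \<and> d \<le> ncrews I) \<Longrightarrow> \<delta> g d = 0"
  unfolding agub_def by metis

lemma vector_coeff_inverse: "agub I G J \<delta> K \<Longrightarrow> vector_coeff I G (coeff_vector \<delta> K) = \<delta>"
  using agub_zero_outside by (fastforce simp: vector_coeff_def coeff_vector_def fun_eq_iff)

lemma agub_vertex_imp_vertex:
  assumes "finite G" "agub_vertex I G J \<delta> K"
  shows "agub_vert I G J (coeff_vector \<delta> K)"
  unfolding vertex_def
proof (intro conjI allI impI)
  let ?M = "agub_cons I G J" and ?N = "agub_vars I G"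
  let ?x = "coeff_vector \<delta> K"
  have ag: "agub I G J \<delta> K" using assms(2) by (simp add: agub_vertex_def)
  show feas: "agub_feas I G J ?x"
    by (rule agub_imp_feas[OF assms(1) ag])
  fix h assume h: "\<forall>i\<in>tight ?M ?N agub_row agub_bound ?x. dot ?N (agub_row i) h = 0"
  obtain s where s: "s > 0" "agub_feas I G J (\<lambda>v. ?x v + s * h v)"
    "agub_feas I G J (\<lambda>v. ?x v + - s * h v)"
    using two_sided_step[OF finite_agub_cons[OF assms(1)] feas, of h] h by blast
  let ?d1 = "vector_coeff I G (\<lambda>v. ?x v + s * h v)" and ?d2 = "vector_coeff I G (\<lambda>v. ?x v + - s * h v)"
  have "?d1 = ?d2 \<and> ?x None + s * h None = ?x None + - s * h None"
  proof -
    have "\<delta> g d = (?d1 g d + ?d2 g d) / 2" for g d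
      using agub_zero_outside[OF ag, of g d] by (auto simp: vector_coeff_def coeff_vector_def)
    moreover have "K = (?x None + s * h None + (?x None + - s * h None)) / 2"
      by (simp add: coeff_vector_def)
    ultimately show ?thesis
      using assms(2) feas_imp_agub[OF assms(1) s(2)] feas_imp_agub[OF assms(1) s(3)]
      unfolding agub_vertex_def by blast
  qed
  then have eq: "?d1 g d = ?d2 g d" "h None = 0" for g d using s(1) by auto
  have "h (Some (g, d)) = 0" if "g \<in> G" "d \<le> ncrews I" for g d
    using eq(1)[of g d] that s(1) by (simp add: vector_coeff_def)
  then show "\<forall>v\<in>?N. h v = 0"
    using eq(2) by (auto simp: agub_vars_def)
qed

lemma vertex_imp_agub_vertex:
  assumes "finite G" and v: "agub_vert I G J x"
  shows "agub_vertex I G J (vector_coeff I G x) (x None)"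
  unfolding agub_vertex_def
proof (intro conjI allI impI)
  let ?M = "agub_cons I G J" and ?N = "agub_vars I G"
  have feas: "agub_feas I G J x" using v by (simp add: vertex_def)
  show "agub I G J (vector_coeff I G x) (x None)"
    by (rule feas_imp_agub[OF assms(1) feas])
  fix \<delta>1 K1 \<delta>2 K2
  assume as: "agub I G J \<delta>1 K1 \<and> agub I G J \<delta>2 K2 \<and> x None = (K1 + K2) / 2 \<and>
      (\<forall>g d. vector_coeff I G x g d = (\<delta>1 g d + \<delta>2 g d) / 2)"
  define x1 where "x1 = coeff_vector \<delta>1 K1"
  define x2 where "x2 = coeff_vector \<delta>2 K2"
  have f1: "agub_feas I G J x1" and f2: "agub_feas I G J x2"
    unfolding x1_def x2_def using as agub_imp_feas[OF assms(1)] by auto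
  have mid: "x v + x v = x1 v + x2 v" if v: "v \<in> ?N" for v
  proof (cases v)
    case None
    then show ?thesis using as by (simp add: x1_def x2_def coeff_vector_def)
  next
    case (Some e)
    then obtain g d where e: "v = Some (g, d)" "g \<in> G" "d \<le> ncrews I"
      using v by (auto simp: agub_vars_def)
    then have "x v = (\<delta>1 g d + \<delta>2 g d) / 2"
      using as by (metis vector_coeff_def)
    then show ?thesis by (simp add: e x1_def x2_def coeff_vector_def)
  qed
  define h where "h v = x1 v + - 1 * x v" for v
  have "dot ?N (agub_row i) h = 0" if "i \<in> tight ?M ?N agub_row agub_bound x" for i
  proof -
    have "i \<in> ?M" "dot ?N (agub_row i) x = agub_bound i"
      using that by (auto simp: tight_def)
    moreover have "dot ?N (agub_row i) (\<lambda>v. x v + 1 * x v) = dot ?N (agub_row i) (\<lambda>v. x1 v + 1 * x2 v)"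
      using mid by (intro dot_cong) auto
    ultimately show ?thesis
      using f1 f2 unfolding h_def dot_step by (force simp: feas_def)
  qed
  then have h0: "\<forall>v\<in>?N. h v = 0" using v unfolding vertex_def by blast
  then have eq: "x1 v = x2 v" if "v \<in> ?N" for v
    using mid[OF that] that by (auto simp: h_def)
  have "K1 = K2" using eq[of None] by (simp add: agub_vars_def x1_def x2_def coeff_vector_def)
  moreover have "\<delta>1 g d = \<delta>2 g d" for g d
  proof (cases "g \<in> G \<and> d \<le> ncrews I")
    case True
    then show ?thesis
      using eq[of "Some (g, d)"] by (simp add: agub_vars_def x1_def x2_def coeff_vector_def)
  next
    case False
    then show ?thesis using as agub_zero_outside by metis
  qed
  ultimately show "\<delta>1 = \<delta>2" "K1 = K2" by auto
qed

lemma finite_agub_vertices: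
  assumes "finite G"
  shows "finite {(\<delta>, K). agub_vertex I G J \<delta> K}"
proof -
  let ?S = "(\<lambda>(\<delta>, K). coeff_vector \<delta> K) ` {(\<delta>, K). agub_vertex I G J \<delta> K}"
  let ?f = "\<lambda>x. (vector_coeff I G x, x None)"
  have "finite (?f ` ?S)"
  proof (rule finite_vertex_image[OF finite_agub_cons[OF assms]])
    show "?S \<subseteq> Collect (agub_vert I G J)"
      using agub_vertex_imp_vertex[OF assms] by auto
    show "?f x = ?f y" if "\<And>v. v \<in> agub_vars I G \<Longrightarrow> x v = y v" for x y
      using that by (auto simp: vector_coeff_def agub_vars_def fun_eq_iff)
  qed
  moreover have "{(\<delta>, K). agub_vertex I G J \<delta> K} \<subseteq> ?f ` ?S"
  proof clarify
    fix \<delta> K assume v: "agub_vertex I G J \<delta> K"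
    then have "agub I G J \<delta> K" by (simp add: agub_vertex_def)
    then have "(\<delta>, K) = ?f (coeff_vector \<delta> K)"
      by (simp add: vector_coeff_inverse) (simp add: coeff_vector_def)
    then show "(\<delta>, K) \<in> ?f ` ?S" using v by blast
  qed
  ultimately show ?thesis by (rule finite_subset[rotated])
qed

lemma finite_cut_universe:
  assumes "wf_network I"
  shows "finite (cut_universe I)"
proof -
  have fin: "finite (fires I)" "finite (crews I)" using assms by (auto simp: wf_network_def)
  let ?f = "\<lambda>(t, J, \<delta>, K). full_cut I t J \<delta> K"
  let ?X = "periods I \<times> (SIGMA J : Pow (crews I). {(\<delta>, K). agub_vertex I (fires I) J \<delta> K})"
  have "cut_universe I \<subseteq> ?f ` ?X"
  proof
    fix u assume "u \<in> cut_universe I"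
    then obtain t J \<delta> K where u: "u = ?f (t, J, \<delta>, K)"
      and "t \<in> periods I" "J \<subseteq> crews I" "agub_vertex I (fires I) J \<delta> K"
      unfolding cut_universe_def prod.case by blast
    then show "u \<in> ?f ` ?X"
      unfolding u by (intro imageI) simp
  qed
  moreover have "finite ?X"
    using fin finite_agub_vertices by blast
  ultimately show ?thesis using finite_surj by blast
qed

lemma cglp_solution_cut:
  assumes "t \<in> periods I" "cglp_solution I t y z \<delta> K"
  shows "cglp_cut I t z \<delta> K \<in> cut_universe I"
proof -
  have "agub_vertex I (fires I) (idle_crews I t z) \<delta> K"
    using assms(2) unfolding cglp_solution_def agub_vertex_def Let_def by blast
  moreover have "idle_crews I t z \<subseteq> crews I"
    by (auto simp: idle_crews_def)
  ultimately show ?thesis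
    using assms(1) unfolding cut_universe_def cglp_cut_def by blast
qed

definition cglp_objective :: "('j, 'l, 's::linorder) network \<Rightarrow> nat \<Rightarrow> ('l, 's) yvars \<Rightarrow> ('l \<times> nat) option \<Rightarrow> real" where
  "cglp_objective I t y v = (case v of None \<Rightarrow> - 1
     | Some (g, d) \<Rightarrow> \<Sum>q\<in>plans I g. of_bool (demand I g q t = d) * y g q)"

lemma cglp_value_dot:
  assumes "finite (fires I)"
  shows "cglp_value I t y \<delta> K = dot (agub_vars I (fires I)) (cglp_objective I t y) (coeff_vector \<delta> K)"
proof -
  have "(\<Sum>q\<in>plans I g. \<Sum>d = 0..ncrews I. of_bool (demand I g q t = d) * y g q * \<delta> g d) =
      (\<Sum>d = 0..ncrews I. (\<Sum>q\<in>plans I g. of_bool (demand I g q t = d) * y g q) * \<delta> g d)" for g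
    unfolding sum_distrib_right by (rule sum.swap)
  then show ?thesis
    by (simp add: cglp_value_def cglp_objective_def dot_agub_vars[OF assms] coeff_vector_def sum.cartesian_product split_def)
qed

lemma cglp_value_vector:
  assumes "finite (fires I)"
  shows "cglp_value I t y (vector_coeff I (fires I) x) (x None) = dot (agub_vars I (fires I)) (cglp_objective I t y) x"
  unfolding cglp_value_dot[OF assms]
  by (intro dot_cong) (auto simp: coeff_vector_def vector_coeff_def agub_vars_def)

text \<open>
  The coefficients are bounded, and the empty packing bounds \<open>K\<close> from below. So a recession direction can
  only raise \<open>K\<close>, which lowers the objective, and the optimum is attained at a vertex.
\<close>

lemma cglp_solution_exists:
  assumes "wf_network I"
  shows "\<exists>\<delta> K. cglp_solution I t y z \<delta> K"
proof -
  have fin: "finite (fires I)" "finite (crews I)" using assms by (auto simp: wf_network_def)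
  let ?J = "idle_crews I t z" and ?G = "fires I"
  let ?M = "agub_cons I ?G ?J" and ?N = "agub_vars I ?G"
  let ?c = "cglp_objective I t y"
  have "card ?J \<le> ncrews I"
    using fin by (intro card_mono) (auto simp: idle_crews_def)
  then have empty: "{} \<in> demand_packings I ?G ?J"
    by (simp add: demand_packings_def)
  have "agub_feas I ?G ?J (\<lambda>_. 0)"
    by (simp add: feas_agub_iff[OF fin(1)])
  moreover have "dot ?N ?c h < 0"
    if h: "\<forall>i\<in>?M. dot ?N (agub_row i) h \<le> 0" and nz: "\<exists>v\<in>?N. h v \<noteq> 0" for h
  proof -
    have e: "h (Some e) = 0" if "e \<in> ?G \<times> {0..ncrews I}" for e
      using h that unfolding agub_cons_def ball_Plus
      by (metis dot_agub_row(1,2)[OF fin(1)] neg_le_0_iff_le order_antisym)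
    have "0 \<le> h None"
      using h empty unfolding agub_cons_def ball_Plus
      by (fastforce simp: dot_agub_row(3)[OF fin(1), of "{}" I ?J h])
    moreover have "h None \<noteq> 0" using nz e by (auto simp: agub_vars_def)
    ultimately show ?thesis
      using e by (simp add: dot_agub_vars[OF fin(1)] cglp_objective_def)
  qed
  ultimately obtain x where v: "agub_vert I ?G ?J x"
    and opt: "\<And>x'. agub_feas I ?G ?J x' \<Longrightarrow> dot ?N ?c x' \<le> dot ?N ?c x"
    using optimal_vertex[OF finite_agub_cons[OF fin(1)], of I ?J ?N agub_row agub_bound "\<lambda>_. 0" ?c] by blast
  have "cglp_value I t y \<delta> K \<le> cglp_value I t y (vector_coeff I ?G x) (x None)" if "agub I ?G ?J \<delta> K" for \<delta> K
    using opt[OF agub_imp_feas[OF fin(1) that]] cglp_value_vector[OF fin(1), of t y x]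
      cglp_value_dot[OF fin(1), of t y \<delta> K] by (simp only:)
  then have "cglp_solution I t y z (vector_coeff I ?G x) (x None)"
    using vertex_imp_agub_vertex[OF fin(1) v] unfolding agub_vertex_def cglp_solution_def Let_def by blast
  then show ?thesis by blast
qed

text \<open>
  The idle crews put their whole weight on routes without assignment, so the crew part of the left-hand
  side is their number, and the cut says that the cut-generating program has no positive value here.
\<close>

lemma satisfied_cut_value:
  assumes wf: "wf_network I"
    and z: "\<And>j p. j \<in> crews I \<Longrightarrow> p \<in> routes I j \<Longrightarrow> 0 \<le> z j p"
      "\<And>j. j \<in> crews I \<Longrightarrow> (\<Sum>p\<in>routes I j. z j p) = 1"
    and sat: "satisfies_cut I y z (cglp_cut I t z \<delta> K)"
  shows "cglp_value I t y \<delta> K \<le> 0"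
proof -
  have fin: "finite (fires I)" "finite (crews I)" using wf by (auto simp: wf_network_def)
  let ?u = "cglp_cut I t z \<delta> K"
  have "plan_coeff I ?u g q * y g q = (\<Sum>d = 0..ncrews I. of_bool (demand I g q t = d) * y g q * \<delta> g d)"
    if "g \<in> fires I" for g q
  proof -
    have "plan_coeff I ?u g q = (\<Sum>d = 0..ncrews I. of_bool (demand I g q t = d) * \<delta> g d)"
      using that by (simp add: plan_coeff_def cglp_cut_def)
    then show ?thesis
      unfolding sum_distrib_right by (simp only: mult.assoc mult.commute[of "y g q"] sum_distrib_right)
  qed
  then have "(\<Sum>g\<in>fires I. \<Sum>q\<in>plans I g. plan_coeff I ?u g q * y g q) = cglp_value I t y \<delta> K + K"
    by (simp add: cglp_value_def)
  moreover have "(\<Sum>j\<in>crews I. \<Sum>p\<in>routes I j. route_coeff I ?u j p * z j p) = card (idle_crews I t z)"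
  proof -
    have "(\<Sum>p\<in>routes I j. route_coeff I ?u j p * z j p) = of_bool (j \<in> idle_crews I t z)" if j: "j \<in> crews I" for j
    proof (cases "j \<in> idle_crews I t z")
      case True
      then have "(\<Sum>p\<in>routes I j. \<Sum>g\<in>fires I. assigned I j p g t * z j p) = 0"
        by (simp add: idle_crews_def)
      then have "(\<Sum>g\<in>fires I. assigned I j p g t * z j p) = 0" if "p \<in> routes I j" for p
        using that z(1)[OF j] finite_routes[OF wf j]
        by (subst (asm) sum_nonneg_eq_0_iff) (auto intro!: sum_nonneg mult_nonneg_nonneg assigned_nonneg)
      then have "route_coeff I ?u j p * z j p = z j p" if "p \<in> routes I j" for p
        using that True by (auto simp: route_coeff_def cglp_cut_def simp flip: sum_distrib_right)
      then have "(\<Sum>p\<in>routes I j. route_coeff I ?u j p * z j p) = (\<Sum>p\<in>routes I j. z j p)"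
        by (rule sum.cong[OF refl])
      then show ?thesis using True z(2)[OF j] by simp
    next
      case False
      then show ?thesis by (simp add: route_coeff_def cglp_cut_def)
    qed
    then have "(\<Sum>j\<in>crews I. \<Sum>p\<in>routes I j. route_coeff I ?u j p * z j p) =
        (\<Sum>j\<in>crews I. of_bool (j \<in> idle_crews I t z))"
      by (intro sum.cong) auto
    also have "\<dots> = card {j \<in> crews I. j \<in> idle_crews I t z}"
      using fin by (simp add: Int_def)
    also have "{j \<in> crews I. j \<in> idle_crews I t z} = idle_crews I t z"
      by (auto simp: idle_crews_def)
    finally show ?thesis .
  qed
  ultimately show ?thesis
    using sat by (simp add: satisfies_cut_def cut_rhs_def cglp_cut_def)
qed

section \<open>The restricted master problem as a linear program\<close>

type_synonym ('j, 'l, 's) column = "('l \<times> 's plan) + ('j \<times> 'l route)"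

text \<open>
  The constraint matrix, with cuts turned into inequalities of the form \<open>\<ge>\<close>. The prices of its columns are
  exactly \<open>plan_price\<close> and \<open>route_price\<close>.
\<close>

fun coef :: "('j, 'l, 's::linorder) network \<Rightarrow> ('j, 'l) row \<Rightarrow> ('j, 'l, 's) column \<Rightarrow> real" where
  "coef I (Sigma_row g) (Inl (g', q)) = of_bool (g = g')"
| "coef I (Sigma_row g) (Inr (j, p)) = 0"
| "coef I (Pi_row j) (Inl (g, q)) = 0"
| "coef I (Pi_row j) (Inr (j', p)) = of_bool (j = j')"
| "coef I (Rho_row g t) (Inl (g', q)) = of_bool (g = g') * - real (demand I g q t)"
| "coef I (Rho_row g t) (Inr (j, p)) = assigned I j p g t"
| "coef I (Cut_row u) (Inl (g, q)) = - plan_coeff I u g q"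
| "coef I (Cut_row u) (Inr (j, p)) = - route_coeff I u j p"

fun rhs :: "('j, 'l) row \<Rightarrow> real" where
  "rhs (Sigma_row g) = 1"
| "rhs (Pi_row j) = 1"
| "rhs (Rho_row g t) = 0"
| "rhs (Cut_row u) = - cut_rhs u"

fun column_cost :: "('j, 'l, 's::linorder) network \<Rightarrow> ('j, 'l, 's) column \<Rightarrow> real" where
  "column_cost I (Inl (g, q)) = plan_cost I g q"
| "column_cost I (Inr (j, p)) = route_cost I j p"

definition columns :: "('j, 'l, 's::linorder) network \<Rightarrow> ('j, 'l) decision set \<Rightarrow>
    ('l, 's) plan_sets \<Rightarrow> ('j, 'l) route_sets \<Rightarrow> ('j, 'l, 's) column set" where
  "columns I D Q P = (SIGMA g : fires I. Q g \<inter> allowed_plans I D g) <+> (SIGMA j : crews I. P j \<inter> allowed_routes I D j)"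

definition all_columns :: "('j, 'l, 's::linorder) network \<Rightarrow> ('j, 'l, 's) column set" where
  "all_columns I = (SIGMA g : fires I. plans I g) <+> (SIGMA j : crews I. routes I j)"

definition free_rows :: "('j, 'l, 's) network \<Rightarrow> ('j, 'l) row set" where
  "free_rows I = Sigma_row ` fires I \<union> Pi_row ` crews I"

definition weights :: "('l, 's) yvars \<Rightarrow> ('j, 'l) zvars \<Rightarrow> ('j, 'l, 's) column \<Rightarrow> real" where
  "weights y z c = (case c of Inl (g, q) \<Rightarrow> y g q | Inr (j, p) \<Rightarrow> z j p)"

text \<open>
  The weight of missing and disallowed columns is zero, so sums over all columns are sums over those at hand.
\<close>

definition supported :: "('j, 'l, 's::linorder) network \<Rightarrow> ('j, 'l) decision set \<Rightarrow> ('l, 's) plan_sets \<Rightarrow>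
    ('j, 'l) route_sets \<Rightarrow> ('l, 's) yvars \<Rightarrow> ('j, 'l) zvars \<Rightarrow> bool" where
  "supported I D Q P y z \<longleftrightarrow>
     (\<forall>g\<in>fires I. \<forall>q\<in>plans I g. q \<notin> Q g \<inter> allowed_plans I D g \<longrightarrow> y g q = 0) \<and>
     (\<forall>j\<in>crews I. \<forall>p\<in>routes I j. p \<notin> P j \<inter> allowed_routes I D j \<longrightarrow> z j p = 0)"

locale suppression_instance =
  fixes I :: "('j, 'l, 's::linorder) network"
  assumes wf: "wf_network I"
    and fires_nonempty: "fires I \<noteq> {}"
    and crew_cost: "\<And>j a. j \<in> crews I \<Longrightarrow> a \<in> crew_arcs I j \<Longrightarrow> 0 \<le> crew_cost I j a"
    and fire_cost: "\<And>g a. g \<in> fires I \<Longrightarrow> a \<in> fire_arcs I g \<Longrightarrow> 0 \<le> fire_cost I g a"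
begin

lemma fin: "finite (fires I)" "finite (crews I)"
  using wf by (auto simp: wf_network_def)

lemma fin_plans: "g \<in> fires I \<Longrightarrow> finite (plans I g)"
  by (rule finite_plans[OF wf])

lemma fin_routes: "j \<in> crews I \<Longrightarrow> finite (routes I j)"
  by (rule finite_routes[OF wf])

lemma allowed_plans_subset: "allowed_plans I D g \<subseteq> plans I g"
  by (auto simp: allowed_plans_def)

lemma allowed_routes_subset: "allowed_routes I D j \<subseteq> routes I j"
  by (auto simp: allowed_routes_def)

lemma finite_all_columns: "finite (all_columns I)"
  unfolding all_columns_def using fin fin_plans fin_routes by (intro finite_Plus finite_SigmaI) auto

lemma columns_subset: "columns I D Q P \<subseteq> all_columns I"
  unfolding columns_def all_columns_def using allowed_plans_subset allowed_routes_subset by blast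

lemma finite_columns: "finite (columns I D Q P)"
  by (rule finite_subset[OF columns_subset finite_all_columns])

lemma ball_columns: "(\<forall>c\<in>columns I D Q P. H c) \<longleftrightarrow>
    (\<forall>g\<in>fires I. \<forall>q\<in>Q g \<inter> allowed_plans I D g. H (Inl (g, q))) \<and>
    (\<forall>j\<in>crews I. \<forall>p\<in>P j \<inter> allowed_routes I D j. H (Inr (j, p)))"
  unfolding columns_def ball_Plus by auto

lemma column_cost_nonneg: "c \<in> all_columns I \<Longrightarrow> 0 \<le> column_cost I c"
  unfolding all_columns_def using plan_cost_nonneg[OF fire_cost] route_cost_nonneg[OF crew_cost] by auto

lemma sum_columns:
  assumes "supported I D Q P y z"
  shows "dot (columns I D Q P) f (weights y z) =
    (\<Sum>g\<in>fires I. \<Sum>q\<in>plans I g. f (Inl (g, q)) * y g q) +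
    (\<Sum>j\<in>crews I. \<Sum>p\<in>routes I j. f (Inr (j, p)) * z j p)"
proof -
  have fp: "finite (Q g \<inter> allowed_plans I D g)" if "g \<in> fires I" for g
    using that fin_plans allowed_plans_subset by (meson finite_Int finite_subset)
  have fr: "finite (P j \<inter> allowed_routes I D j)" if "j \<in> crews I" for j
    using that fin_routes allowed_routes_subset by (meson finite_Int finite_subset)
  have "dot (columns I D Q P) f (weights y z) =
    (\<Sum>(g, q)\<in>(SIGMA g : fires I. Q g \<inter> allowed_plans I D g). f (Inl (g, q)) * y g q) +
    (\<Sum>(j, p)\<in>(SIGMA j : crews I. P j \<inter> allowed_routes I D j). f (Inr (j, p)) * z j p)"
    unfolding dot_def columns_def using fin fp fr
    by (subst sum.Plus) (auto simp: weights_def split_def comp_def intro!: finite_SigmaI)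
  also have "\<dots> = (\<Sum>g\<in>fires I. \<Sum>q\<in>Q g \<inter> allowed_plans I D g. f (Inl (g, q)) * y g q) +
    (\<Sum>j\<in>crews I. \<Sum>p\<in>P j \<inter> allowed_routes I D j. f (Inr (j, p)) * z j p)"
    using fin fp fr by (simp add: sum.Sigma)
  also have "(\<Sum>g\<in>fires I. \<Sum>q\<in>Q g \<inter> allowed_plans I D g. f (Inl (g, q)) * y g q) =
      (\<Sum>g\<in>fires I. \<Sum>q\<in>plans I g. f (Inl (g, q)) * y g q)"
    using fin_plans allowed_plans_subset assms
    by (intro sum.cong refl sum.mono_neutral_left) (auto simp: supported_def)
  also have "(\<Sum>j\<in>crews I. \<Sum>p\<in>P j \<inter> allowed_routes I D j. f (Inr (j, p)) * z j p) =
      (\<Sum>j\<in>crews I. \<Sum>p\<in>routes I j. f (Inr (j, p)) * z j p)"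
    using fin_routes allowed_routes_subset assms
    by (intro sum.cong refl sum.mono_neutral_left) (auto simp: supported_def)
  finally show ?thesis .
qed

lemma ball_rows: "(\<forall>r\<in>rows I U. H r) \<longleftrightarrow> (\<forall>g\<in>fires I. H (Sigma_row g)) \<and> (\<forall>j\<in>crews I. H (Pi_row j)) \<and>
    (\<forall>g\<in>fires I. \<forall>t\<in>periods I. H (Rho_row g t)) \<and> (\<forall>u\<in>U. H (Cut_row u))"
  unfolding rows_def by auto

lemma ball_free_rows: "(\<forall>r\<in>free_rows I. H r) \<longleftrightarrow> (\<forall>g\<in>fires I. H (Sigma_row g)) \<and> (\<forall>j\<in>crews I. H (Pi_row j))"
  unfolding free_rows_def by auto

lemma free_rows_subset: "free_rows I \<subseteq> rows I U"
  by (auto simp: free_rows_def rows_def)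

lemma ball_bound_rows: "(\<forall>r\<in>rows I U - free_rows I. H r) \<longleftrightarrow>
    (\<forall>g\<in>fires I. \<forall>t\<in>periods I. H (Rho_row g t)) \<and> (\<forall>u\<in>U. H (Cut_row u))"
proof -
  have "rows I U - free_rows I = (\<lambda>(g, t). Rho_row g t) ` (fires I \<times> periods I) \<union> Cut_row ` U"
    by (auto simp: rows_def free_rows_def)
  then show ?thesis by auto
qed

lemma finite_rows: "finite U \<Longrightarrow> finite (rows I U)"
  using fin by (simp add: rows_def)

lemma sum_rows:
  assumes "finite U"
  shows "(\<Sum>r\<in>rows I U. f r) = (\<Sum>g\<in>fires I. f (Sigma_row g)) + (\<Sum>j\<in>crews I. f (Pi_row j)) +
    (\<Sum>g\<in>fires I. \<Sum>t\<in>periods I. f (Rho_row g t)) + (\<Sum>u\<in>U. f (Cut_row u))"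
proof -
  have rho: "(\<Sum>r\<in>(\<lambda>(g, t). Rho_row g t) ` (fires I \<times> periods I). f r) =
      (\<Sum>g\<in>fires I. \<Sum>t\<in>periods I. f (Rho_row g t))"
    by (subst sum.reindex) (auto simp: inj_on_def sum.cartesian_product split_def)
  have "(\<Sum>r\<in>rows I U. f r) = (\<Sum>r\<in>Sigma_row ` fires I. f r) + (\<Sum>r\<in>Pi_row ` crews I. f r) +
      (\<Sum>r\<in>(\<lambda>(g, t). Rho_row g t) ` (fires I \<times> periods I). f r) + (\<Sum>r\<in>Cut_row ` U. f r)"
    unfolding rows_def using fin assms
    by (subst sum.union_disjoint, simp, simp, force)+ simp
  then show ?thesis
    unfolding rho by (simp add: sum.reindex inj_on_def)
qed

lemma plan_price_dot:
  assumes "finite U" "g \<in> fires I"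
  shows "price (rows I U) (coef I) w (Inl (g, q)) = plan_price I U w g q"
proof -
  have "(\<Sum>g'\<in>fires I. w (Sigma_row g') * of_bool (g' = g)) = w (Sigma_row g)"
    using fin(1) assms(2) sum.delta'[of "fires I" g "\<lambda>g. w (Sigma_row g)"]
    by (simp add: of_bool_def if_distrib eq_commute cong: if_cong)
  moreover have "(\<Sum>g'\<in>fires I. \<Sum>t\<in>periods I. w (Rho_row g' t) * (of_bool (g' = g) * - real (demand I g' q t)))
      = - (\<Sum>t\<in>periods I. real (demand I g q t) * w (Rho_row g t))"
  proof -
    have "(\<Sum>t\<in>periods I. w (Rho_row g' t) * (of_bool (g' = g) * - real (demand I g' q t))) =
        (if g' = g then - (\<Sum>t\<in>periods I. real (demand I g q t) * w (Rho_row g t)) else 0)" for g'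
      by (simp add: sum_negf mult.commute)
    then show ?thesis using fin(1) assms(2) by simp
  qed
  ultimately show ?thesis
    using assms(1) by (simp add: dot_def sum_rows plan_price_def sum_negf mult.commute)
qed

lemma route_price_dot:
  assumes "finite U" "j \<in> crews I"
  shows "price (rows I U) (coef I) w (Inr (j, p)) = route_price I U w j p"
proof -
  have "(\<Sum>j'\<in>crews I. w (Pi_row j') * of_bool (j' = j)) = w (Pi_row j)"
    using fin(2) assms(2) sum.delta'[of "crews I" j "\<lambda>j. w (Pi_row j)"]
    by (simp add: of_bool_def if_distrib eq_commute cong: if_cong)
  then show ?thesis
    using assms(1) by (simp add: dot_def sum_rows route_price_def sum_negf mult.commute)
qed

lemma dual_objective_dot: "finite U \<Longrightarrow> dot (rows I U) w rhs = dual_objective I U w"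
  by (simp add: dot_def sum_rows dual_objective_def sum_negf mult.commute)

lemma dual_constraints_lp:
  assumes "finite U"
  shows "dual_constraints I D U Q P k w \<longleftrightarrow>
    lp_dual (columns I D Q P) (rows I U) (free_rows I) (coef I) (\<lambda>c. k * column_cost I c) w"
  unfolding dual_constraints_def lp_dual_def ball_columns ball_bound_rows
  using assms by (simp add: plan_price_dot route_price_dot)

lemma cost_dot:
  assumes "supported I D Q P y z"
  shows "cost I y z = dot (columns I D Q P) (column_cost I) (weights y z)"
  unfolding cost_def sum_columns[OF assms] by simp

lemma rmp_feasible_lp:
  assumes "supported I D Q P y z"
  shows "rmp_feasible I D U Q P y z \<longleftrightarrow>
    (\<forall>g\<in>fires I. \<forall>q\<in>plans I g. 0 \<le> y g q) \<and> (\<forall>j\<in>crews I. \<forall>p\<in>routes I j. 0 \<le> z j p) \<and>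
    (\<forall>r\<in>rows I U. rhs r \<le> dot (columns I D Q P) (coef I r) (weights y z)) \<and>
    (\<forall>r\<in>free_rows I. dot (columns I D Q P) (coef I r) (weights y z) = rhs r)"
proof -
  note dot = sum_columns[OF assms]
  have sigma: "dot (columns I D Q P) (coef I (Sigma_row g)) (weights y z) = (\<Sum>q\<in>plans I g. y g q)"
    if "g \<in> fires I" for g
  proof -
    have "(\<Sum>q\<in>plans I g'. of_bool (g = g') * y g' q) = (if g' = g then \<Sum>q\<in>plans I g. y g q else 0)" for g'
      by simp
    then show ?thesis using fin(1) that by (simp add: dot)
  qed
  have pi: "dot (columns I D Q P) (coef I (Pi_row j)) (weights y z) = (\<Sum>p\<in>routes I j. z j p)"
    if "j \<in> crews I" for j
  proof -
    have "(\<Sum>p\<in>routes I j'. of_bool (j = j') * z j' p) = (if j' = j then \<Sum>p\<in>routes I j. z j p else 0)" for j'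
      by simp
    then show ?thesis using fin(2) that by (simp add: dot)
  qed
  have rho: "dot (columns I D Q P) (coef I (Rho_row g t)) (weights y z) =
      (\<Sum>j\<in>crews I. \<Sum>p\<in>routes I j. assigned I j p g t * z j p) -
      (\<Sum>q\<in>plans I g. real (demand I g q t) * y g q)" if "g \<in> fires I" for g t
  proof -
    have "(\<Sum>q\<in>plans I g'. of_bool (g = g') * - real (demand I g q t) * y g' q) =
        (if g' = g then - (\<Sum>q\<in>plans I g. real (demand I g q t) * y g q) else 0)" for g'
      by (simp add: sum_negf)
    then show ?thesis using fin(1) that by (simp add: dot)
  qed
  have cut: "dot (columns I D Q P) (coef I (Cut_row u)) (weights y z) =
      - ((\<Sum>g\<in>fires I. \<Sum>q\<in>plans I g. plan_coeff I u g q * y g q) +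
         (\<Sum>j\<in>crews I. \<Sum>p\<in>routes I j. route_coeff I u j p * z j p))" for u
    by (simp add: dot sum_negf)
  have "rmp_feasible I D U Q P y z \<longleftrightarrow>
      (\<forall>g\<in>fires I. \<forall>q\<in>plans I g. 0 \<le> y g q) \<and> (\<forall>j\<in>crews I. \<forall>p\<in>routes I j. 0 \<le> z j p) \<and>
      sp_constraints I y z \<and> (\<forall>u\<in>U. satisfies_cut I y z u)"
    using assms unfolding rmp_feasible_def supported_def by blast
  also have "\<dots> \<longleftrightarrow> (\<forall>g\<in>fires I. \<forall>q\<in>plans I g. 0 \<le> y g q) \<and> (\<forall>j\<in>crews I. \<forall>p\<in>routes I j. 0 \<le> z j p) \<and>
    (\<forall>r\<in>rows I U. rhs r \<le> dot (columns I D Q P) (coef I r) (weights y z)) \<and>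
    (\<forall>r\<in>free_rows I. dot (columns I D Q P) (coef I r) (weights y z) = rhs r)"
    unfolding ball_rows ball_free_rows sp_constraints_def satisfies_cut_def
    by (auto simp: sigma pi rho cut)
  finally show ?thesis .
qed

lemma rmp_feasible_supported: "rmp_feasible I D U Q P y z \<Longrightarrow> supported I D Q P y z"
  unfolding rmp_feasible_def supported_def by blast

lemma rmp_feasible_imp_lp:
  assumes "rmp_feasible I D U Q P y z"
  shows "lp_feasible (columns I D Q P) (rows I U) (free_rows I) (coef I) rhs (weights y z)"
proof -
  have "\<forall>c\<in>columns I D Q P. 0 \<le> weights y z c"
    unfolding ball_columns weights_def
    using assms allowed_plans_subset allowed_routes_subset by (fastforce simp: rmp_feasible_def)
  then show ?thesis
    using assms rmp_feasible_lp[OF rmp_feasible_supported[OF assms]] unfolding lp_feasible_def by blast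
qed

lemma lp_imp_rmp_feasible:
  assumes x: "lp_feasible (columns I D Q P) (rows I U) (free_rows I) (coef I) rhs x"
  shows "\<exists>y z. rmp_feasible I D U Q P y z \<and> cost I y z = dot (columns I D Q P) (column_cost I) x"
proof -
  define y where "y g q = (if Inl (g, q) \<in> columns I D Q P then x (Inl (g, q)) else 0)" for g q
  define z where "z j p = (if Inr (j, p) \<in> columns I D Q P then x (Inr (j, p)) else 0)" for j p
  have sup: "supported I D Q P y z"
    by (auto simp: supported_def y_def z_def columns_def)
  have "weights y z c = x c" if "c \<in> columns I D Q P" for c
    using that by (auto simp: weights_def y_def z_def split: sum.split)
  then have dot: "dot (columns I D Q P) f (weights y z) = dot (columns I D Q P) f x" for f
    by (intro dot_cong) auto
  have "0 \<le> y g q" "0 \<le> z j p" for g q j p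
    using x by (auto simp: lp_feasible_def y_def z_def)
  then have "rmp_feasible I D U Q P y z"
    using x unfolding rmp_feasible_lp[OF sup] dot lp_feasible_def by blast
  then show ?thesis
    using cost_dot[OF sup] dot by metis
qed

lemma rmp_weak_duality:
  assumes "finite U" "rmp_feasible I D U Q P y z" "dual_constraints I D U Q P k w"
  shows "dual_objective I U w \<le> k * cost I y z"
proof -
  have "dot (rows I U) w rhs \<le> dot (columns I D Q P) (\<lambda>c. k * column_cost I c) (weights y z)"
    using assms by (intro weak_duality[OF finite_columns finite_rows])
      (auto simp: rmp_feasible_imp_lp dual_constraints_lp)
  also have "\<dots> = k * cost I y z"
    unfolding cost_dot[OF rmp_feasible_supported[OF assms(2)]]
    by (simp add: dot_def sum_distrib_left mult.assoc)
  finally show ?thesis using assms(1) by (simp add: dual_objective_dot)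
qed

text \<open>
  Every column occurs with coefficient 1 in a partitioning equation whose coefficients are nonnegative.
\<close>

lemma rmp_bounded:
  assumes h: "lp_feasible (columns I D Q P) (rows I U) (free_rows I) (coef I) (\<lambda>_. 0) h"
    and c: "c \<in> columns I D Q P"
  shows "h c = 0"
proof -
  obtain r where r: "r \<in> free_rows I" "coef I r c = 1" "\<forall>c'\<in>columns I D Q P. 0 \<le> coef I r c'"
  proof (cases c)
    case (Inl gq)
    then obtain g q where gq: "c = Inl (g, q)" "g \<in> fires I" using c by (auto simp: columns_def)
    show ?thesis
      by (rule that[of "Sigma_row g"]) (use gq in \<open>auto simp: free_rows_def columns_def\<close>)
  next
    case (Inr jp)
    then obtain j p where jp: "c = Inr (j, p)" "j \<in> crews I" using c by (auto simp: columns_def)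
    show ?thesis
      by (rule that[of "Pi_row j"]) (use jp in \<open>auto simp: free_rows_def columns_def\<close>)
  qed
  have "(\<Sum>c\<in>columns I D Q P. coef I r c * h c) = 0"
    using h r(1) by (auto simp: lp_feasible_def dot_def)
  then have "coef I r c * h c = 0"
    using c h r(3) finite_columns by (subst (asm) sum_nonneg_eq_0_iff) (auto simp: lp_feasible_def)
  then show ?thesis using r(2) by simp
qed

lemma rmp_optimal_exists:
  assumes "finite U" "rmp_feasible I D U Q P y0 z0"
  shows "\<exists>y z. rmp_optimal I D U Q P y z"
proof -
  let ?N = "columns I D Q P"
  obtain x where x: "lp_feasible ?N (rows I U) (free_rows I) (coef I) rhs x"
    and opt: "\<And>x'. lp_feasible ?N (rows I U) (free_rows I) (coef I) rhs x' \<Longrightarrow>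
      dot ?N (column_cost I) x \<le> dot ?N (column_cost I) x'"
    using lp_optimum[OF finite_columns finite_rows[OF assms(1)] free_rows_subset
        rmp_feasible_imp_lp[OF assms(2)], where k = "column_cost I"] rmp_bounded by blast
  obtain y z where yz: "rmp_feasible I D U Q P y z" "cost I y z = dot ?N (column_cost I) x"
    using lp_imp_rmp_feasible[OF x] by blast
  have "cost I y z \<le> cost I y' z'" if "rmp_feasible I D U Q P y' z'" for y' z'
    using opt[OF rmp_feasible_imp_lp[OF that]] yz(2) cost_dot[OF rmp_feasible_supported[OF that]] by simp
  then show ?thesis using yz(1) unfolding rmp_optimal_def by blast
qed

lemma rmp_strong_duality:
  assumes "finite U" "rmp_optimal I D U Q P y z"
  shows "\<exists>w. dual_constraints I D U Q P 1 w \<and> cost I y z \<le> dual_objective I U w"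
proof -
  have "\<exists>w. lp_dual (columns I D Q P) (rows I U) (free_rows I) (coef I) (column_cost I) w \<and>
      cost I y z \<le> dot (rows I U) w rhs"
  proof (rule strong_duality[OF finite_columns finite_rows[OF assms(1)] free_rows_subset])
    show "0 \<le> column_cost I c" if "c \<in> columns I D Q P" for c
      using that columns_subset column_cost_nonneg by blast
    show "cost I y z \<le> dot (columns I D Q P) (column_cost I) x"
      if "lp_feasible (columns I D Q P) (rows I U) (free_rows I) (coef I) rhs x" for x
      using lp_imp_rmp_feasible[OF that] assms(2) unfolding rmp_optimal_def by metis
  qed
  then show ?thesis
    using assms(1) by (simp add: dual_constraints_lp dual_objective_dot)
qed

lemma dual_optimal_exists:
  assumes "finite U" "rmp_optimal I D U Q P y z"
  shows "\<exists>w. dual_optimal I D U Q P w"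
proof -
  obtain w where w: "dual_constraints I D U Q P 1 w" "cost I y z \<le> dual_objective I U w"
    using rmp_strong_duality[OF assms] by blast
  have "dual_objective I U w' \<le> dual_objective I U w" if "dual_constraints I D U Q P 1 w'" for w'
    using rmp_weak_duality[OF assms(1) _ that] assms(2) w(2) unfolding rmp_optimal_def by fastforce
  then show ?thesis using w(1) unfolding dual_optimal_def by blast
qed

lemma dual_optimal_objective:
  assumes "finite U" "rmp_optimal I D U Q P y z" "dual_optimal I D U Q P w"
  shows "cost I y z \<le> dual_objective I U w"
  using rmp_strong_duality[OF assms(1,2)] assms(3) unfolding dual_optimal_def by fastforce

lemma dual_extreme_ray_lp:
  assumes "finite U"
  shows "dual_extreme_ray I D U Q P w \<longleftrightarrow>
    lp_ray (columns I D Q P) (rows I U) (free_rows I) (coef I) rhs w"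
  unfolding dual_extreme_ray_def lp_ray_def dual_constraints_lp[OF assms] dual_objective_dot[OF assms]
  by simp

lemma dual_extreme_ray_exists:
  assumes "finite U" "\<nexists>y z. rmp_feasible I D U Q P y z"
  shows "\<exists>w. dual_extreme_ray I D U Q P w"
proof -
  have "\<nexists>x. lp_feasible (columns I D Q P) (rows I U) (free_rows I) (coef I) rhs x"
    using assms(2) lp_imp_rmp_feasible by blast
  then obtain w where "lp_dual (columns I D Q P) (rows I U) (free_rows I) (coef I) (\<lambda>_. 0) w"
      "0 < dot (rows I U) w rhs"
    using infeasible_ray[OF finite_columns finite_rows[OF assms(1)] free_rows_subset] by blast
  then show ?thesis
    unfolding dual_extreme_ray_lp[OF assms(1)]
    by (rule extreme_ray_exists[OF finite_columns finite_rows[OF assms(1)]])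
qed

text \<open>
  A lower bound for the positive prices of normalised extreme rays that does not depend on the cuts, the
  decisions and the columns at hand. It decides how large \<open>M'\<close> has to be.
\<close>

definition price_gap :: "real \<Rightarrow> bool" where
  "price_gap m \<longleftrightarrow> 0 < m \<and> (\<forall>U D Q P w. U \<subseteq> cut_universe I \<and> dual_extreme_ray I D U Q P w \<longrightarrow>
     (\<forall>c\<in>all_columns I. 0 < price (rows I U) (coef I) w c \<longrightarrow>
        m * (\<Sum>r\<in>rows I U. \<bar>w r\<bar>) \<le> price (rows I U) (coef I) w c))"

lemma price_gap_exists: "\<exists>m. price_gap m"
proof -
  have fU: "finite U" if "U \<subseteq> cut_universe I" for U
    using that finite_cut_universe[OF wf] finite_subset by blast
  let ?X = "Pow (all_columns I) \<times> Pow (cut_universe I)"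
  define gap where "gap N U m \<longleftrightarrow> 0 < m \<and> (\<forall>w. lp_ray N (rows I U) (free_rows I) (coef I) rhs w \<longrightarrow>
      (\<forall>c\<in>all_columns I. 0 < price (rows I U) (coef I) w c \<longrightarrow>
         m * (\<Sum>r\<in>rows I U. \<bar>w r\<bar>) \<le> price (rows I U) (coef I) w c))" for N U m
  have "\<exists>m. gap N U m" if "N \<subseteq> all_columns I" "U \<subseteq> cut_universe I" for N U
    unfolding gap_def
    by (rule ray_price_gap[OF finite_subset[OF that(1) finite_all_columns] finite_rows[OF fU[OF that(2)]] finite_all_columns])
  then have ex: "\<forall>x\<in>?X. \<exists>m. gap (fst x) (snd x) m" by (simp add: mem_Times_iff)
  obtain f where f: "\<forall>x\<in>?X. gap (fst x) (snd x) (f x)"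
    using bchoice[OF ex] by blast
  have "finite ?X"
    using finite_all_columns finite_cut_universe[OF wf] by simp
  then have fin_img: "finite (f ` ?X)" by blast
  define m where "m = Min (f ` ?X)"
  have le: "m \<le> f x" if "x \<in> ?X" for x
    unfolding m_def by (rule Min_le[OF fin_img]) (use that in blast)
  have "m \<in> f ` ?X"
    unfolding m_def by (rule Min_in[OF fin_img]) blast
  then have "0 < m" using f unfolding gap_def by blast
  have bound: "m * (\<Sum>r\<in>rows I U. \<bar>w r\<bar>) \<le> price (rows I U) (coef I) w c"
    if "U \<subseteq> cut_universe I" "dual_extreme_ray I D U Q P w" "c \<in> all_columns I"
      "0 < price (rows I U) (coef I) w c" for U D Q P w c
  proof -
    have X: "(columns I D Q P, U) \<in> ?X" using that(1) columns_subset by blast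
    have "m * (\<Sum>r\<in>rows I U. \<bar>w r\<bar>) \<le> f (columns I D Q P, U) * (\<Sum>r\<in>rows I U. \<bar>w r\<bar>)"
      using le[OF X] by (intro mult_right_mono) (auto simp: sum_nonneg)
    also have "\<dots> \<le> price (rows I U) (coef I) w c"
      using f[rule_format, OF X] that(2-4) dual_extreme_ray_lp[OF fU[OF that(1)]]
      unfolding gap_def fst_conv snd_conv by blast
    finally show ?thesis .
  qed
  then have "price_gap m"
    using \<open>0 < m\<close> unfolding price_gap_def by blast
  then show ?thesis ..
qed

end

section \<open>Column generation and cuts\<close>

lemma priced_exists: "finite C \<Longrightarrow> \<exists>x. priced C f x"
proof (cases "C = {}")
  case True
  then have "priced C f None" by (simp add: priced_def)
  then show ?thesis ..
next
  case False
  assume "finite C"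
  then obtain c where "is_arg_min f (\<lambda>c. c \<in> C) c"
    using ex_is_arg_min_if_finite[OF _ False] by blast
  then have "priced C f (Some c)" by (simp add: priced_def)
  then show ?thesis ..
qed

lemma priced_member: "priced C f (Some c) \<Longrightarrow> c \<in> C"
  by (simp add: priced_def is_arg_min_def)

lemma priced_lower_bound:
  fixes f :: "'c \<Rightarrow> real"
  assumes "priced C f x" "c \<in> C" "\<And>c'. x = Some c' \<Longrightarrow> 0 \<le> f c'"
  shows "0 \<le> f c"
proof (cases x)
  case None
  then show ?thesis using assms by (simp add: priced_def)
next
  case (Some c')
  then show ?thesis
    using assms by (fastforce simp: priced_def is_arg_min_def not_less)
qed

lemma price_scale: "price R A (\<lambda>r. k * w r) c = k * price R A w c"
  by (simp add: dot_def sum_distrib_left mult.assoc)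

lemma scaled_ray_eq: "scaled_ray I U M' w = (\<lambda>r. M' / (\<Sum>r\<in>rows I U. \<bar>w r\<bar>) * w r)"
  by (simp add: scaled_ray_def)

abbreviation full_feasible :: "('j, 'l, 's::linorder) network \<Rightarrow> ('j, 'l) decision set \<Rightarrow> ('j, 'l) cut set \<Rightarrow>
    ('l, 's) yvars \<Rightarrow> ('j, 'l) zvars \<Rightarrow> bool" where
  "full_feasible I D U \<equiv> rmp_feasible I D U (\<lambda>_. UNIV) (\<lambda>_. UNIV)"

lemma rmp_feasible_mono:
  assumes "rmp_feasible I D U Q P y z" "\<And>g. Q g \<subseteq> Q' g" "\<And>j. P j \<subseteq> P' j"
  shows "rmp_feasible I D U Q' P' y z"
proof -
  have "q \<in> Q' g \<inter> A" if "q \<in> Q g \<inter> A" for q g A using that assms(2) by blast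
  moreover have "p \<in> P' j \<inter> A" if "p \<in> P j \<inter> A" for p j A using that assms(3) by blast
  ultimately show ?thesis
    using assms(1) unfolding rmp_feasible_def by meson
qed

text \<open>
  At the initial prices a route with an assignment earns at least \<open>M\<close> and a plan without demand \<open>M'\<close>; at a
  scaled ray a column of positive price earns at least \<open>M' * m\<close>. In each case the column is attractive.
\<close>

locale large_constants = suppression_instance I for I :: "('j, 'l, 's::linorder) network" +
  fixes M M' m :: real
  assumes gap: "price_gap m"
    and pos: "0 < M" "0 < M'"
    and large: "\<And>c. c \<in> all_columns I \<Longrightarrow> column_cost I c < M"
      "\<And>c. c \<in> all_columns I \<Longrightarrow> column_cost I c < M'"
      "\<And>c. c \<in> all_columns I \<Longrightarrow> column_cost I c < M' * m"
begin

lemma plan_column: "g \<in> fires I \<Longrightarrow> q \<in> allowed_plans I D g \<Longrightarrow> Inl (g, q) \<in> all_columns I"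
  using allowed_plans_subset by (auto simp: all_columns_def)

lemma route_column: "j \<in> crews I \<Longrightarrow> p \<in> allowed_routes I D j \<Longrightarrow> Inr (j, p) \<in> all_columns I"
  using allowed_routes_subset by (auto simp: all_columns_def)

lemma finite_cuts: "U \<subseteq> cut_universe I \<Longrightarrow> finite U"
  using finite_cut_universe[OF wf] finite_subset by blast

definition nonneg_priced :: "('j, 'l) decision set \<Rightarrow> ('j, 'l) cut set \<Rightarrow> ('j, 'l) dual \<Rightarrow>
    ('l, 's) plan_sets \<Rightarrow> ('j, 'l) route_sets \<Rightarrow> bool" where
  "nonneg_priced D U w Q P \<longleftrightarrow> (\<forall>c\<in>columns I D Q P. price (rows I U) (coef I) w c \<le> column_cost I c)"

lemma nonneg_priced_iff:
  assumes "finite U"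
  shows "nonneg_priced D U w Q P \<longleftrightarrow>
     (\<forall>g\<in>fires I. \<forall>q\<in>Q g \<inter> allowed_plans I D g. 0 \<le> plan_reduced_cost I U w g q) \<and>
     (\<forall>j\<in>crews I. \<forall>p\<in>P j \<inter> allowed_routes I D j. 0 \<le> route_reduced_cost I U w j p)"
  unfolding nonneg_priced_def ball_columns plan_reduced_cost_def route_reduced_cost_def
  using assms by (simp add: plan_price_dot route_price_dot)

lemma converged_priced:
  assumes "finite U" "pricing I D U w qs ps" "\<And>g. new_plans I U w qs g = {}" "\<And>j. new_routes I U w ps j = {}"
  shows "nonneg_priced D U w (\<lambda>_. UNIV) (\<lambda>_. UNIV)"
  unfolding nonneg_priced_iff[OF assms(1)]
proof (intro conjI ballI)
  fix g q assume g: "g \<in> fires I" and q: "q \<in> UNIV \<inter> allowed_plans I D g"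
  have "0 \<le> plan_reduced_cost I U w g q'" if "qs g = Some q'" for q'
    using assms(3)[of g] that g by (auto simp: new_plans_def not_less)
  then show "0 \<le> plan_reduced_cost I U w g q"
    using priced_lower_bound[of "allowed_plans I D g" _ "qs g" q] assms(2) g q by (simp add: pricing_def)
next
  fix j p assume j: "j \<in> crews I" and p: "p \<in> UNIV \<inter> allowed_routes I D j"
  have "0 \<le> route_reduced_cost I U w j p'" if "ps j = Some p'" for p'
    using assms(4)[of j] that j by (auto simp: new_routes_def not_less)
  then show "0 \<le> route_reduced_cost I U w j p"
    using priced_lower_bound[of "allowed_routes I D j" _ "ps j" p] assms(2) j p by (simp add: pricing_def)
qed

text \<open>
  Without attractive columns no allowed route is ever assigned to a fire, and every allowed plan
  demands a crew at some time. As there is at least one fire, its demand cannot be met.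
\<close>

lemma initial_dual_infeasible:
  assumes U: "finite U" and np: "nonneg_priced D U (initial_dual M M') (\<lambda>_. UNIV) (\<lambda>_. UNIV)"
  shows "\<not> full_feasible I D U y z"
proof
  assume f: "full_feasible I D U y z"
  obtain g where g: "g \<in> fires I" using fires_nonempty by blast
  have unassigned: "assigned I j p g t = 0"
    if j: "j \<in> crews I" and p: "p \<in> allowed_routes I D j" and t: "t \<in> periods I" for j p t
  proof (rule ccontr)
    assume "assigned I j p g t \<noteq> 0"
    then have a: "assigned I j p g t = 1" using assigned_bool[of I j p g t] by simp
    have "M \<le> (\<Sum>t\<in>periods I. assigned I j p g t * M)"
      using member_le_sum[of t "periods I" "\<lambda>t. assigned I j p g t * M"] t a pos
      by (simp add: assigned_nonneg)
    also have "\<dots> \<le> (\<Sum>g\<in>fires I. \<Sum>t\<in>periods I. assigned I j p g t * M)"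
      using member_le_sum[of g "fires I" "\<lambda>g. \<Sum>t\<in>periods I. assigned I j p g t * M"] g fin pos
      by (simp add: assigned_nonneg sum_nonneg)
    also have "\<dots> \<le> route_cost I j p"
      using np j p by (auto simp: nonneg_priced_iff[OF U] route_reduced_cost_def route_price_def)
    finally show False
      using large(1)[OF route_column[OF j p]] by simp
  qed
  have y: "\<And>q. q \<in> plans I g \<Longrightarrow> 0 \<le> y g q \<and> (y g q \<noteq> 0 \<longrightarrow> q \<in> allowed_plans I D g)"
    and sum: "(\<Sum>q\<in>plans I g. y g q) = 1"
    using f g by (auto simp: rmp_feasible_def sp_constraints_def)
  obtain q where q: "q \<in> plans I g" "y g q \<noteq> 0"
    using sum by (metis sum.neutral zero_neq_one)
  have "\<exists>t\<in>periods I. demand I g q t \<noteq> 0"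
  proof (rule ccontr)
    assume "\<not> ?thesis"
    then have "plan_price I U (initial_dual M M') g q = M'" by (simp add: plan_price_def)
    moreover have qa: "q \<in> allowed_plans I D g" using y[OF q(1)] q(2) by blast
    ultimately have "M' \<le> plan_cost I g q"
      using np g unfolding nonneg_priced_iff[OF U] plan_reduced_cost_def by fastforce
    then show False using large(2)[OF plan_column[OF g qa]] by simp
  qed
  then obtain t where t: "t \<in> periods I" "demand I g q t \<noteq> 0" by blast
  have "0 < real (demand I g q t) * y g q"
  proof (rule mult_pos_pos)
    show "0 < y g q" using y[OF q(1)] q(2) by linarith
    show "0 < real (demand I g q t)" using t(2) by simp
  qed
  also have "\<dots> \<le> (\<Sum>q\<in>plans I g. real (demand I g q t) * y g q)"
    by (rule member_le_sum[OF q(1)]) (use y fin_plans[OF g] in auto)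
  also have "\<dots> \<le> (\<Sum>j\<in>crews I. \<Sum>p\<in>routes I j. assigned I j p g t * z j p)"
    using f g t by (auto simp: rmp_feasible_def sp_constraints_def)
  also have "\<dots> = 0"
  proof (intro sum.neutral ballI)
    fix j p assume "j \<in> crews I" "p \<in> routes I j"
    then show "assigned I j p g t * z j p = 0"
      using unassigned[of j p t] t f by (cases "p \<in> allowed_routes I D j") (auto simp: rmp_feasible_def)
  qed
  finally show False by simp
qed

lemma ray_norm_pos:
  assumes U: "U \<subseteq> cut_universe I" and ray: "dual_extreme_ray I D U Q P w"
  shows "0 < (\<Sum>r\<in>rows I U. \<bar>w r\<bar>)"
proof (rule ccontr)
  assume "\<not> ?thesis"
  then have "(\<Sum>r\<in>rows I U. \<bar>w r\<bar>) = 0"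
    by (simp add: order_antisym sum_nonneg)
  then have "\<forall>r\<in>rows I U. w r = 0"
    using finite_rows[OF finite_cuts[OF U]] by (simp add: sum_nonneg_eq_0_iff)
  then have "dot (rows I U) w rhs = 0" by (simp add: dot_def)
  then show False
    using ray dual_objective_dot[OF finite_cuts[OF U]] by (simp add: dual_extreme_ray_def)
qed

text \<open>
  A column with positive price along the ray would have negative reduced cost. So the ray stays in the
  recession cone when all allowed columns are added, and certifies infeasibility for them.
\<close>

lemma ray_infeasible:
  assumes U: "U \<subseteq> cut_universe I" and ray: "dual_extreme_ray I D U Q P w"
    and np: "nonneg_priced D U (scaled_ray I U M' w) (\<lambda>_. UNIV) (\<lambda>_. UNIV)"
  shows "\<not> full_feasible I D U y z"
proof
  assume f: "full_feasible I D U y z"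
  define n where "n = (\<Sum>r\<in>rows I U. \<bar>w r\<bar>)"
  have n: "0 < n" unfolding n_def by (rule ray_norm_pos[OF U ray])
  have "price (rows I U) (coef I) w c \<le> 0" if c: "c \<in> columns I D (\<lambda>_. UNIV) (\<lambda>_. UNIV)" for c
  proof (rule ccontr)
    assume "\<not> ?thesis"
    moreover have ac: "c \<in> all_columns I" using c columns_subset by blast
    ultimately have "m * n \<le> price (rows I U) (coef I) w c"
      using gap U ray unfolding price_gap_def n_def by (metis not_le)
    then have "M' / n * (m * n) \<le> M' / n * price (rows I U) (coef I) w c"
      using pos n by (intro mult_left_mono) auto
    also have "\<dots> \<le> column_cost I c"
      using np c unfolding nonneg_priced_def scaled_ray_eq price_scale n_def by blast
    finally show False using large(3)[OF ac] n by simp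
  qed
  then have "dual_constraints I D U (\<lambda>_. UNIV) (\<lambda>_. UNIV) 0 w"
    using ray unfolding dual_extreme_ray_def dual_constraints_lp[OF finite_cuts[OF U]] lp_dual_def by simp
  from rmp_weak_duality[OF finite_cuts[OF U] f this] show False
    using ray by (simp add: dual_extreme_ray_def)
qed

lemma optimal_full:
  assumes U: "U \<subseteq> cut_universe I" and opt: "rmp_optimal I D U Q P y z" "dual_optimal I D U Q P w"
    and np: "nonneg_priced D U w (\<lambda>_. UNIV) (\<lambda>_. UNIV)" and f: "full_feasible I D U y' z'"
  shows "cost I y z \<le> cost I y' z'"
proof -
  have "dual_constraints I D U (\<lambda>_. UNIV) (\<lambda>_. UNIV) 1 w"
    using opt(2) np unfolding dual_optimal_def dual_constraints_lp[OF finite_cuts[OF U]] lp_dual_def nonneg_priced_def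
    by simp
  from rmp_weak_duality[OF finite_cuts[OF U] f this] show ?thesis
    using dual_optimal_objective[OF finite_cuts[OF U] opt] by simp
qed

definition generating :: "('j, 'l) decision set \<Rightarrow> ('j, 'l, 's) relaxation \<Rightarrow> bool" where
  "generating D r \<longleftrightarrow>
     (obj r = \<infinity> \<and> dual r = initial_dual M M') \<or>
     (obj r = \<infinity> \<and> (\<exists>w. dual_extreme_ray I D (cuts r) (cols_q r) (cols_p r) w \<and>
        dual r = scaled_ray I (cuts r) M' w)) \<or>
     (obj r = ereal (cost I (yval r) (zval r)) \<and>
        rmp_optimal I D (cuts r) (cols_q r) (cols_p r) (yval r) (zval r) \<and>
        dual_optimal I D (cuts r) (cols_q r) (cols_p r) (dual r))"

text \<open>
  What is known once column generation has converged. The sign of \<open>\<rho>\<close> is recorded because dual-aware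
  branching uses \<open>\<rho>\<close> in its weights.
\<close>

definition generated :: "('j, 'l) decision set \<Rightarrow> ('j, 'l, 's) relaxation \<Rightarrow> bool" where
  "generated D r \<longleftrightarrow>
     (obj r = \<infinity> \<and> (\<nexists>y z. full_feasible I D (cuts r) y z)) \<or>
     (obj r = ereal (cost I (yval r) (zval r)) \<and>
        rmp_feasible I D (cuts r) (cols_q r) (cols_p r) (yval r) (zval r) \<and>
        (\<forall>y z. full_feasible I D (cuts r) y z \<longrightarrow> cost I (yval r) (zval r) \<le> cost I y z) \<and>
        (\<forall>g\<in>fires I. \<forall>t\<in>periods I. 0 \<le> dual r (Rho_row g t)))"

definition relax_inv :: "('j, 'l) decision set \<Rightarrow> ('j, 'l, 's) relaxation \<Rightarrow> bool" where
  "relax_inv D r \<longleftrightarrow> cuts r \<subseteq> cut_universe I \<and>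
     (if stage r = Generate then generating D r else generated D r)"

lemma relax_inv_start: "U \<subseteq> cut_universe I \<Longrightarrow> relax_inv D (start_relaxation M M' Q P U)"
  by (simp add: relax_inv_def generating_def start_relaxation_def)

lemma generating_converged:
  assumes "cuts r \<subseteq> cut_universe I" "generating D r"
    and np: "nonneg_priced D (cuts r) (dual r) (\<lambda>_. UNIV) (\<lambda>_. UNIV)"
  shows "generated D r"
  using assms(2) unfolding generating_def
proof (elim disjE conjE exE)
  assume "obj r = \<infinity>" "dual r = initial_dual M M'"
  then show ?thesis
    using initial_dual_infeasible[OF finite_cuts[OF assms(1)]] np unfolding generated_def by auto
next
  fix w assume "obj r = \<infinity>" "dual_extreme_ray I D (cuts r) (cols_q r) (cols_p r) w"
    "dual r = scaled_ray I (cuts r) M' w"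
  then show ?thesis
    using ray_infeasible[OF assms(1)] np unfolding generated_def by auto
next
  assume opt: "obj r = ereal (cost I (yval r) (zval r))"
    "rmp_optimal I D (cuts r) (cols_q r) (cols_p r) (yval r) (zval r)"
    "dual_optimal I D (cuts r) (cols_q r) (cols_p r) (dual r)"
  have "\<forall>y z. full_feasible I D (cuts r) y z \<longrightarrow> cost I (yval r) (zval r) \<le> cost I y z"
    using optimal_full[OF assms(1) opt(2,3) np] by blast
  moreover have "\<forall>g\<in>fires I. \<forall>t\<in>periods I. 0 \<le> dual r (Rho_row g t)"
    using opt(3) unfolding dual_optimal_def dual_constraints_def by blast
  ultimately show ?thesis
    using opt unfolding generated_def rmp_optimal_def by blast
qed

lemma relax_inv_step:
  assumes step: "relax_step I M M' D r r'" and inv: "relax_inv D r"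
  shows "relax_inv D r'"
  using step
proof cases
  case (feasible qs ps Q P y z w)
  then show ?thesis
    using inv by (simp add: relax_inv_def generating_def)
next
  case (infeasible qs ps Q P w)
  have gen: "generating D r" and U: "cuts r \<subseteq> cut_universe I"
    using inv infeasible(2) by (auto simp: relax_inv_def)
  have "\<not> rmp_optimal I D (cuts r) (cols_q r) (cols_p r) (yval r) (zval r)"
  proof
    assume "rmp_optimal I D (cuts r) (cols_q r) (cols_p r) (yval r) (zval r)"
    then have "rmp_feasible I D (cuts r) (cols_q r) (cols_p r) (yval r) (zval r)"
      by (simp add: rmp_optimal_def)
    then have "rmp_feasible I D (cuts r) Q P (yval r) (zval r)"
      by (rule rmp_feasible_mono) (use infeasible in auto)
    then show False using infeasible by blast
  qed
  then have "obj r = \<infinity>" using gen by (auto simp: generating_def)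
  then have "generating D r'"
    using infeasible unfolding generating_def by auto
  then show ?thesis
    using infeasible U by (simp add: relax_inv_def)
next
  case (converged qs ps)
  then have "generated D r"
    using generating_converged converged_priced[OF finite_cuts converged(3-5)] inv by (simp add: relax_inv_def)
  then show ?thesis
    using converged inv by (simp add: relax_inv_def generated_def)
next
  case (add_cuts \<delta> K C)
  have "C \<subseteq> cut_universe I"
    using add_cuts(4,5) cglp_solution_cut by blast
  then have "cuts r \<union> C \<subseteq> cut_universe I"
    using inv by (simp add: relax_inv_def)
  then show ?thesis
    unfolding add_cuts(1) by (rule relax_inv_start)
next
  case no_cuts
  then show ?thesis
    using inv by (simp add: relax_inv_def generated_def)
qed

lemma pricing_exists: "\<exists>qs ps. pricing I D U w qs ps"
proof -
  have "\<forall>g\<in>fires I. \<exists>x. priced (allowed_plans I D g) (plan_reduced_cost I U w g) x"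
    using priced_exists fin_plans allowed_plans_subset finite_subset by metis
  moreover have "\<forall>j\<in>crews I. \<exists>x. priced (allowed_routes I D j) (route_reduced_cost I U w j) x"
    using priced_exists fin_routes allowed_routes_subset finite_subset by metis
  ultimately show ?thesis
    unfolding pricing_def by (metis bchoice)
qed

lemma relax_progress:
  assumes inv: "relax_inv D r" and "stage r \<noteq> Solved"
  shows "\<exists>r'. relax_step I M M' D r r'"
proof (cases "stage r = Generate")
  case True
  have U: "finite (cuts r)" using inv finite_cuts by (simp add: relax_inv_def)
  obtain qs ps where pr: "pricing I D (cuts r) (dual r) qs ps"
    using pricing_exists by blast
  show ?thesis
  proof (cases "(\<exists>g. new_plans I (cuts r) (dual r) qs g \<noteq> {}) \<or> (\<exists>j. new_routes I (cuts r) (dual r) ps j \<noteq> {})")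
    case new: True
    define Q where "Q = (\<lambda>g. cols_q r g \<union> new_plans I (cuts r) (dual r) qs g)"
    define P where "P = (\<lambda>j. cols_p r j \<union> new_routes I (cuts r) (dual r) ps j)"
    show ?thesis
    proof (cases "\<exists>y z. rmp_feasible I D (cuts r) Q P y z")
      case True
      then obtain y z where "rmp_optimal I D (cuts r) Q P y z"
        using rmp_optimal_exists[OF U] by blast
      moreover from this obtain w where "dual_optimal I D (cuts r) Q P w"
        using dual_optimal_exists[OF U] by blast
      ultimately show ?thesis
        using relax_step.feasible[OF \<open>stage r = Generate\<close> pr new Q_def P_def] by blast
    next
      case False
      then obtain w where "dual_extreme_ray I D (cuts r) Q P w"
        using dual_extreme_ray_exists[OF U] by blast
      then show ?thesis
        using relax_step.infeasible[OF \<open>stage r = Generate\<close> pr new Q_def P_def False] by blast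
    qed
  next
    case False
    then show ?thesis
      using relax_step.converged[OF True pr] by blast
  qed
next
  case False
  then have sep: "stage r = Separate" using assms(2) by (cases "stage r") auto
  show ?thesis
  proof (cases "obj r < \<infinity> \<longrightarrow> (\<forall>t\<in>periods I. \<forall>\<delta> K. agub I (fires I) (idle_crews I t (zval r)) \<delta> K \<longrightarrow>
          cglp_value I t (yval r) \<delta> K \<le> 0)")
    case True
    then show ?thesis using relax_step.no_cuts[OF sep] by blast
  next
    case False
    then obtain t \<delta>' K' where viol: "t \<in> periods I" "agub I (fires I) (idle_crews I t (zval r)) \<delta>' K'"
      "0 < cglp_value I t (yval r) \<delta>' K'" and obj: "obj r < \<infinity>"
      by (auto simp: not_le)
    have "\<forall>t. \<exists>v. cglp_solution I t (yval r) (zval r) (fst v) (snd v)"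
      using cglp_solution_exists[OF wf, of _ "yval r" "zval r"] by simp
    from choice[OF this] obtain v where "\<forall>t. cglp_solution I t (yval r) (zval r) (fst (v t)) (snd (v t))"
      by blast
    moreover define \<delta> where "\<delta> = (\<lambda>t. fst (v t))"
    moreover define K where "K = (\<lambda>t. snd (v t))"
    ultimately have sol: "\<And>t. cglp_solution I t (yval r) (zval r) (\<delta> t) (K t)" by simp
    have "cglp_value I t (yval r) \<delta>' K' \<le> cglp_value I t (yval r) (\<delta> t) (K t)"
      using sol[of t] viol(2) unfolding cglp_solution_def Let_def by blast
    then have "0 < cglp_value I t (yval r) (\<delta> t) (K t)" using viol(3) by simp
    then have "{cglp_cut I t (zval r) (\<delta> t) (K t) | t.
        t \<in> periods I \<and> cglp_value I t (yval r) (\<delta> t) (K t) > 0} \<noteq> {}"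
      using viol(1) by blast
    then show ?thesis
      using relax_step.add_cuts[OF sep obj sol refl] by blast
  qed
qed

definition missing :: "('j, 'l, 's) relaxation \<Rightarrow> ('j, 'l, 's) column set" where
  "missing r = all_columns I - ((SIGMA g : fires I. cols_q r g) <+> (SIGMA j : crews I. cols_p r j))"

definition stage_rank :: "relax_stage \<Rightarrow> nat" where
  "stage_rank st = (case st of Generate \<Rightarrow> 2 | Separate \<Rightarrow> 1 | Solved \<Rightarrow> 0)"

text \<open>
  Rounds of cuts enlarge the cut set, and column generation reduces the missing columns. The third
  component handles the first iteration after a start: its prices ignore the columns at hand, one of which may
  be priced again; afterwards these have nonnegative reduced cost.
\<close>

definition relax_measure :: "('j, 'l) decision set \<Rightarrow> ('j, 'l, 's) relaxation \<Rightarrow> nat \<times> nat \<times> nat \<times> nat" where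
  "relax_measure D r = (card (cut_universe I - cuts r), stage_rank (stage r),
     of_bool (\<not> nonneg_priced D (cuts r) (dual r) (cols_q r) (cols_p r)), card (missing r))"

lemma new_columns_decrease:
  assumes fU: "finite (cuts r)" and pr: "pricing I D (cuts r) (dual r) qs ps"
    and new: "(\<exists>g. new_plans I (cuts r) (dual r) qs g \<noteq> {}) \<or> (\<exists>j. new_routes I (cuts r) (dual r) ps j \<noteq> {})"
    and Q: "Q = (\<lambda>g. cols_q r g \<union> new_plans I (cuts r) (dual r) qs g)"
    and P: "P = (\<lambda>j. cols_p r j \<union> new_routes I (cuts r) (dual r) ps j)"
    and r': "cuts r' = cuts r" "stage r' = stage r" "cols_q r' = Q" "cols_p r' = P"
    and np: "nonneg_priced D (cuts r') (dual r') Q P"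
  shows "(relax_measure D r', relax_measure D r) \<in> less_than <*lex*> less_than <*lex*> less_than <*lex*> less_than"
proof (cases "nonneg_priced D (cuts r) (dual r) (cols_q r) (cols_p r)")
  case False
  then show ?thesis using np r' by (simp add: relax_measure_def)
next
  case True
  have "missing r' \<subseteq> missing r"
    using r' Q P by (auto simp: missing_def)
  moreover have "\<exists>c. c \<in> missing r - missing r'"
    using new
  proof (elim disjE exE)
    fix g assume "new_plans I (cuts r) (dual r) qs g \<noteq> {}"
    then obtain q where q: "g \<in> fires I" "qs g = Some q" "plan_reduced_cost I (cuts r) (dual r) g q < 0"
      by (auto simp: new_plans_def)
    then have "q \<in> allowed_plans I D g"
      using pr priced_member by (metis pricing_def)
    moreover from this have "q \<notin> cols_q r g"
      using True q unfolding nonneg_priced_iff[OF fU] by (metis IntI not_le)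
    ultimately show ?thesis
      using q r' Q plan_column by (intro exI[of _ "Inl (g, q)"]) (auto simp: missing_def new_plans_def)
  next
    fix j assume "new_routes I (cuts r) (dual r) ps j \<noteq> {}"
    then obtain p where p: "j \<in> crews I" "ps j = Some p" "route_reduced_cost I (cuts r) (dual r) j p < 0"
      by (auto simp: new_routes_def)
    then have "p \<in> allowed_routes I D j"
      using pr priced_member by (metis pricing_def)
    moreover from this have "p \<notin> cols_p r j"
      using True p unfolding nonneg_priced_iff[OF fU] by (metis IntI not_le)
    ultimately show ?thesis
      using p r' P route_column by (intro exI[of _ "Inr (j, p)"]) (auto simp: missing_def new_routes_def)
  qed
  ultimately have "missing r' \<subset> missing r" by blast
  then have "card (missing r') < card (missing r)"
    using finite_all_columns by (intro psubset_card_mono) (auto simp: missing_def)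
  then show ?thesis
    using True np r' by (simp add: relax_measure_def)
qed

text \<open>
  After a feasible step the columns at hand are priced by a dual feasible solution. After an infeasible one
  their prices are nonpositive while their costs are nonnegative. Added cuts are violated by a solution that
  satisfies the old ones.
\<close>

lemma relax_decreases:
  assumes step: "relax_step I M M' D r r'" and inv: "relax_inv D r"
  shows "(relax_measure D r', relax_measure D r) \<in> less_than <*lex*> less_than <*lex*> less_than <*lex*> less_than"
proof -
  have fU: "finite (cuts r)" using inv finite_cuts by (simp add: relax_inv_def)
  show ?thesis
    using step
  proof cases
    case (feasible qs ps Q P y z w)
    have "nonneg_priced D (cuts r) w Q P"
      using feasible(8) unfolding dual_optimal_def dual_constraints_lp[OF fU] lp_dual_def nonneg_priced_def by simp
    then show ?thesis
      by (intro new_columns_decrease[OF fU feasible(3-6)]) (auto simp: feasible(1))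
  next
    case (infeasible qs ps Q P w)
    have "M' / (\<Sum>r\<in>rows I (cuts r). \<bar>w r\<bar>) * price (rows I (cuts r)) (coef I) w c \<le> column_cost I c"
      if c: "c \<in> columns I D Q P" for c
    proof -
      have "price (rows I (cuts r)) (coef I) w c \<le> 0"
        using infeasible(8) c unfolding dual_extreme_ray_def dual_constraints_lp[OF fU] lp_dual_def by simp
      moreover have "0 \<le> M' / (\<Sum>r\<in>rows I (cuts r). \<bar>w r\<bar>)"
        using pos by (simp add: sum_nonneg)
      ultimately show ?thesis
        using column_cost_nonneg columns_subset c by (meson mult_nonneg_nonpos order_trans subsetD)
    qed
    then have "nonneg_priced D (cuts r) (scaled_ray I (cuts r) M' w) Q P"
      unfolding nonneg_priced_def scaled_ray_eq price_scale by blast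
    then show ?thesis
      by (intro new_columns_decrease[OF fU infeasible(3-6)]) (auto simp: infeasible(1))
  next
    case (converged qs ps)
    then show ?thesis by (simp add: relax_measure_def stage_rank_def)
  next
    case (add_cuts \<delta> K C)
    obtain t where t: "t \<in> periods I" "cglp_value I t (yval r) (\<delta> t) (K t) > 0"
      using add_cuts(5,6) by blast
    let ?u = "cglp_cut I t (zval r) (\<delta> t) (K t)"
    have "?u \<in> C" using t add_cuts(5) by blast
    have f: "rmp_feasible I D (cuts r) (cols_q r) (cols_p r) (yval r) (zval r)"
      using inv add_cuts(2,3) by (auto simp: relax_inv_def generated_def)
    have "?u \<notin> cuts r"
    proof
      assume "?u \<in> cuts r"
      then have "satisfies_cut I (yval r) (zval r) ?u"
        using f by (simp add: rmp_feasible_def)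
      then have "cglp_value I t (yval r) (\<delta> t) (K t) \<le> 0"
        using f by (intro satisfied_cut_value[OF wf]) (auto simp: rmp_feasible_def sp_constraints_def)
      then show False using t(2) by simp
    qed
    moreover have "?u \<in> cut_universe I"
      using cglp_solution_cut[OF t(1)] add_cuts(4)[OF t(1)] by blast
    ultimately have "cut_universe I - (cuts r \<union> C) \<subset> cut_universe I - cuts r"
      using \<open>?u \<in> C\<close> by blast
    then have "card (cut_universe I - (cuts r \<union> C)) < card (cut_universe I - cuts r)"
      using finite_cut_universe[OF wf] by (intro psubset_card_mono) auto
    then show ?thesis
      using add_cuts(1) by (simp add: relax_measure_def start_relaxation_def)
  next
    case no_cuts
    then show ?thesis by (simp add: relax_measure_def stage_rank_def)
  qed
qed

end

section \<open>Convex combinations\<close>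

lemma variance_eq:
  fixes f y :: "'x \<Rightarrow> real"
  assumes "(\<Sum>x\<in>S. y x) = 1"
  shows "(\<Sum>x\<in>S. (f x)\<^sup>2 * y x) - (\<Sum>x\<in>S. f x * y x)\<^sup>2 = (\<Sum>x\<in>S. y x * (f x - (\<Sum>x\<in>S. f x * y x))\<^sup>2)"
proof -
  define m where "m = (\<Sum>x\<in>S. f x * y x)"
  have "(\<Sum>x\<in>S. y x * (f x - m)\<^sup>2) = (\<Sum>x\<in>S. (f x)\<^sup>2 * y x) - 2 * m * (\<Sum>x\<in>S. f x * y x) + m\<^sup>2 * (\<Sum>x\<in>S. y x)"
    by (simp add: power2_diff algebra_simps sum.distrib sum_subtractf sum_distrib_left sum_distrib_right)
  then show ?thesis
    unfolding m_def[symmetric] using assms by (simp add: power2_eq_square)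
qed

lemma variance_nonneg:
  fixes f y :: "'x \<Rightarrow> real"
  assumes "\<And>x. x \<in> S \<Longrightarrow> 0 \<le> y x" "(\<Sum>x\<in>S. y x) = 1"
  shows "0 \<le> (\<Sum>x\<in>S. (f x)\<^sup>2 * y x) - (\<Sum>x\<in>S. f x * y x)\<^sup>2"
  unfolding variance_eq[OF assms(2)] using assms(1) by (intro sum_nonneg) auto

lemma variance_zero:
  fixes f y :: "'x \<Rightarrow> real"
  assumes "finite S" "\<And>x. x \<in> S \<Longrightarrow> 0 \<le> y x" "(\<Sum>x\<in>S. y x) = 1"
    and "(\<Sum>x\<in>S. (f x)\<^sup>2 * y x) - (\<Sum>x\<in>S. f x * y x)\<^sup>2 = 0" "x \<in> S" "y x \<noteq> 0"
  shows "f x = (\<Sum>x\<in>S. f x * y x)"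
proof -
  have "y x * (f x - (\<Sum>x\<in>S. f x * y x))\<^sup>2 = 0"
    using assms(4,5) unfolding variance_eq[OF assms(3)]
    by (subst (asm) sum_nonneg_eq_0_iff) (use assms(1,2) in auto)
  then show ?thesis using assms(6) by simp
qed

text \<open>
  The weight \<open>k\<close> scales the variance by its square, so the unweighted values are not constant on the support and
  lie on both sides of their mean.
\<close>

lemma variance_split:
  fixes f y :: "'x \<Rightarrow> real"
  assumes fin: "finite S" and y: "\<And>x. x \<in> S \<Longrightarrow> 0 \<le> y x" "(\<Sum>x\<in>S. y x) = 1"
    and var: "(\<Sum>x\<in>S. (f x * k)\<^sup>2 * y x) - (\<Sum>x\<in>S. f x * k * y x)\<^sup>2 \<noteq> 0"
  shows "\<exists>x\<in>S. y x \<noteq> 0 \<and> (\<Sum>x\<in>S. f x * y x) < f x"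
    and "\<exists>x\<in>S. y x \<noteq> 0 \<and> f x < (\<Sum>x\<in>S. f x * y x)"
proof -
  define m where "m = (\<Sum>x\<in>S. f x * y x)"
  have mean: "(\<Sum>x\<in>S. y x * (f x - m)) = 0"
    using y(2) by (simp add: right_diff_distrib sum_subtractf m_def mult.commute flip: sum_distrib_right sum_distrib_left)
  have nonconst: "\<exists>x\<in>S. y x * (f x - m) \<noteq> 0"
  proof (rule ccontr)
    assume "\<not> ?thesis"
    then have c: "y x = 0 \<or> f x = m" if "x \<in> S" for x using that by auto
    have "(\<Sum>x\<in>S. f x * k * y x) = k * m"
      by (simp add: m_def sum_distrib_left mult_ac)
    moreover have "(\<Sum>x\<in>S. y x * (f x * k - k * m)\<^sup>2) = 0"
      using c by (intro sum.neutral) auto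
    ultimately show False
      using var unfolding variance_eq[OF y(2)] by simp
  qed
  show "\<exists>x\<in>S. y x \<noteq> 0 \<and> (\<Sum>x\<in>S. f x * y x) < f x"
  proof (rule ccontr)
    assume "\<not> ?thesis"
    then have "y x * (f x - m) \<le> 0" if "x \<in> S" for x
      using that y(1)[OF that] by (cases "y x = 0") (auto simp: m_def not_less mult_le_0_iff)
    then have "\<forall>x\<in>S. - (y x * (f x - m)) = 0"
      using mean fin by (subst sum_nonneg_eq_0_iff[symmetric]) (auto simp: sum_negf)
    then show False using nonconst by auto
  qed
  show "\<exists>x\<in>S. y x \<noteq> 0 \<and> f x < (\<Sum>x\<in>S. f x * y x)"
  proof (rule ccontr)
    assume "\<not> ?thesis"
    then have "0 \<le> y x * (f x - m)" if "x \<in> S" for x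
      using that y(1)[OF that] by (cases "y x = 0") (auto simp: m_def not_less)
    then have "\<forall>x\<in>S. y x * (f x - m) = 0"
      using mean fin by (subst sum_nonneg_eq_0_iff[symmetric]) auto
    then show False using nonconst by blast
  qed
qed

text \<open>
  The average exceeds the minimum by a weighted sum of nonnegative terms, which is zero only if every
  term of positive weight is.
\<close>

lemma cheapest_in_support:
  fixes f y :: "'x \<Rightarrow> real"
  assumes fin: "finite S" and y: "\<And>x. x \<in> S \<Longrightarrow> 0 \<le> y x" "(\<Sum>x\<in>S. y x) = 1"
  shows "\<exists>q\<in>S. 0 < y q \<and> f q \<le> (\<Sum>x\<in>S. f x * y x) \<and>
    (f q = (\<Sum>x\<in>S. f x * y x) \<longrightarrow> (\<forall>x\<in>S. 0 < y x \<longrightarrow> f x = (\<Sum>x\<in>S. f x * y x)))"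
proof -
  let ?T = "{x \<in> S. 0 < y x}"
  have "?T \<noteq> {}"
  proof
    assume "?T = {}"
    then have "\<forall>x\<in>S. y x = 0" using y(1) by force
    then show False using y(2) by simp
  qed
  then obtain q where "is_arg_min f (\<lambda>x. x \<in> ?T) q"
    using ex_is_arg_min_if_finite[of ?T f] fin by auto
  then have q: "q \<in> S" "0 < y q" and min: "\<And>x. x \<in> S \<Longrightarrow> 0 < y x \<Longrightarrow> f q \<le> f x"
    by (auto simp: is_arg_min_def not_less)
  have nn: "0 \<le> (f x - f q) * y x" if "x \<in> S" for x
    using min[OF that] y(1)[OF that] by (cases "y x = 0") auto
  have eq: "(\<Sum>x\<in>S. (f x - f q) * y x) = (\<Sum>x\<in>S. f x * y x) - f q"
    using y(2) by (simp add: left_diff_distrib sum_subtractf flip: sum_distrib_left)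
  have "f q \<le> (\<Sum>x\<in>S. f x * y x)"
    using sum_nonneg[of S "\<lambda>x. (f x - f q) * y x"] nn eq by simp
  moreover have "f x = f q" if "f q = (\<Sum>x\<in>S. f x * y x)" "x \<in> S" "0 < y x" for x
  proof -
    have "\<forall>x\<in>S. (f x - f q) * y x = 0"
      using eq that(1) fin nn by (subst sum_nonneg_eq_0_iff[symmetric]) auto
    then show ?thesis using that by fastforce
  qed
  ultimately show ?thesis using q by metis
qed

lemma cheapest_selection:
  fixes f y :: "'i \<Rightarrow> 'x \<Rightarrow> real"
  assumes "\<And>i. i \<in> G \<Longrightarrow> finite (S i)" "\<And>i x. i \<in> G \<Longrightarrow> x \<in> S i \<Longrightarrow> 0 \<le> y i x"
    and "\<And>i. i \<in> G \<Longrightarrow> (\<Sum>x\<in>S i. y i x) = 1"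
  obtains s where "\<forall>i\<in>G. s i \<in> S i \<and> 0 < y i (s i)" "\<forall>i\<in>G. f i (s i) \<le> (\<Sum>x\<in>S i. f i x * y i x)"
    "\<forall>i\<in>G. f i (s i) = (\<Sum>x\<in>S i. f i x * y i x) \<longrightarrow>
       (\<forall>x\<in>S i. 0 < y i x \<longrightarrow> f i x = (\<Sum>x\<in>S i. f i x * y i x))"
proof -
  have "\<forall>i\<in>G. \<exists>q. q \<in> S i \<and> 0 < y i q \<and> f i q \<le> (\<Sum>x\<in>S i. f i x * y i x) \<and>
      (f i q = (\<Sum>x\<in>S i. f i x * y i x) \<longrightarrow> (\<forall>x\<in>S i. 0 < y i x \<longrightarrow> f i x = (\<Sum>x\<in>S i. f i x * y i x)))"
    using cheapest_in_support[OF assms] unfolding Bex_def by blast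
  from bchoice[OF this] that show ?thesis by blast
qed

section \<open>Branching\<close>

abbreviation obeys :: "('j, 'l, 's::linorder) network \<Rightarrow> ('j, 'l) decision set \<Rightarrow> ('l, 's) yvars \<Rightarrow> ('j, 'l) zvars \<Rightarrow> bool" where
  "obeys I D \<equiv> supported I D (\<lambda>_. UNIV) (\<lambda>_. UNIV)"

context large_constants
begin

lemma rmp_weights:
  assumes "rmp_feasible I D U Q P y z"
  shows "\<And>g q. g \<in> fires I \<Longrightarrow> q \<in> plans I g \<Longrightarrow> 0 \<le> y g q" "\<And>g. g \<in> fires I \<Longrightarrow> (\<Sum>q\<in>plans I g. y g q) = 1"
    "\<And>j p. j \<in> crews I \<Longrightarrow> p \<in> routes I j \<Longrightarrow> 0 \<le> z j p" "\<And>j. j \<in> crews I \<Longrightarrow> (\<Sum>p\<in>routes I j. z j p) = 1"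
  using assms by (simp_all add: rmp_feasible_def sp_constraints_def)

lemma obeys_selects:
  assumes "selects I y z qs ps"
  shows "obeys I D y z \<longleftrightarrow> (\<forall>g\<in>fires I. qs g \<in> allowed_plans I D g) \<and> (\<forall>j\<in>crews I. ps j \<in> allowed_routes I D j)"
proof -
  have "(\<forall>q\<in>plans I g. q \<notin> UNIV \<inter> allowed_plans I D g \<longrightarrow> y g q = 0) \<longleftrightarrow> qs g \<in> allowed_plans I D g"
    if "g \<in> fires I" for g
  proof -
    have "qs g \<in> plans I g" "\<And>q. q \<in> plans I g \<Longrightarrow> y g q = 0 \<longleftrightarrow> q \<noteq> qs g"
      using assms that by (simp_all add: selects_def)
    then show ?thesis by blast
  qed
  moreover have "(\<forall>p\<in>routes I j. p \<notin> UNIV \<inter> allowed_routes I D j \<longrightarrow> z j p = 0) \<longleftrightarrow> ps j \<in> allowed_routes I D j"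
    if "j \<in> crews I" for j
  proof -
    have "ps j \<in> routes I j" "\<And>p. p \<in> routes I j \<Longrightarrow> z j p = 0 \<longleftrightarrow> p \<noteq> ps j"
      using assms that by (simp_all add: selects_def)
    then show ?thesis by blast
  qed
  ultimately show ?thesis
    unfolding supported_def by (simp cong: ball_cong)
qed

lemma obeys_empty: "obeys I {} y z"
  by (auto simp: supported_def allowed_plans_def allowed_routes_def)

lemma sp_full_feasible:
  assumes "sp_feasible I y z" "obeys I D y z" "U \<subseteq> cut_universe I"
  shows "full_feasible I D U y z"
proof -
  have "0 \<le> y g q" if "g \<in> fires I" "q \<in> plans I g" for g q
    using assms(1) that by (force simp: sp_feasible_def binary_def)
  moreover have "0 \<le> z j p" if "j \<in> crews I" "p \<in> routes I j" for j p
    using assms(1) that by (force simp: sp_feasible_def binary_def)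
  moreover have "\<forall>u\<in>U. satisfies_cut I y z u"
    using assms(1,3) cut_universe_valid[OF wf] by blast
  ultimately show ?thesis
    using assms(1,2) unfolding rmp_feasible_def supported_def sp_feasible_def by blast
qed

lemma generated_bound:
  assumes "generated D r" "cuts r \<subseteq> cut_universe I" "sp_feasible I y z" "obeys I D y z"
  shows "obj r \<le> ereal (cost I y z)"
  using assms(1) sp_full_feasible[OF assms(3,4,2)] unfolding generated_def by auto

lemma obeys_child:
  assumes "sp_feasible I y z" "obeys I D y z"
  shows "obeys I (insert (lower_child I v e) D) y z \<or> obeys I (insert (upper_child I v e) D) y z"
proof -
  obtain qs ps where sel: "selects I y z qs ps"
    using sp_feasible_selects[OF wf assms(1)] by blast
  note resp = obeys_selects[OF sel]
  show ?thesis
  proof (cases e)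
    case (Demand_entry g t)
    then show ?thesis
      using assms(2) unfolding resp
      by (cases "demand I g (qs g) t \<le> nat \<lfloor>mean_demand I v g t\<rfloor>")
        (auto simp: allowed_plans_def allowed_routes_def)
  next
    case (Assign_entry j g t)
    then show ?thesis
      using assms(2) assigned_bool[of I j "ps j" g t] unfolding resp
      by (cases "assigned I j (ps j) g t = 0") (auto simp: allowed_plans_def allowed_routes_def)
  qed
qed

definition num_columns :: "('j, 'l) decision set \<Rightarrow> nat" where
  "num_columns D = card (columns I D (\<lambda>_. UNIV) (\<lambda>_. UNIV))"

lemma num_columns_less:
  assumes "c \<in> columns I D (\<lambda>_. UNIV) (\<lambda>_. UNIV)" "c \<notin> columns I (insert b D) (\<lambda>_. UNIV) (\<lambda>_. UNIV)"
  shows "num_columns (insert b D) < num_columns D"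
proof -
  have "columns I (insert b D) (\<lambda>_. UNIV) (\<lambda>_. UNIV) \<subseteq> columns I D (\<lambda>_. UNIV) (\<lambda>_. UNIV)"
    by (auto simp: columns_def allowed_plans_def allowed_routes_def)
  then show ?thesis
    unfolding num_columns_def using assms finite_columns by (intro psubset_card_mono) auto
qed

text \<open>
  The columns of positive weight have demands on both sides of the mean, or both values of the
  assignment indicator. Each child forbids one of the two sides.
\<close>

lemma children_smaller:
  assumes f: "rmp_feasible I D U Q P y z" and e: "e \<in> entries I" and var: "variance I \<omega> y z e \<noteq> 0"
  shows "num_columns (insert (lower_child I y e) D) < num_columns D"
    and "num_columns (insert (upper_child I y e) D) < num_columns D"
proof -
  have "num_columns (insert (lower_child I y e) D) < num_columns D \<and>
      num_columns (insert (upper_child I y e) D) < num_columns D"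
  proof (cases e)
    case (Demand_entry g t)
    then have g: "g \<in> fires I" using e by (auto simp: entries_def)
    define m where "m = mean_demand I y g t"
    note y = rmp_weights(1,2)[OF f g]
    have al: "q \<in> allowed_plans I D g" if "q \<in> plans I g" "y g q \<noteq> 0" for q
      using f g that by (auto simp: rmp_feasible_def)
    have "0 \<le> m"
      unfolding m_def mean_demand_def using y(1) by (intro sum_nonneg) auto
    obtain q1 q2 where q: "q1 \<in> plans I g" "y g q1 \<noteq> 0" "m < demand I g q1 t"
      "q2 \<in> plans I g" "y g q2 \<noteq> 0" "demand I g q2 t < m"
      using variance_split[OF fin_plans[OF g] y, of "\<lambda>q. real (demand I g q t)" "\<omega> g t"] var
      unfolding Demand_entry m_def mean_demand_def by auto
    have "nat \<lfloor>m\<rfloor> < demand I g q1 t"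
      using q(3) \<open>0 \<le> m\<close> by linarith
    moreover have "demand I g q2 t \<le> nat \<lfloor>m\<rfloor>"
      using q(6) \<open>0 \<le> m\<close> by linarith
    ultimately have "q1 \<notin> allowed_plans I (insert (DemandLe g t (nat \<lfloor>m\<rfloor>)) D) g"
      "q2 \<notin> allowed_plans I (insert (DemandGt g t (nat \<lfloor>m\<rfloor>)) D) g"
      unfolding allowed_plans_def using leD by blast+
    then show ?thesis
      using al[OF q(1,2)] al[OF q(4,5)] g
      by (intro conjI[OF num_columns_less[of "Inl (g, q1)"] num_columns_less[of "Inl (g, q2)"]])
        (auto simp: columns_def Demand_entry m_def)
  next
    case (Assign_entry j g t)
    then have j: "j \<in> crews I" using e by (auto simp: entries_def)
    note z = rmp_weights(3,4)[OF f j]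
    have al: "p \<in> allowed_routes I D j" if "p \<in> routes I j" "z j p \<noteq> 0" for p
      using f j that by (auto simp: rmp_feasible_def)
    obtain p1 p2 where p: "p1 \<in> routes I j" "z j p1 \<noteq> 0" "p2 \<in> routes I j" "z j p2 \<noteq> 0"
      and less: "assigned I j p2 g t < assigned I j p1 g t"
      using variance_split[OF fin_routes[OF j] z, of "\<lambda>p. assigned I j p g t" "\<omega> g t"] var
      unfolding Assign_entry by fastforce
    have "assigned I j p1 g t = 1" "assigned I j p2 g t = 0"
      using less assigned_bool[of I j p1 g t] assigned_bool[of I j p2 g t] by auto
    then show ?thesis
      using al[OF p(1,2)] al[OF p(3,4)] j
      by (intro conjI[OF num_columns_less[of "Inr (j, p1)"] num_columns_less[of "Inr (j, p2)"]])
        (auto simp: columns_def allowed_routes_def Assign_entry)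
  qed
  then show "num_columns (insert (lower_child I y e) D) < num_columns D"
    "num_columns (insert (upper_child I y e) D) < num_columns D" by auto
qed

lemma entry_variance_nonneg:
  assumes f: "rmp_feasible I D U Q P y z" and e: "e \<in> entries I"
  shows "0 \<le> variance I \<omega> y z e"
proof (cases e)
  case (Demand_entry g t)
  then show ?thesis
    using f e variance_nonneg[of "plans I g" "y g" "\<lambda>q. real (demand I g q t) * \<omega> g t"]
    by (auto simp: rmp_feasible_def sp_constraints_def entries_def)
next
  case (Assign_entry j g t)
  then show ?thesis
    using f e variance_nonneg[of "routes I j" "z j" "\<lambda>p. assigned I j p g t * \<omega> g t"]
    by (auto simp: rmp_feasible_def sp_constraints_def entries_def)
qed

lemma finite_entries: "finite (entries I)"
proof -
  have "entries I = (\<lambda>(g, t). Demand_entry g t) ` (fires I \<times> periods I) \<union>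
      (\<lambda>(j, g, t). Assign_entry j g t) ` (crews I \<times> fires I \<times> periods I)"
    by (auto simp: entries_def image_def)
  then show ?thesis using fin by simp
qed

definition in_support :: "('l, 's) yvars \<Rightarrow> ('j, 'l) zvars \<Rightarrow> ('l \<Rightarrow> 's plan) \<Rightarrow> ('j \<Rightarrow> 'l route) \<Rightarrow> bool" where
  "in_support y z qs ps \<longleftrightarrow> (\<forall>g\<in>fires I. qs g \<in> plans I g \<and> 0 < y g (qs g)) \<and>
     (\<forall>j\<in>crews I. ps j \<in> routes I j \<and> 0 < z j (ps j))"

definition selection :: "('l \<Rightarrow> 's plan) \<Rightarrow> ('j \<Rightarrow> 'l route) \<Rightarrow> ('l, 's) yvars \<times> ('j, 'l) zvars" where
  "selection qs ps = ((\<lambda>g q. of_bool (q = qs g)), (\<lambda>j p. of_bool (p = ps j)))"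

lemma converted_iff: "converted I y z y' z' \<longleftrightarrow> (\<exists>qs ps. in_support y z qs ps \<and> (y', z') = selection qs ps)"
  by (auto simp: converted_def in_support_def selection_def)

lemma selection_selects:
  assumes "in_support y z qs ps" "(y', z') = selection qs ps"
  shows "selects I y' z' qs ps"
  using assms by (simp add: in_support_def selection_def selects_def)

lemma support_exists:
  assumes "rmp_feasible I D U Q P y z"
  shows "\<exists>qs ps. in_support y z qs ps"
proof -
  note w = rmp_weights[OF assms]
  obtain qs where "\<forall>g\<in>fires I. qs g \<in> plans I g \<and> 0 < y g (qs g)"
    by (rule cheapest_selection[OF fin_plans w(1,2)])
  moreover obtain ps where "\<forall>j\<in>crews I. ps j \<in> routes I j \<and> 0 < z j (ps j)"
    by (rule cheapest_selection[OF fin_routes w(3,4)])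
  ultimately show ?thesis
    unfolding in_support_def by blast
qed

text \<open>
  The columns of positive weight of one fire or crew agree on all demands or assignments, so each of them has
  the same effect on the linking constraints as the whole mixture.
\<close>

lemma selection_feasible:
  assumes f: "rmp_feasible I D U Q P y z"
    and \<omega>: "\<And>g t. g \<in> fires I \<Longrightarrow> t \<in> periods I \<Longrightarrow> 0 < \<omega> g t"
    and var: "\<And>e. e \<in> entries I \<Longrightarrow> variance I \<omega> y z e = 0"
    and sup: "in_support y z qs ps" and eq: "(y', z') = selection qs ps"
  shows "sp_feasible I y' z'" "obeys I D y' z'"
proof -
  note sel = selection_selects[OF sup eq]
  have d: "real (demand I g (qs g) t) = (\<Sum>q\<in>plans I g. real (demand I g q t) * y g q)"
    if g: "g \<in> fires I" and t: "t \<in> periods I" for g t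
  proof -
    note y = rmp_weights(1,2)[OF f g]
    have "variance I \<omega> y z (Demand_entry g t) = 0"
      using g t by (intro var) (simp add: entries_def)
    then have "real (demand I g (qs g) t) * \<omega> g t = (\<Sum>q\<in>plans I g. real (demand I g q t) * \<omega> g t * y g q)"
      using variance_zero[OF fin_plans[OF g] y, of "\<lambda>q. real (demand I g q t) * \<omega> g t" "qs g"] sup g
      by (simp add: in_support_def less_imp_neq[symmetric])
    also have "\<dots> = (\<Sum>q\<in>plans I g. real (demand I g q t) * y g q) * \<omega> g t"
      by (simp add: sum_distrib_left sum_distrib_right mult_ac)
    finally show ?thesis using \<omega>[OF g t] by simp
  qed
  have a: "assigned I j (ps j) g t = (\<Sum>p\<in>routes I j. assigned I j p g t * z j p)"
    if j: "j \<in> crews I" and g: "g \<in> fires I" and t: "t \<in> periods I" for j g t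
  proof -
    note z = rmp_weights(3,4)[OF f j]
    have "variance I \<omega> y z (Assign_entry j g t) = 0"
      using j g t by (intro var) (simp add: entries_def)
    then have "assigned I j (ps j) g t * \<omega> g t = (\<Sum>p\<in>routes I j. assigned I j p g t * \<omega> g t * z j p)"
      using variance_zero[OF fin_routes[OF j] z, of "\<lambda>p. assigned I j p g t * \<omega> g t" "ps j"] sup j
      by (simp add: in_support_def less_imp_neq[symmetric])
    also have "\<dots> = (\<Sum>p\<in>routes I j. assigned I j p g t * z j p) * \<omega> g t"
      by (simp add: sum_distrib_left sum_distrib_right mult_ac)
    finally show ?thesis using \<omega>[OF g t] by simp
  qed
  have "(\<Sum>j\<in>crews I. assigned I j (ps j) g t) - real (demand I g (qs g) t) \<ge> 0"
    if "g \<in> fires I" "t \<in> periods I" for g t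
    using f that by (simp add: d a rmp_feasible_def sp_constraints_def)
  moreover have "(\<Sum>q\<in>plans I g. y' g q) = 1" if "g \<in> fires I" for g
    using selects_sums(1)[OF wf sel that, of "\<lambda>_. 1"] by simp
  moreover have "(\<Sum>p\<in>routes I j. z' j p) = 1" if "j \<in> crews I" for j
    using selects_sums(2)[OF wf sel that, of "\<lambda>_. 1"] by simp
  ultimately have "sp_constraints I y' z'"
    unfolding sp_constraints_def by (simp add: selects_sums[OF wf sel])
  moreover have "binary I y' z'"
    using eq by (simp add: binary_def selection_def)
  ultimately show "sp_feasible I y' z'" by (simp add: sp_feasible_def)
  show "obeys I D y' z'"
    unfolding obeys_selects[OF sel] using f sup by (force simp: rmp_feasible_def in_support_def)
qed

lemma selects_cost:
  assumes "selects I y z qs ps"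
  shows "cost I y z = (\<Sum>j\<in>crews I. route_cost I j (ps j)) + (\<Sum>g\<in>fires I. plan_cost I g (qs g))"
  unfolding cost_def by (simp add: selects_sums[OF wf assms])

text \<open>
  Every selection from the support is an integer solution and hence not cheaper than the relaxation. The
  selection of the cheapest columns is not dearer. So these cost as much as the average of the
  support, which makes all columns of the support equally expensive.
\<close>

lemma converted_optimal:
  assumes gen: "generated D r" and U: "cuts r \<subseteq> cut_universe I" and obj: "obj r \<noteq> \<infinity>"
    and \<omega>: "\<And>g t. g \<in> fires I \<Longrightarrow> t \<in> periods I \<Longrightarrow> 0 < \<omega> g t"
    and var: "\<And>e. e \<in> entries I \<Longrightarrow> variance I \<omega> (yval r) (zval r) e = 0"
    and conv: "converted I (yval r) (zval r) y' z'"
  shows "sp_feasible I y' z'" "ereal (cost I y' z') = obj r"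
proof -
  let ?y = "yval r" and ?z = "zval r"
  have f: "rmp_feasible I D (cuts r) (cols_q r) (cols_p r) ?y ?z"
    and c: "obj r = ereal (cost I ?y ?z)"
    using gen obj by (auto simp: generated_def)
  obtain qs ps where sup: "in_support ?y ?z qs ps" and eq: "(y', z') = selection qs ps"
    using conv converted_iff by blast
  note feas = selection_feasible[OF f \<omega> var]
  show "sp_feasible I y' z'" by (rule feas(1)[OF _ _ _ sup eq])
  define A where "A g = (\<Sum>q\<in>plans I g. plan_cost I g q * ?y g q)" for g
  define B where "B j = (\<Sum>p\<in>routes I j. route_cost I j p * ?z j p)" for j
  note w = rmp_weights[OF f]
  obtain qm where qm: "\<forall>g\<in>fires I. qm g \<in> plans I g \<and> 0 < ?y g (qm g)"
    "\<forall>g\<in>fires I. plan_cost I g (qm g) \<le> A g"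
    "\<forall>g\<in>fires I. plan_cost I g (qm g) = A g \<longrightarrow> (\<forall>q\<in>plans I g. 0 < ?y g q \<longrightarrow> plan_cost I g q = A g)"
    unfolding A_def by (rule cheapest_selection[OF fin_plans w(1,2), where f = "plan_cost I"])
  obtain pm where pm: "\<forall>j\<in>crews I. pm j \<in> routes I j \<and> 0 < ?z j (pm j)"
    "\<forall>j\<in>crews I. route_cost I j (pm j) \<le> B j"
    "\<forall>j\<in>crews I. route_cost I j (pm j) = B j \<longrightarrow> (\<forall>p\<in>routes I j. 0 < ?z j p \<longrightarrow> route_cost I j p = B j)"
    unfolding B_def by (rule cheapest_selection[OF fin_routes w(3,4), where f = "route_cost I"])
  have total: "cost I ?y ?z = (\<Sum>j\<in>crews I. B j) + (\<Sum>g\<in>fires I. A g)"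
    by (simp add: cost_def A_def B_def)
  have supm: "in_support ?y ?z qm pm" using qm pm by (simp add: in_support_def)
  obtain ym zm where eqm: "(ym, zm) = selection qm pm" by (metis surj_pair)
  have "sp_feasible I ym zm" "obeys I D ym zm"
    using feas[OF _ _ _ supm eqm] by auto
  then have "cost I ?y ?z \<le> cost I ym zm"
    using generated_bound[OF gen U] c by fastforce
  then have "(\<Sum>j\<in>crews I. B j) + (\<Sum>g\<in>fires I. A g) \<le>
      (\<Sum>j\<in>crews I. route_cost I j (pm j)) + (\<Sum>g\<in>fires I. plan_cost I g (qm g))"
    unfolding total selects_cost[OF selection_selects[OF supm eqm]] .
  moreover have "(\<Sum>j\<in>crews I. route_cost I j (pm j)) \<le> (\<Sum>j\<in>crews I. B j)"
    using pm by (intro sum_mono) blast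
  moreover have "(\<Sum>g\<in>fires I. plan_cost I g (qm g)) \<le> (\<Sum>g\<in>fires I. A g)"
    using qm by (intro sum_mono) blast
  ultimately have zero: "(\<Sum>j\<in>crews I. B j - route_cost I j (pm j)) = 0" "(\<Sum>g\<in>fires I. A g - plan_cost I g (qm g)) = 0"
    by (simp_all add: sum_subtractf)
  have le: "\<forall>j\<in>crews I. 0 \<le> B j - route_cost I j (pm j)" "\<forall>g\<in>fires I. 0 \<le> A g - plan_cost I g (qm g)"
    using qm pm unfolding diff_ge_0_iff_ge by blast+
  have "route_cost I j (pm j) = B j" if "j \<in> crews I" for j
    using zero(1) le(1) fin that sum_nonneg_eq_0_iff[of "crews I" "\<lambda>j. B j - route_cost I j (pm j)"] by simp
  then have "\<forall>j\<in>crews I. route_cost I j (ps j) = B j"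
    using pm sup unfolding in_support_def by blast
  moreover have "plan_cost I g (qm g) = A g" if "g \<in> fires I" for g
    using zero(2) le(2) fin that sum_nonneg_eq_0_iff[of "fires I" "\<lambda>g. A g - plan_cost I g (qm g)"] by simp
  then have "\<forall>g\<in>fires I. plan_cost I g (qs g) = A g"
    using qm sup unfolding in_support_def by blast
  ultimately have "cost I y' z' = cost I ?y ?z"
    unfolding total selects_cost[OF selection_selects[OF sup eq]] by simp
  then show "ereal (cost I y' z') = obj r" using c by simp
qed

end

section \<open>Branch-price-and-cut\<close>

context large_constants
begin

text \<open>
  The node being solved is already marked as explored, but the solutions that respect its decisions are
  not yet accounted for.
\<close>

definition pending :: "('j, 'l, 's) bpc_state \<Rightarrow> nat set" where
  "pending s = open_nodes s \<union> (case phase s of Solving r \<Rightarrow> {current s} | _ \<Rightarrow> {})"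

abbreviation node_decisions :: "('j, 'l, 's) bpc_state \<Rightarrow> nat \<Rightarrow> ('j, 'l) decision set" where
  "node_decisions s i \<equiv> decisions (nodes s ! i)"

definition phase_inv :: "('j, 'l, 's) bpc_state \<Rightarrow> bool" where
  "phase_inv s \<longleftrightarrow> (case phase s of
       Enter \<Rightarrow> current s \<in> open_nodes s
     | Solving r \<Rightarrow> current s \<in> explored s \<and> relax_inv (node_decisions s (current s)) r
     | Heuristic_option r \<Rightarrow> cuts r \<subseteq> cut_universe I
     | Heuristic k c r \<Rightarrow> relax_inv (demand_limits I c) r
     | Heuristic_next k c r \<Rightarrow> cuts r \<subseteq> cut_universe I
     | Select \<Rightarrow> True
     | Done \<Rightarrow> open_nodes s = {})"

definition tree_inv :: "('j, 'l, 's) bpc_state \<Rightarrow> bool" where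
  "tree_inv s \<longleftrightarrow> explored s \<subseteq> {..<length (nodes s)} \<and> counter s = card (explored s) \<and>
     (\<forall>nd\<in>set (nodes s). node_cuts nd \<subseteq> cut_universe I)"

definition incumbent_inv :: "('j, 'l, 's) bpc_state \<Rightarrow> bool" where
  "incumbent_inv s \<longleftrightarrow> (best s = None \<and> ub s = \<infinity>) \<or>
     (\<exists>y z. best s = Some (y, z) \<and> sp_feasible I y z \<and> ub s = ereal (cost I y z))"

definition covered :: "('j, 'l, 's) bpc_state \<Rightarrow> bool" where
  "covered s \<longleftrightarrow> (\<forall>y z. sp_feasible I y z \<longrightarrow>
     ub s \<le> ereal (cost I y z) \<or> (\<exists>i\<in>pending s. obeys I (node_decisions s i) y z))"

definition bpc_inv :: "('j, 'l, 's) bpc_state \<Rightarrow> bool" where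
  "bpc_inv s \<longleftrightarrow> phase_inv s \<and> tree_inv s \<and> incumbent_inv s \<and> covered s"

lemmas inv_defs = bpc_inv_def phase_inv_def tree_inv_def incumbent_inv_def

lemma bpc_inv_init: "bpc_inv bpc_init"
proof -
  have "open_nodes bpc_init = {0 :: nat}"
    by (auto simp: open_nodes_def bpc_init_def)
  then show ?thesis
    by (auto simp: inv_defs covered_def pending_def bpc_init_def obeys_empty)
qed

text \<open>
  An integer solution that loses its node has to be dominated by the incumbent or move to another node.
\<close>

lemma covered_step:
  assumes "covered s" "ub s' \<le> ub s"
    and "\<And>i y z. i \<in> pending s \<Longrightarrow> sp_feasible I y z \<Longrightarrow> obeys I (node_decisions s i) y z \<Longrightarrow>
      ub s' \<le> ereal (cost I y z) \<or> (\<exists>i\<in>pending s'. obeys I (node_decisions s' i) y z)"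
  shows "covered s'"
  using assms(1,3) order_trans[OF assms(2)] unfolding covered_def by blast

lemma covered_unchanged:
  "covered s \<Longrightarrow> ub s' \<le> ub s \<Longrightarrow> pending s \<subseteq> pending s' \<Longrightarrow> nodes s' = nodes s \<Longrightarrow> covered s'"
  by (rule covered_step) auto

lemma solved_bound:
  assumes "bpc_inv s" "phase s = Solving r" "stage r = Solved"
  shows "generated (node_decisions s (current s)) r" "cuts r \<subseteq> cut_universe I"
    "current s \<in> explored s" "pending s = open_nodes s \<union> {current s}"
  using assms by (simp_all add: bpc_inv_def phase_inv_def relax_inv_def pending_def)

text \<open>Closing the current node is justified when \<open>ub\<close> is at most its bound afterwards.\<close>

lemma covered_closed:
  assumes inv: "bpc_inv s" and ph: "phase s = Solving r" "stage r = Solved"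
    and s': "ub s' \<le> ub s" "ub s' \<le> obj r" "open_nodes s' = open_nodes s" "nodes s' = nodes s"
  shows "covered s'"
proof (rule covered_step)
  note solved = solved_bound[OF inv ph]
  show "covered s" "ub s' \<le> ub s" using inv s'(1) by (simp_all add: bpc_inv_def)
  fix i y z assume "i \<in> pending s" and sp: "sp_feasible I y z" and ob: "obeys I (node_decisions s i) y z"
  then consider "i \<in> open_nodes s" | "i = current s" using solved(4) by auto
  then show "ub s' \<le> ereal (cost I y z) \<or> (\<exists>i\<in>pending s'. obeys I (node_decisions s' i) y z)"
  proof cases
    case 1
    then show ?thesis using ob s'(3,4) by (auto simp: pending_def)
  next
    case 2
    then show ?thesis using generated_bound[OF solved(1,2) sp] ob s'(2) by auto
  qed
qed

lemma bpc_inv_same_tree: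
  assumes "bpc_inv s" "phase_inv s'" "incumbent_inv s'" "ub s' \<le> ub s" "pending s \<subseteq> pending s'"
    "nodes s' = nodes s" "explored s' = explored s" "counter s' = counter s"
  shows "bpc_inv s'"
  using assms covered_unchanged[of s s'] by (simp add: bpc_inv_def tree_inv_def)

lemma bpc_inv_closed:
  assumes "bpc_inv s" "phase s = Solving r" "stage r = Solved" "phase_inv s'" "incumbent_inv s'"
    "ub s' \<le> ub s" "ub s' \<le> obj r" "nodes s' = nodes s" "explored s' = explored s" "counter s' = counter s"
  shows "bpc_inv s'"
  using assms covered_closed[OF assms(1-3), of s'] by (simp add: bpc_inv_def tree_inv_def open_nodes_def)

lemma branch_open:
  assumes "explored s \<subseteq> {..<length (nodes s)}" "nodes s' = nodes s @ [a, b]" "explored s' = explored s"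
  shows "open_nodes s' = open_nodes s \<union> {length (nodes s), Suc (length (nodes s))}"
  using assms by (auto simp: open_nodes_def less_Suc_eq)

lemma rmp_integer_feasible:
  assumes "rmp_integer_optimal I D r y z"
  shows "sp_feasible I y z"
  using assms by (simp add: rmp_integer_optimal_def Let_def sp_feasible_def rmp_feasible_def)

lemma bpc_inv_step:
  assumes step: "bpc_step I M M' dual_aware s s'" and inv: "bpc_inv s"
  shows "bpc_inv s'"
proof -
  have tree: "tree_inv s" and inc: "incumbent_inv s" and cov: "covered s" and ph: "phase_inv s"
    using inv by (auto simp: bpc_inv_def)
  note same = bpc_inv_same_tree[OF inv]
  note unfold = phase_inv_def incumbent_inv_def pending_def open_nodes_def
  show ?thesis
    using step
  proof cases
    case (enter nd)
    have cur: "current s \<in> open_nodes s" using ph enter(2) by (simp add: phase_inv_def)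
    then have len: "current s < length (nodes s)" "current s \<notin> explored s" by (auto simp: open_nodes_def)
    have "finite (explored s)" using tree finite_subset by (auto simp: tree_inv_def)
    then have "tree_inv s'"
      using tree len enter(1) by (simp add: tree_inv_def)
    moreover have "node_cuts nd \<subseteq> cut_universe I"
      using tree len(1) enter(3) by (simp add: tree_inv_def)
    then have "phase_inv s'"
      using enter(1) by (simp add: phase_inv_def relax_inv_start)
    moreover have "pending s \<subseteq> pending s'"
      using enter(1,2) by (auto simp: pending_def open_nodes_def)
    then have "covered s'"
      using covered_unchanged[OF cov] enter(1) by simp
    ultimately show ?thesis
      using inc enter(1) by (simp add: bpc_inv_def incumbent_inv_def)
  next
    case (solve r r')
    then show ?thesis
      using ph inc relax_inv_step[OF solve(3)] by (intro same) (auto simp: unfold)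
  next
    case (integral r)
    have "obj r \<noteq> \<infinity>" using integral(4) by auto
    then have "obj r = ereal (cost I (yval r) (zval r))" "sp_feasible I (yval r) (zval r)"
      using solved_bound(1)[OF inv integral(2,3)] integral(5)
      by (auto simp: generated_def sp_feasible_def rmp_feasible_def)
    then show ?thesis
      using integral by (intro bpc_inv_closed[OF inv integral(2,3)]) (auto simp: unfold)
  next
    case (prune r)
    then show ?thesis
      using inc solved_bound(2)[OF inv prune(2,3)]
      by (intro bpc_inv_closed[OF inv prune(2,3)]) (auto simp: unfold)
  next
    case (convert r \<omega> y' z')
    note solved = solved_bound[OF inv convert(2,3)]
    have obj: "obj r \<noteq> \<infinity>" using convert(4) by auto
    have "0 \<le> dual r (Rho_row g t)" if "g \<in> fires I" "t \<in> periods I" for g t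
      using solved(1) obj that by (auto simp: generated_def)
    then have \<omega>: "0 < \<omega> g t" if "g \<in> fires I" "t \<in> periods I" for g t
      using convert(6) that by (auto simp: branching_weights_def add_nonneg_pos split: if_splits)
    have "sp_feasible I y' z'" "ereal (cost I y' z') = obj r"
      using converted_optimal[OF solved(1,2) obj \<omega> convert(7,8)] by auto
    then show ?thesis
      using convert by (intro bpc_inv_closed[OF inv convert(2,3)]) (auto simp: unfold)
  next
    case (branch r \<omega> e nd)
    note solved = solved_bound[OF inv branch(2,3)]
    let ?n = "length (nodes s)"
    let ?a = "child nd r (lower_child I (yval r) e)" and ?b = "child nd r (upper_child I (yval r) e)"
    have exp: "explored s \<subseteq> {..<?n}" using tree by (simp add: tree_inv_def)
    have nodes': "nodes s' = nodes s @ [?a, ?b]" "explored s' = explored s" "counter s' = counter s"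
      "phase s' = Heuristic_option r" "ub s' = ub s" "best s' = best s"
      using branch(1) by simp_all
    have pend: "pending s' = open_nodes s \<union> {?n, Suc ?n}"
      using branch_open[OF exp nodes'(1,2)] nodes'(4) by (simp add: pending_def)
    have old: "node_decisions s' i = node_decisions s i" if "i < ?n" for i
      using that by (simp add: nodes' nth_append)
    have new: "node_decisions s' ?n = insert (lower_child I (yval r) e) (node_decisions s (current s))"
      "node_decisions s' (Suc ?n) = insert (upper_child I (yval r) e) (node_decisions s (current s))"
      using branch(10) by (simp_all add: nodes' nth_append child_def)
    have "covered s'"
    proof (rule covered_step[OF cov])
      fix i y z assume "i \<in> pending s" and sp: "sp_feasible I y z" and ob: "obeys I (node_decisions s i) y z"
      then consider "i \<in> open_nodes s" "i < ?n" | "i = current s"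
        using solved(4) by (auto simp: open_nodes_def)
      then show "ub s' \<le> ereal (cost I y z) \<or> (\<exists>i\<in>pending s'. obeys I (node_decisions s' i) y z)"
      proof cases
        case 1
        then show ?thesis using ob old pend by (metis UnI1)
      next
        case 2
        then show ?thesis
          using obeys_child[OF sp, of _ "yval r" e] ob new pend by auto
      qed
    qed (simp add: nodes')
    moreover have "tree_inv s'"
      using tree solved(2) by (auto simp: tree_inv_def nodes' child_def)
    moreover have "phase_inv s'"
      using solved(2) nodes' by (simp add: phase_inv_def)
    ultimately show ?thesis
      using inc nodes' by (simp add: bpc_inv_def incumbent_inv_def)
  next
    case (heuristic_start r Q P U k)
    then show ?thesis
      using ph inc by (intro same) (auto simp: unfold intro!: relax_inv_start)
  next
    case (heuristic_solve k c r r')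
    then show ?thesis
      using ph inc relax_inv_step[OF heuristic_solve(3)] by (intro same) (auto simp: unfold)
  next
    case (heuristic_improve k c r y z)
    then show ?thesis
      using ph rmp_integer_feasible[OF heuristic_improve(4)]
      by (intro same) (auto simp: unfold relax_inv_def)
  next
    case (heuristic_again k c r Q P U)
    then show ?thesis
      using ph inc by (intro same) (auto simp: unfold intro!: relax_inv_start)
  next
    case finish
    have "explored s = {..<length (nodes s)}"
      using tree finish(3) by (intro card_subset_eq) (auto simp: tree_inv_def)
    then show ?thesis
      using finish inc by (intro same) (auto simp: unfold)
  qed (use ph inc in \<open>auto simp: unfold relax_inv_def intro!: same\<close>)
qed

lemma bpc_inv_reachable: "(bpc_step I M M' dual_aware)\<^sup>*\<^sup>* bpc_init s \<Longrightarrow> bpc_inv s"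
  by (induction rule: rtranclp_induct) (auto intro: bpc_inv_init bpc_inv_step)

lemma weights_exist: "\<exists>\<omega>. branching_weights dual_aware w \<omega>"
proof (cases dual_aware)
  case True
  have "branching_weights True w (\<lambda>g t. w (Rho_row g t) + 1)"
    unfolding branching_weights_def by (auto intro!: exI[of _ "\<lambda>_ _. 1"])
  then show ?thesis using True by auto
next
  case False
  then show ?thesis by (auto simp: branching_weights_def)
qed

lemma bpc_progress:
  assumes inv: "bpc_inv s" and "phase s \<noteq> Done"
  shows "\<exists>s'. bpc_step I M M' dual_aware s s'"
proof (cases "phase s")
  case Enter
  then show ?thesis using bpc_step.enter by blast
next
  case (Solving r)
  show ?thesis
  proof (cases "stage r = Solved")
    case False
    have "relax_inv (node_decisions s (current s)) r"
      using inv Solving by (simp add: bpc_inv_def phase_inv_def)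
    then obtain r' where "relax_step I M M' (node_decisions s (current s)) r r'"
      using relax_progress False by blast
    then show ?thesis using bpc_step.solve[OF Solving] by blast
  next
    case stage: True
    note solved = solved_bound[OF inv Solving stage]
    show ?thesis
    proof (cases "obj r < ub s")
      case False
      then show ?thesis using bpc_step.prune[OF Solving stage] by (simp add: not_less) blast
    next
      case obj: True
      then have f: "rmp_feasible I (node_decisions s (current s)) (cuts r) (cols_q r) (cols_p r) (yval r) (zval r)"
        using solved(1) by (auto simp: generated_def)
      show ?thesis
      proof (cases "binary I (yval r) (zval r)")
        case True
        then show ?thesis using bpc_step.integral[OF Solving stage obj] by blast
      next
        case nonbin: False
        obtain \<omega> where \<omega>: "branching_weights dual_aware (dual r) \<omega>"
          using weights_exist by blast
        let ?v = "variance I \<omega> (yval r) (zval r)"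
        show ?thesis
        proof (cases "\<forall>e\<in>entries I. ?v e = 0")
          case True
          obtain qs ps where "in_support (yval r) (zval r) qs ps"
            using support_exists[OF f] by blast
          then obtain y' z' where "converted I (yval r) (zval r) y' z'"
            unfolding converted_iff by (metis surj_pair)
          then show ?thesis
            using bpc_step.convert[OF Solving stage obj nonbin \<omega>] True by blast
        next
          case False
          then obtain e0 where e0: "e0 \<in> entries I" "?v e0 \<noteq> 0" by blast
          then have "entries I \<noteq> {}" by blast
          then obtain e where "is_arg_min (\<lambda>e. - ?v e) (\<lambda>e. e \<in> entries I) e"
            using ex_is_arg_min_if_finite[OF finite_entries] by blast
          then have e: "e \<in> entries I" "\<And>e'. e' \<in> entries I \<Longrightarrow> ?v e' \<le> ?v e"
            by (auto simp: is_arg_min_def not_less)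
          have "0 < ?v e0"
            using entry_variance_nonneg[OF f e0(1), of \<omega>] e0(2) by simp
          then have "?v e \<noteq> 0" using e(2)[OF e0(1)] by simp
          then show ?thesis
            using bpc_step.branch[OF Solving stage obj nonbin \<omega> e(1) _ e(2) refl] by blast
        qed
      qed
    qed
  qed
next
  case (Heuristic_option r)
  then show ?thesis using bpc_step.heuristic_skip by blast
next
  case (Heuristic k c r)
  show ?thesis
  proof (cases "stage r = Solved")
    case False
    have "relax_inv (demand_limits I c) r"
      using inv Heuristic by (simp add: bpc_inv_def phase_inv_def)
    then obtain r' where "relax_step I M M' (demand_limits I c) r r'"
      using relax_progress False by blast
    then show ?thesis using bpc_step.heuristic_solve[OF Heuristic] by blast
  next
    case True
    show ?thesis
    proof (cases "\<exists>y z. rmp_integer_optimal I (demand_limits I c) r y z \<and> ereal (cost I y z) < ub s")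
      case True
      then show ?thesis using bpc_step.heuristic_improve[OF Heuristic \<open>stage r = Solved\<close>] by blast
    next
      case False
      then show ?thesis using bpc_step.heuristic_no_improve[OF Heuristic \<open>stage r = Solved\<close>] by blast
    qed
  qed
next
  case (Heuristic_next k c r)
  show ?thesis
  proof (cases k)
    case 0
    then show ?thesis using bpc_step.heuristic_stop Heuristic_next by blast
  next
    case (Suc k')
    then show ?thesis
      using bpc_step.heuristic_again[of s k' c r "cols_q r" "cols_p r" "cuts r"] Heuristic_next by blast
  qed
next
  case Select
  show ?thesis
  proof (cases "length (nodes s) = counter s")
    case True
    then show ?thesis using bpc_step.finish[OF Select] by blast
  next
    case False
    have "open_nodes s \<noteq> {}"
    proof
      assume "open_nodes s = {}"
      then have "explored s = {..<length (nodes s)}"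
        using inv by (auto simp: open_nodes_def bpc_inv_def tree_inv_def)
      then show False using inv False by (simp add: bpc_inv_def tree_inv_def)
    qed
    then show ?thesis using bpc_step.select[OF Select False] by blast
  qed
next
  case Done
  then show ?thesis using assms(2) by blast
qed

text \<open>With base 3, two children with fewer columns weigh less than their parent.\<close>

definition node_weight :: "('j, 'l, 's) bpc_state \<Rightarrow> nat \<Rightarrow> nat" where
  "node_weight s i = 3 ^ num_columns (node_decisions s i)"

definition tree_weight :: "('j, 'l, 's) bpc_state \<Rightarrow> nat" where
  "tree_weight s = (\<Sum>i\<in>pending s. node_weight s i)"

text \<open>
  The number of rounds of the heuristic is fixed only when it starts, so it may rank only below the phase.
  The factor 2 separates solving the relaxation of a round from evaluating it.
\<close>

definition phase_measure :: "('j, 'l, 's) bpc_state \<Rightarrow> nat \<times> nat \<times> nat \<times> nat \<times> nat \<times> nat" where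
  "phase_measure s = (case phase s of
       Enter \<Rightarrow> (2, 0, 0, 0, 0, 0)
     | Solving r \<Rightarrow> (1, 0, relax_measure (node_decisions s (current s)) r)
     | Heuristic_option r \<Rightarrow> (5, 0, 0, 0, 0, 0)
     | Heuristic k c r \<Rightarrow> (4, 2 * k + 1, relax_measure (demand_limits I c) r)
     | Heuristic_next k c r \<Rightarrow> (4, 2 * k, 0, 0, 0, 0)
     | Select \<Rightarrow> (3, 0, 0, 0, 0, 0)
     | Done \<Rightarrow> (0, 0, 0, 0, 0, 0))"

abbreviation phase_order :: "((nat \<times> nat \<times> nat \<times> nat \<times> nat \<times> nat) \<times> (nat \<times> nat \<times> nat \<times> nat \<times> nat \<times> nat)) set" where
  "phase_order \<equiv> less_than <*lex*> less_than <*lex*> less_than <*lex*> less_than <*lex*> less_than <*lex*> less_than"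

definition bpc_order :: "(('j, 'l, 's) bpc_state \<times> ('j, 'l, 's) bpc_state) set" where
  "bpc_order = inv_image (less_than <*lex*> phase_order) (\<lambda>s. (tree_weight s, phase_measure s))"

lemma wf_bpc_order: "wf bpc_order"
  unfolding bpc_order_def by (intro wf_inv_image wf_lex_prod wf_less_than)

lemma finite_open: "finite (open_nodes s)"
  by (simp add: open_nodes_def)

lemma same_weight:
  "pending s' = pending s \<Longrightarrow> nodes s' = nodes s \<Longrightarrow> tree_weight s' = tree_weight s"
  by (simp add: tree_weight_def node_weight_def)

lemma tree_weight_solving:
  assumes "bpc_inv s" "phase s = Solving r"
  shows "tree_weight s = (\<Sum>i\<in>open_nodes s. node_weight s i) + node_weight s (current s)"
proof -
  have "current s \<notin> open_nodes s"
    using assms by (simp add: bpc_inv_def phase_inv_def open_nodes_def)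
  then show ?thesis
    using assms(2) by (simp add: tree_weight_def pending_def finite_open)
qed

lemma weight_close:
  assumes inv: "bpc_inv s" and ph: "phase s = Solving r"
    and s': "nodes s' = nodes s" "explored s' = explored s" "\<And>r. phase s' \<noteq> Solving r"
  shows "tree_weight s' < tree_weight s"
proof -
  have "pending s' = open_nodes s"
    using s' by (simp add: pending_def open_nodes_def split: phase.split)
  then have "tree_weight s' = (\<Sum>i\<in>open_nodes s. node_weight s i)"
    using s' by (simp add: tree_weight_def node_weight_def)
  then show ?thesis
    using tree_weight_solving[OF inv ph] by (simp add: node_weight_def)
qed

text \<open>
  The tree gets lighter when the current node is closed or branched. All other steps keep its weight and
  move to a lower phase, use up a round of the heuristic, or advance a relaxation.
\<close>

lemma bpc_decreases:
  assumes step: "bpc_step I M M' dual_aware s s'" and inv: "bpc_inv s"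
  shows "(s', s) \<in> bpc_order"
proof -
  have lighter: ?thesis if "tree_weight s' < tree_weight s"
    using that by (simp add: bpc_order_def)
  have later: ?thesis if "tree_weight s' = tree_weight s" "(phase_measure s', phase_measure s) \<in> phase_order"
    using that by (simp add: bpc_order_def)
  show ?thesis
    using step
  proof cases
    case (enter nd)
    have "current s \<in> open_nodes s" using inv enter(2) by (simp add: bpc_inv_def phase_inv_def)
    then have "pending s' = pending s"
      using enter(1,2) by (auto simp: pending_def open_nodes_def)
    then show ?thesis
      using enter(1,2) by (intro later same_weight) (auto simp: phase_measure_def)
  next
    case (solve r r')
    have "relax_inv (node_decisions s (current s)) r"
      using inv solve(2) by (simp add: bpc_inv_def phase_inv_def)
    then show ?thesis
      using solve relax_decreases[OF solve(3)]
      by (intro later same_weight) (auto simp: phase_measure_def pending_def open_nodes_def)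
  next
    case (integral r)
    show ?thesis
      by (rule lighter[OF weight_close[OF inv integral(2)]]) (use integral(1) in auto)
  next
    case (prune r)
    show ?thesis
      by (rule lighter[OF weight_close[OF inv prune(2)]]) (use prune(1) in auto)
  next
    case (convert r \<omega> y' z')
    show ?thesis
      by (rule lighter[OF weight_close[OF inv convert(2)]]) (use convert(1) in auto)
  next
    case (branch r \<omega> e nd)
    note solved = solved_bound[OF inv branch(2,3)]
    let ?n = "length (nodes s)"
    let ?a = "child nd r (lower_child I (yval r) e)" and ?b = "child nd r (upper_child I (yval r) e)"
    have exp: "explored s \<subseteq> {..<?n}" using inv by (simp add: bpc_inv_def tree_inv_def)
    have nodes': "nodes s' = nodes s @ [?a, ?b]" "explored s' = explored s" "phase s' = Heuristic_option r"
      using branch(1) by simp_all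
    have pend: "pending s' = open_nodes s \<union> {?n, Suc ?n}"
      using branch_open[OF exp nodes'(1,2)] nodes'(3) by (simp add: pending_def)
    have f: "rmp_feasible I (node_decisions s (current s)) (cuts r) (cols_q r) (cols_p r) (yval r) (zval r)"
      using solved(1) branch(4) by (auto simp: generated_def)
    note smaller = children_smaller[OF f branch(7,8)]
    have old: "node_weight s' i = node_weight s i" if "i \<in> open_nodes s" for i
      using that by (simp add: node_weight_def nodes' nth_append open_nodes_def)
    have new: "node_weight s' ?n + node_weight s' (Suc ?n) < node_weight s (current s)"
    proof -
      have pow: "3 * 3 ^ a \<le> (3 ^ b :: nat)" if "a < b" for a b :: nat
        using power_increasing[of "Suc a" b "3 :: nat"] that by simp
      have "3 * node_weight s' ?n \<le> node_weight s (current s)"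
        using pow[OF smaller(1)] branch(10) by (simp add: node_weight_def nodes' nth_append child_def)
      moreover have "3 * node_weight s' (Suc ?n) \<le> node_weight s (current s)"
        using pow[OF smaller(2)] branch(10) by (simp add: node_weight_def nodes' nth_append child_def)
      moreover have "0 < node_weight s (current s)" by (simp add: node_weight_def)
      ultimately show ?thesis by linarith
    qed
    have "tree_weight s' = (\<Sum>i\<in>open_nodes s. node_weight s' i) + (\<Sum>i\<in>{?n, Suc ?n}. node_weight s' i)"
      unfolding tree_weight_def pend
      by (rule sum.union_disjoint) (auto simp: finite_open, auto simp: open_nodes_def)
    also have "\<dots> = (\<Sum>i\<in>open_nodes s. node_weight s i) + (node_weight s' ?n + node_weight s' (Suc ?n))"
      using old by simp
    also have "\<dots> < tree_weight s"
      unfolding tree_weight_solving[OF inv branch(2)] using new by simp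
    finally show ?thesis by (rule lighter)
  next
    case (heuristic_solve k c r r')
    have "relax_inv (demand_limits I c) r"
      using inv heuristic_solve(2) by (simp add: bpc_inv_def phase_inv_def)
    then show ?thesis
      using heuristic_solve relax_decreases[OF heuristic_solve(3)]
      by (intro later same_weight) (auto simp: phase_measure_def pending_def open_nodes_def)
  qed (rule later[OF same_weight]; simp add: phase_measure_def pending_def open_nodes_def)+
qed

lemma bpc_terminates:
  "\<nexists>run. run 0 = bpc_init \<and> (\<forall>n. bpc_step I M M' dual_aware (run n) (run (Suc n)))"
proof
  assume "\<exists>run. run 0 = bpc_init \<and> (\<forall>n. bpc_step I M M' dual_aware (run n) (run (Suc n)))"
  then obtain run where run: "run 0 = bpc_init" "\<And>n. bpc_step I M M' dual_aware (run n) (run (Suc n))"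
    by blast
  have "bpc_inv (run n)" for n
    by (induction n) (auto simp: run(1) bpc_inv_init intro: bpc_inv_step[OF run(2)])
  then have "(run (Suc n), run n) \<in> bpc_order" for n
    using bpc_decreases[OF run(2)] by blast
  then show False
    using wf_bpc_order unfolding wf_iff_no_infinite_down_chain by blast
qed

lemma bpc_final:
  assumes feas: "\<exists>y z. sp_feasible I y z"
    and reach: "(bpc_step I M M' dual_aware)\<^sup>*\<^sup>* bpc_init s" and stuck: "\<nexists>s'. bpc_step I M M' dual_aware s s'"
  shows "phase s = Done \<and> (\<exists>y z. best s = Some (y, z) \<and> sp_optimal I y z)"
proof -
  have inv: "bpc_inv s" by (rule bpc_inv_reachable[OF reach])
  then have finished: "phase s = Done" using bpc_progress stuck by blast
  then have "pending s = {}"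
    using inv by (simp add: bpc_inv_def phase_inv_def pending_def)
  then have bound: "ub s \<le> ereal (cost I y z)" if "sp_feasible I y z" for y z
    using inv that by (simp add: bpc_inv_def covered_def)
  then have "ub s \<noteq> \<infinity>" using feas by fastforce
  then obtain y z where "best s = Some (y, z)" "sp_feasible I y z" "ub s = ereal (cost I y z)"
    using inv by (auto simp: bpc_inv_def incumbent_inv_def)
  then show ?thesis
    using finished bound by (auto simp: sp_optimal_def)
qed

end

theorem theorem3:
  fixes I :: "('j, 'l, 's::linorder) network" and dual_aware :: bool
  assumes "wf_network I"
    and "fires I \<noteq> {}"
    and "\<And>j a. j \<in> crews I \<Longrightarrow> a \<in> crew_arcs I j \<Longrightarrow> 0 \<le> crew_cost I j a"
    and "\<And>g a. g \<in> fires I \<Longrightarrow> a \<in> fire_arcs I g \<Longrightarrow> 0 \<le> fire_cost I g a"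
    and "\<exists>y z. sp_feasible I y z"
  shows "\<exists>M0. \<forall>M\<ge>M0. \<forall>M'\<ge>M0.
     (\<nexists>run. run 0 = bpc_init \<and> (\<forall>n. bpc_step I M M' dual_aware (run n) (run (Suc n)))) \<and>
     (\<forall>s. (bpc_step I M M' dual_aware)\<^sup>*\<^sup>* bpc_init s \<and> (\<nexists>s'. bpc_step I M M' dual_aware s s') \<longrightarrow>
        phase s = Done \<and> (\<exists>y z. best s = Some (y, z) \<and> sp_optimal I y z))"
proof -
  interpret suppression_instance I
    using assms(1-4) by unfold_locales
  obtain m where gap: "price_gap m" using price_gap_exists by blast
  then have m: "0 < m" by (simp add: price_gap_def)
  \<comment> \<open>\<open>B\<close> exceeds the cost of every column because costs are nonnegative.\<close>
  define B where "B = (\<Sum>c\<in>all_columns I. column_cost I c) + 1"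
  have B: "column_cost I c < B" if "c \<in> all_columns I" for c
    using member_le_sum[OF that, of "column_cost I"] column_cost_nonneg finite_all_columns
    by (simp add: B_def)
  have "0 < B"
    unfolding B_def using column_cost_nonneg by (simp add: add_nonneg_pos sum_nonneg)
  define M0 where "M0 = max B (B / m)"
  have "large_constants I M M' m" if M: "M \<ge> M0" "M' \<ge> M0" for M M'
  proof unfold_locales
    show "0 < M" "0 < M'" using M \<open>0 < B\<close> by (auto simp: M0_def)
    have "B \<le> M' * m" using M m by (simp add: M0_def pos_divide_le_eq)
    then show "column_cost I c < M" "column_cost I c < M'" "column_cost I c < M' * m"
      if "c \<in> all_columns I" for c
      using B[OF that] M by (auto simp: M0_def)
  qed (rule gap)
  then show ?thesis
    using large_constants.bpc_terminates large_constants.bpc_final[OF _ assms(5)]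
    by (intro exI[of _ M0]) blast
qed

end
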